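(* Let $E\subset\mathcal E$ be Banach spaces with $E$ continuously and densely embedded in $\mathcal E$. Let $L$ (on $E$) and $\mathcal L$ (on $\mathcal E$) be closed unbounded linear operators generating $C_0$-semigroups $(S_L(t))_{t\ge0}$ on $E$ and $(S_{\mathcal L}(t))_{t\ge 0}$ on $\mathcal E$, with $\mathcal L_{|E}=L$. Assume that there are $A,B\in\mathscr C(E)$ and $\mathcal A,\mathcal B\in\mathscr C(\mathcal E)$ such that $$\mathcal L=\mathcal A+\mathcal B,\quad L=A+B,\quad A=\mathcal A_{|E},\quad B=\mathcal B_{|E},$$ and a real number $a\in\mathbb R$ such that (i) $B-a$ is hypodissipative on $E$ and $\mathcal B-a$ is hypodissipative on $\mathcal E$; (ii) $A\in\mathscr B(E)$ and $\mathcal A\in\mathscr B(\mathcal E)$; (iii) there are $n\ge1$ and $C_a>0$ such that for all $t\ge 0$ $$\big\|(\mathcal A S_{\mathcal B})^{( *n)}(t)\big\|_{\mathscr B(\mathcal E,E)}+\big\|(S_{\mathcal B}\mathcal A)^{( *n)}(t)\big\|_{\mathscr B(\mathcal E,E)}\le C_a\,e^{at}.$$ Then the following two properties are equivalent: (1) There are distinct $\xi_1,\dots,\xi_k\in\Delta_a$ and finite rank projectors $\Pi_{j,L}\in\mathscr B(E)$, $1\le j\le k$, which commute with $L$ and satisfy $\Sigma(L_{|\Pi_{j,L}})=\{\xi_j\}$, so that for any $a'>a$ there is a constant $C_{L,a'}>0$ with $$\forall\,t\ge0,\quad\Big\|S_L(t)-\sum_{j=1}^kS_L(t)\,\Pi_{j,L}\Big\|_{\mathscr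 B(E)}\le C_{L,a'}\,e^{a't}.$$ (2) There are distinct $\xi_1,\dots,\xi_k\in\Delta_a$ and finite rank projectors $\Pi_{j,\mathcal L}\in\mathscr B(\mathcal E)$, $1\le j\le k$, which commute with $\mathcal L$ and satisfy $\Sigma(\mathcal L_{|\Pi_{j,\mathcal L}})=\{\xi_j\}$, so that for any $a'>a$ there is a constant $C_{\mathcal L,a'}>0$ with $$\forall\,t\ge0,\quad\Big\|S_{\mathcal L}(t)-\sum_{j=1}^kS_{\mathcal L}(t)\,\Pi_{j,\mathcal L}\Big\|_{\mathscr B(\mathcal E)}\le C_{\mathcal L,a'}\,e^{a't}.$$
   Context: Notation. $\mathscr C(E)$: closed operators on the Banach space $E$; $\mathscr B(E)$: bounded operators on $E$; $\mathscr B(E,\mathcal E)$: bounded operators from $E$ to $\mathcal E$ (and $\mathscr B(\mathcal E,E)$ similarly). $\Sigma(\Lambda)$ is the spectrum of $\Lambda$. $\Delta_a:=\{z\in\mathbb C:\ \Re e\,z>a\}$. For a generator $\Lambda$, $S_\Lambda(t)=e^{t\Lambda}$ is its semigroup; since $\mathcal A$, $A$ are bounded, $\mathcal B=\mathcal L-\mathcal A$ and $B=L-A$ generate semigroups $S_{\mathcal B}$, $S_B$. The notation $\mathcal L_{|E}=L$ means that $L$ is the restriction of $\mathcal L$ to $E$ (the domain of $L$ is contained in that of $\mathcal L$ and $\mathcal L f=Lf$ there), and similarly for $\mathcal A_{|E}$, $\mathcal B_{|E}$. $L_{|\Pi}$ denotes the restriction of $L$ to the range of the projector $\Pi$. The case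 $k=0$ (empty family of $\xi_j$, no projector) is allowed. Dissipativity. $P\in\mathscr C(E)$ is dissipative for the norm $\|\cdot\|_E$ if for all $f$ in the domain of $P$ and all $f^*\in E^*$ with $\langle f,f^*\rangle=\|f\|_E^2=\|f^*\|_{E^*}^2$ one has $\Re e\,\langle Pf,f^*\rangle\le0$. $P$ is hypodissipative if it is dissipative for some norm equivalent to the canonical norm of $E$. Convolution. For operator-valued functions $S_1:\mathbb R_+\to\mathscr B(X_1,X_2)$ and $S_2:\mathbb R_+\to\mathscr B(X_2,X_3)$, $(S_2*S_1)(t):=\int_0^tS_2(s)S_1(t-s)\,ds$; $S^{( *1)}=S$ and $S^{( *\ell)}=S*S^{( *(\ell-1))}$ for $\ell\ge2$. $\mathcal A S_{\mathcal B}$ and $S_{\mathcal B}\mathcal A$ denote $t\mapsto\mathcal A S_{\mathcal B}(t)$ and $t\mapsto S_{\mathcal B}(t)\mathcal A$. *)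

theory Defs
  imports "HOL-Analysis.Analysis"
begin

class complex_banach = banach +
  fixes scaleC :: "complex \<Rightarrow> 'a \<Rightarrow> 'a"  (infixr \<open>*\<^sub>C\<close> 75)
  assumes scaleC_add_right: "c *\<^sub>C (x + y) = c *\<^sub>C x + c *\<^sub>C y"
    and scaleC_add_left: "(c + d) *\<^sub>C x = c *\<^sub>C x + d *\<^sub>C x"
    and scaleC_scaleC: "c *\<^sub>C d *\<^sub>C x = (c * d) *\<^sub>C x"
    and scaleC_of_real: "of_real r *\<^sub>C x = r *\<^sub>R x"
    and norm_scaleC: "norm (c *\<^sub>C x) = cmod c * norm x"

instantiation complex :: complex_banach
begin

definition scaleC_complex :: "complex \<Rightarrow> complex \<Rightarrow> complex"
  where "scaleC_complex c z = c * z"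

instance
  by standard (auto simp: scaleC_complex_def algebra_simps norm_mult scaleR_conv_of_real)

end

lemma vector_space_scaleC: "vector_space (scaleC :: complex \<Rightarrow> 'a::complex_banach \<Rightarrow> 'a)"
proof
  show "1 *\<^sub>C x = x" for x :: 'a
    using scaleC_of_real[of 1 x] by simp
qed (simp_all add: scaleC_add_right scaleC_add_left scaleC_scaleC)

definition bounded_clinear :: "('a::complex_banach \<Rightarrow> 'b::complex_banach) \<Rightarrow> bool"
  where "bounded_clinear T \<longleftrightarrow> bounded_linear T \<and> (\<forall>c x. T (c *\<^sub>C x) = c *\<^sub>C T x)"

definition cont_dense_embedding :: "('a::complex_banach \<Rightarrow> 'b::complex_banach) \<Rightarrow> bool"
  where "cont_dense_embedding \<iota> \<longleftrightarrow>
    bounded_clinear \<iota> \<and> inj \<iota> \<and> closure (range \<iota>) = UNIV"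

text \<open>An operator on a space is a partial map: \<open>P f = None\<close> outside the domain \<open>dom P\<close>,
  so that equality of operators includes equality of their domains.\<close>

type_synonym 'a operator = "'a \<rightharpoonup> 'a"

definition linear_op :: "'a::complex_banach operator \<Rightarrow> bool"
  where "linear_op P \<longleftrightarrow>
    module.subspace scaleC (dom P) \<and>
    (\<forall>f\<in>dom P. \<forall>g\<in>dom P. the (P (f + g)) = the (P f) + the (P g)) \<and>
    (\<forall>c. \<forall>f\<in>dom P. the (P (c *\<^sub>C f)) = c *\<^sub>C the (P f))"

definition closed_op :: "'a::complex_banach operator \<Rightarrow> bool"
  where "closed_op P \<longleftrightarrow> linear_op P \<and> closed (Map.graph P)"

definition bounded_op :: "'a::complex_banach operator \<Rightarrow> bool"
  where "bounded_op P \<longleftrightarrow> dom P = UNIV \<and> bounded_clinear (\<lambda>f. the (P f))"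

definition op_add :: "'a::complex_banach operator \<Rightarrow> 'a operator \<Rightarrow> 'a operator"
  where "op_add P Q =
    (\<lambda>f. if f \<in> dom P \<inter> dom Q then Some (the (P f) + the (Q f)) else None)"

definition op_shift :: "'a::complex_banach operator \<Rightarrow> real \<Rightarrow> 'a operator"
  where "op_shift P a = (\<lambda>f. if f \<in> dom P then Some (the (P f) - a *\<^sub>R f) else None)"

text \<open>\<open>P\<close> is the restriction of \<open>Q\<close> to the smaller space; the domain of \<open>P\<close> is only required
  to be contained in that of \<open>Q\<close>.\<close>

definition is_restriction ::
    "('a::complex_banach \<Rightarrow> 'b::complex_banach) \<Rightarrow> 'a operator \<Rightarrow> 'b operator \<Rightarrow> bool"
  where "is_restriction \<iota> P Q \<longleftrightarrow>
    (\<forall>f\<in>dom P. \<iota> f \<in> dom Q \<and> the (Q (\<iota> f)) = \<iota> (the (P f)))"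

text \<open>Spectrum of an operator acting in the closed subspace \<open>X\<close>, that is, whose domain and
  values are in \<open>X\<close>.\<close>

definition resolvent_set_on :: "'a::complex_banach set \<Rightarrow> 'a operator \<Rightarrow> complex set"
  where "resolvent_set_on X P =
    {z. bij_betw (\<lambda>f. z *\<^sub>C f - the (P f)) (dom P) X \<and>
        (\<exists>M. \<forall>f\<in>dom P. norm f \<le> M * norm (z *\<^sub>C f - the (P f)))}"

definition spectrum_on :: "'a::complex_banach set \<Rightarrow> 'a operator \<Rightarrow> complex set"
  where "spectrum_on X P = - resolvent_set_on X P"

definition finite_rank_projector :: "('a::complex_banach \<Rightarrow> 'a) \<Rightarrow> bool"
  where "finite_rank_projector \<pi> \<longleftrightarrow>
    bounded_clinear \<pi> \<and> \<pi> \<circ> \<pi> = \<pi> \<and> (\<exists>F. finite F \<and> range \<pi> \<subseteq> module.span scaleC F)"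

definition commutes_with :: "('a::complex_banach \<Rightarrow> 'a) \<Rightarrow> 'a operator \<Rightarrow> bool"
  where "commutes_with \<pi> P \<longleftrightarrow>
    (\<forall>f\<in>dom P. \<pi> f \<in> dom P \<and> the (P (\<pi> f)) = \<pi> (the (P f)))"

definition equivalent_norm :: "('a::complex_banach \<Rightarrow> real) \<Rightarrow> bool"
  where "equivalent_norm N \<longleftrightarrow>
    (\<forall>f. N f = 0 \<longleftrightarrow> f = 0) \<and>
    (\<forall>f g. N (f + g) \<le> N f + N g) \<and>
    (\<forall>c f. N (c *\<^sub>C f) = cmod c * N f) \<and>
    (\<exists>m>0. \<exists>M>0. \<forall>f. m * norm f \<le> N f \<and> N f \<le> M * norm f)"

definition dual_norm :: "('a::complex_banach \<Rightarrow> real) \<Rightarrow> ('a \<Rightarrow> complex) \<Rightarrow> real"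
  where "dual_norm N \<phi> = (SUP f\<in>{f. N f \<le> 1}. cmod (\<phi> f))"

definition dissipative :: "('a::complex_banach \<Rightarrow> real) \<Rightarrow> 'a operator \<Rightarrow> bool"
  where "dissipative N P \<longleftrightarrow>
    (\<forall>f\<in>dom P. \<forall>\<phi>. bounded_clinear \<phi> \<and> \<phi> f = of_real ((N f)\<^sup>2) \<and> (N f)\<^sup>2 = (dual_norm N \<phi>)\<^sup>2
      \<longrightarrow> Re (\<phi> (the (P f))) \<le> 0)"

definition hypodissipative :: "'a::complex_banach operator \<Rightarrow> bool"
  where "hypodissipative P \<longleftrightarrow> closed_op P \<and> (\<exists>N. equivalent_norm N \<and> dissipative N P)"

definition c0_semigroup :: "(real \<Rightarrow> 'a::complex_banach \<Rightarrow> 'a) \<Rightarrow> bool"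
  where "c0_semigroup S \<longleftrightarrow>
    (\<forall>t\<ge>0. bounded_clinear (S t)) \<and>
    S 0 = id \<and>
    (\<forall>s\<ge>0. \<forall>t\<ge>0. S (s + t) = S s \<circ> S t) \<and>
    (\<forall>f. continuous_on {0..} (\<lambda>t. S t f))"

definition generator :: "(real \<Rightarrow> 'a::complex_banach \<Rightarrow> 'a) \<Rightarrow> 'a operator"
  where "generator S = (\<lambda>f.
    if \<exists>g. ((\<lambda>h. (1 / h) *\<^sub>R (S h f - f)) \<longlongrightarrow> g) (at_right 0)
    then Some (Lim (at_right 0) (\<lambda>h. (1 / h) *\<^sub>R (S h f - f))) else None)"

definition generates_c0_semigroup :: "'a::complex_banach operator \<Rightarrow> bool"
  where "generates_c0_semigroup P \<longleftrightarrow> (\<exists>S. c0_semigroup S \<and> generator S = P)"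

text \<open>A semigroup is determined by its generator for nonnegative times; its values at negative
  times are arbitrary, hence \<open>SOME\<close> rather than \<open>THE\<close>.\<close>

definition semigroup_of :: "'a::complex_banach operator \<Rightarrow> real \<Rightarrow> 'a \<Rightarrow> 'a"
  where "semigroup_of P = (SOME S. c0_semigroup S \<and> generator S = P)"

text \<open>The convolution integral is understood in the strong sense, since semigroups are in
  general not continuous for the operator norm.\<close>

definition op_conv ::
    "(real \<Rightarrow> 'b::complex_banach \<Rightarrow> 'c::complex_banach) \<Rightarrow> (real \<Rightarrow> 'a::complex_banach \<Rightarrow> 'b) \<Rightarrow>
     real \<Rightarrow> 'a \<Rightarrow> 'c"
  where "op_conv S2 S1 t f = integral {0..t} (\<lambda>s. S2 s (S1 (t - s) f))"

fun conv_power ::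
    "(real \<Rightarrow> 'a::complex_banach \<Rightarrow> 'a) \<Rightarrow> nat \<Rightarrow> real \<Rightarrow> 'a \<Rightarrow> 'a"
  where
    "conv_power S (Suc 0) = S"
  | "conv_power S (Suc (Suc l)) = op_conv S (conv_power S (Suc l))"

text \<open>An operator \<open>T\<close> on the larger space belongs to the bounded operators from the larger to
  the smaller space; it is then regarded as the operator \<open>inv \<iota> \<circ> T\<close>.\<close>

definition bounded_into ::
    "('a::complex_banach \<Rightarrow> 'b::complex_banach) \<Rightarrow> ('b \<Rightarrow> 'b) \<Rightarrow> bool"
  where "bounded_into \<iota> T \<longleftrightarrow> range T \<subseteq> range \<iota> \<and> bounded_clinear (inv \<iota> \<circ> T)"

definition norm_into ::
    "('a::complex_banach \<Rightarrow> 'b::complex_banach) \<Rightarrow> ('b \<Rightarrow> 'b) \<Rightarrow> real"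
  where "norm_into \<iota> T = onorm (inv \<iota> \<circ> T)"

definition finite_rank_asymptotics :: "real \<Rightarrow> 'a::complex_banach operator \<Rightarrow> bool"
  where "finite_rank_asymptotics a P \<longleftrightarrow>
    (\<exists>(k::nat) (\<xi> :: nat \<Rightarrow> complex) (\<pi> :: nat \<Rightarrow> 'a \<Rightarrow> 'a).
      inj_on \<xi> {1..k} \<and>
      (\<forall>j\<in>{1..k}. Re (\<xi> j) > a \<and>
        finite_rank_projector (\<pi> j) \<and> commutes_with (\<pi> j) P \<and>
        spectrum_on (range (\<pi> j)) (P |` range (\<pi> j)) = {\<xi> j}) \<and>
      (\<forall>a'>a. \<exists>C>0. \<forall>t\<ge>0.
        onorm (\<lambda>f. semigroup_of P t f - (\<Sum>j=1..k. semigroup_of P t (\<pi> j f)))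
          \<le> C * exp (a' * t)))"

end

theory Submission
  imports Defs "HOL-Computational_Algebra.Fundamental_Theorem_Algebra"
begin

text \<open>
  Write \<open>S\<close>, \<open>S'\<close> for the semigroups of \<open>L\<close> and \<open>\<L>\<close>, \<open>U\<close>, \<open>U'\<close> for those of \<open>B\<close> and \<open>\<B>\<close>, and
  \<open>*\<close> for the convolution \<open>op_conv\<close>. The proof stays in the time domain, without Laplace
  transforms or contour integrals.

  First, \<open>B\<close> does generate a semigroup (\<open>bounded_perturbation_generates\<close>, a Volterra equation), and
  hypodissipativity bounds it by a multiple of \<open>exp (a t)\<close> (\<open>hypodissipative_exp_bounded\<close>; the
  definition of dissipativity speaks of support functionals, so the Hahn--Banach theorem enters
  here). The same holds for \<open>\<B>\<close>. Iterating the two Duhamel formulas gives, with \<open>H = A U\<close> and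
  \<open>K = U A\<close>,
  \<open>S = Y + S * H\<^sup>*\<^sup>n\<close> and \<open>S = Y + K\<^sup>*\<^sup>n * S\<close>
  with explicit \<open>Y\<close> that decay at every rate above \<open>a\<close>, and likewise on the large space
  (\<open>iterated_duhamel_right\<close>, \<open>iterated_duhamel_left\<close>). By hypothesis the convolution powers on the
  large space map into the small one, at rate \<open>a\<close>; they are even strongly continuous as families
  into the small space, because they are so on the dense subspace and the bounds are uniform
  (\<open>strongly_continuous_into\<close>). This makes all remainders integrals of continuous functions in the
  right space.

  On the range of a projector \<open>\<pi>\<close> with spectrum \<open>{\<xi>}\<close> the generator is \<open>\<xi>\<close> plus a nilpotent operator,
  so the semigroup can be run backwards there, by a family \<open>R\<close> with \<open>R 0 = \<pi>\<close> that decays like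
  \<open>exp (- b t)\<close> for each \<open>b < Re \<xi>\<close> (\<open>backward_family\<close>). Choose \<open>a < b\<close>. If \<open>\<pi>\<close> lives on the small
  space, apply \<open>R t\<close> to the first formula at time \<open>t\<close>: the term with \<open>Y\<close> vanishes as \<open>t\<close> tends to
  infinity, and \<open>\<pi>\<close> becomes the integral of \<open>R s\<close> composed with \<open>H\<^sup>*\<^sup>n s\<close>, which is defined on the
  large space: \<open>\<pi>\<close> extends to a map \<open>Q\<close> from the large to the small space (\<open>projector_extends\<close>).
  If \<open>\<pi>\<close> lives on the large space, apply the second formula to \<open>R t\<close>: now \<open>\<pi>\<close> is an integral of
  \<open>K\<^sup>*\<^sup>n s\<close> composed with \<open>R s\<close>, which takes values in the small space (\<open>projector_regularises\<close>).
  In both cases \<open>Q \<iota>\<close> and \<open>\<iota> Q\<close> are the corresponding projectors on the two spaces, and everything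
  that is required of one of them passes to the other (\<open>spectral_projector_transfer\<close>).

  It remains to subtract the projectors from the two formulas. What is left of the remainder is a
  convolution of the convolution power at rate \<open>a\<close> with the complementary semigroup of the \<^emph>\<open>other\<close>
  space, whose decay is the hypothesis (\<open>enlargement\<close>, \<open>shrinking\<close>).
\<close>

section \<open>Bounded complex-linear maps\<close>

lemma scaleC_diff_right: "c *\<^sub>C (x - y) = c *\<^sub>C x - c *\<^sub>C (y::'a::complex_banach)"
  using scaleC_add_right[of c "x - y" y] by (simp add: algebra_simps)

lemma scaleC_zero_right [simp]: "c *\<^sub>C 0 = (0::'a::complex_banach)"
  using scaleC_diff_right[of c 0 0] by simp

lemma bounded_clinearI:
  assumes "\<And>x y. T (x + y) = T x + T y" "\<And>c x. T (c *\<^sub>C x) = c *\<^sub>C T x"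
    and "\<And>x. norm (T x) \<le> K * norm x"
  shows "bounded_clinear T"
proof -
  have "bounded_linear T"
  proof (rule bounded_linear_intro[where K = K])
    show "T (r *\<^sub>R x) = r *\<^sub>R T x" for r x
      using assms(2)[of "of_real r" x] by (simp add: scaleC_of_real)
  qed (use assms in \<open>auto simp: mult.commute\<close>)
  then show ?thesis using assms(2) by (simp add: bounded_clinear_def)
qed

lemma
  assumes "bounded_clinear T"
  shows bounded_clinear_linear: "bounded_linear T"
    and bounded_clinear_add: "T (x + y) = T x + T y"
    and bounded_clinear_diff: "T (x - y) = T x - T y"
    and bounded_clinear_scaleC: "T (c *\<^sub>C x) = c *\<^sub>C T x"
    and bounded_clinear_scaleR: "T (r *\<^sub>R x) = r *\<^sub>R T x"
    and bounded_clinear_minus: "T (- x) = - T x"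
    and bounded_clinear_zero: "T 0 = 0"
    and bounded_clinear_sum: "T (sum g I) = (\<Sum>i\<in>I. T (g i))"
proof -
  interpret bounded_linear T using assms by (simp add: bounded_clinear_def)
  show "bounded_linear T" "T (x + y) = T x + T y" "T (x - y) = T x - T y"
    "T (c *\<^sub>C x) = c *\<^sub>C T x" "T (r *\<^sub>R x) = r *\<^sub>R T x" "T (- x) = - T x" "T 0 = 0"
    "T (sum g I) = (\<Sum>i\<in>I. T (g i))"
    using assms diff[of 0 x]
    by (auto simp: bounded_clinear_def add diff scaleR zero sum bounded_linear_axioms)
qed

lemma bounded_clinear_bound:
  assumes "bounded_clinear T"
  obtains K where "K > 0" "\<And>x. norm (T x) \<le> K * norm x"
  using bounded_linear.pos_bounded[OF bounded_clinear_linear[OF assms]]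
  by (metis mult.commute)

lemma bounded_clinear_onormI:
  assumes "bounded_clinear T" "onorm T \<le> K"
  shows "norm (T x) \<le> K * norm x"
  using onorm[OF bounded_clinear_linear[OF assms(1)], of x] assms(2)
  by (meson mult_right_mono norm_ge_zero order_trans)

lemma bounded_clinear_tendsto:
  "bounded_clinear T \<Longrightarrow> (u \<longlongrightarrow> l) F \<Longrightarrow> ((\<lambda>y. T (u y)) \<longlongrightarrow> T l) F"
  by (rule bounded_linear.tendsto[OF bounded_clinear_linear])

lemma bounded_clinear_continuous_on:
  "bounded_clinear T \<Longrightarrow> continuous_on S u \<Longrightarrow> continuous_on S (\<lambda>y. T (u y))"
  by (rule bounded_linear.continuous_on[OF bounded_clinear_linear])

lemma bounded_clinear_ident: "bounded_clinear (\<lambda>x. x)"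
  by (rule bounded_clinearI[where K = 1]) auto

lemma bounded_clinear_zero_map: "bounded_clinear (\<lambda>x. 0)"
  by (rule bounded_clinearI[where K = 0]) auto

lemma bounded_clinear_scaleC_map: "bounded_clinear (\<lambda>x::'a::complex_banach. c *\<^sub>C x)"
  by (rule bounded_clinearI[where K = "cmod c"])
    (auto simp: scaleC_add_right scaleC_scaleC norm_scaleC mult.commute)

lemma bounded_clinear_compose:
  assumes "bounded_clinear S" "bounded_clinear T"
  shows "bounded_clinear (\<lambda>x. S (T x))"
  using assms bounded_linear_compose[of S T] by (auto simp: bounded_clinear_def)

lemma bounded_clinear_add_map:
  assumes "bounded_clinear S" "bounded_clinear T"
  shows "bounded_clinear (\<lambda>x. S x + T x)"
  using assms bounded_linear_add[of S T] by (auto simp: bounded_clinear_def scaleC_add_right)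

lemma bounded_clinear_diff_map:
  assumes "bounded_clinear S" "bounded_clinear T"
  shows "bounded_clinear (\<lambda>x. S x - T x)"
  using assms bounded_linear_sub[of S T] by (auto simp: bounded_clinear_def scaleC_diff_right)

lemma bounded_clinear_sum_map:
  assumes "\<And>i. i \<in> I \<Longrightarrow> bounded_clinear (T i)"
  shows "bounded_clinear (\<lambda>x. \<Sum>i\<in>I. T i x)"
  using assms
  by (induction I rule: infinite_finite_induct)
    (auto intro: bounded_clinear_add_map bounded_clinear_zero_map)

lemma bounded_clinear_funpow:
  fixes T :: "'a::complex_banach \<Rightarrow> 'a"
  assumes "bounded_clinear T"
  shows "bounded_clinear (T ^^ k)"
proof (induction k)
  case (Suc k)
  then show ?case using bounded_clinear_compose[OF assms Suc] by (simp add: o_def)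
qed (simp add: id_def bounded_clinear_ident)

text \<open>This is how identities pass from the small space, or from the domain of a generator, to the
  whole space.\<close>

lemma bounded_clinear_eq_on_dense:
  assumes "bounded_clinear S" "bounded_clinear T" and "closure D = UNIV"
    and "\<And>x. x \<in> D \<Longrightarrow> S x = T x"
  shows "S x = T x"
proof -
  have "x \<in> closure D" using assms(3) by simp
  moreover have "continuous_on (closure D) (\<lambda>x. S x - T x)"
    by (intro continuous_on_diff bounded_clinear_continuous_on[OF assms(1)]
        bounded_clinear_continuous_on[OF assms(2)] continuous_on_id)
  moreover have "S x - T x = 0" if "x \<in> D" for x using assms(4)[OF that] by simp
  ultimately have "S x - T x = 0"
    using continuous_constant_on_closure[of D "\<lambda>x. S x - T x" 0 x] by blast
  then show ?thesis by simp
qed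

section \<open>Strongly continuous families of operators\<close>

definition exp_bounded :: "real \<Rightarrow> (real \<Rightarrow> 'a::complex_banach \<Rightarrow> 'b::complex_banach) \<Rightarrow> bool"
  where "exp_bounded b X \<longleftrightarrow> (\<exists>C. \<forall>t\<ge>0. \<forall>f. norm (X t f) \<le> C * exp (b * t) * norm f)"

text \<open>Semigroups are not continuous for the operator norm. Strongly continuous families with an
  exponential bound are closed under composition and convolution, and the convolution integrands are
  continuous functions of time.\<close>

definition sc_family :: "(real \<Rightarrow> 'a::complex_banach \<Rightarrow> 'b::complex_banach) \<Rightarrow> bool"
  where "sc_family X \<longleftrightarrow> (\<forall>t\<ge>0. bounded_clinear (X t)) \<and>
    (\<forall>f. continuous_on {0..} (\<lambda>t. X t f)) \<and> (\<exists>b. exp_bounded b X)"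

text \<open>The rates of the theorem are attained only up to an arbitrarily small loss, because
  convolutions produce powers of time; this predicate is stable under convolution.\<close>

definition decays_beyond :: "real \<Rightarrow> (real \<Rightarrow> 'a::complex_banach \<Rightarrow> 'b::complex_banach) \<Rightarrow> bool"
  where "decays_beyond a X \<longleftrightarrow> (\<forall>b>a. exp_bounded b X)"

lemma exp_boundedE:
  assumes "exp_bounded b X"
  obtains C where "C > 0" "\<And>t f. 0 \<le> t \<Longrightarrow> norm (X t f) \<le> C * exp (b * t) * norm f"
proof -
  from assms obtain C where C: "\<And>t f. 0 \<le> t \<Longrightarrow> norm (X t f) \<le> C * exp (b * t) * norm f"
    by (auto simp: exp_bounded_def)
  show ?thesis
  proof (rule that[of "max C 1"])
    fix t f assume "0 \<le> (t::real)"
    then have "norm (X t f) \<le> C * exp (b * t) * norm f" by (rule C)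
    also have "\<dots> \<le> max C 1 * exp (b * t) * norm f" by (intro mult_right_mono) auto
    finally show "norm (X t f) \<le> max C 1 * exp (b * t) * norm f" .
  qed simp
qed

lemma exp_bounded_mono:
  assumes "exp_bounded b X" "b \<le> c"
  shows "exp_bounded c X"
proof -
  obtain C where C: "C > 0" "\<And>t f. 0 \<le> t \<Longrightarrow> norm (X t f) \<le> C * exp (b * t) * norm f"
    by (rule exp_boundedE[OF assms(1)]) blast
  have "norm (X t f) \<le> C * exp (c * t) * norm f" if "0 \<le> t" for t f
    using C(2)[OF that, of f] assms(2) that C(1)
    by (smt (verit) exp_le_cancel_iff mult_left_mono mult_right_mono norm_ge_zero)
  then show ?thesis by (auto simp: exp_bounded_def)
qed

lemma exp_bounded_decays: "exp_bounded a X \<Longrightarrow> decays_beyond a X"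
  unfolding decays_beyond_def using exp_bounded_mono less_imp_le by blast

lemma sc_familyD:
  assumes "sc_family X"
  shows "0 \<le> t \<Longrightarrow> bounded_clinear (X t)"
    and "continuous_on {0..} (\<lambda>t. X t f)"
  using assms by (auto simp: sc_family_def)

lemma continuous_on_atLeast_0I:
  fixes u :: "real \<Rightarrow> 'a::topological_space"
  assumes "\<And>T. continuous_on {0..T} u"
  shows "continuous_on {0..} u"
  unfolding continuous_on_eq_continuous_within
proof
  fix t :: real assume "t \<in> {0..}"
  then have "continuous (at t within {0..t + 1}) u"
    using assms[of "t + 1"] unfolding continuous_on_eq_continuous_within by simp
  moreover have "at t within {0..} = at t within {0..t + 1}"
    by (rule at_within_nhd[of _ "{..<t + 1}"]) auto
  ultimately show "continuous (at t within {0..}) u" by simp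
qed

text \<open>The local bound upgrades strong continuity to joint continuity in time and vector.\<close>

lemma sc_family_tendsto:
  assumes X: "sc_family X" and g: "(g \<longlongrightarrow> \<tau>) F" "\<forall>\<^sub>F y in F. 0 \<le> g y" "0 \<le> \<tau>"
    and u: "(u \<longlongrightarrow> l) F"
  shows "((\<lambda>y. X (g y) (u y)) \<longlongrightarrow> X \<tau> l) F"
proof -
  obtain b C where C: "C > 0" "\<And>t f. 0 \<le> t \<Longrightarrow> norm (X t f) \<le> C * exp (b * t) * norm f"
    using X exp_boundedE unfolding sc_family_def by metis
  have 1: "((\<lambda>y. X (g y) l) \<longlongrightarrow> X \<tau> l) F"
    by (rule continuous_on_tendsto_compose[OF sc_familyD(2)[OF X] g(1)]) (use g in auto)
  have 2: "((\<lambda>y. C * exp (b * g y) * norm (u y - l)) \<longlongrightarrow> C * exp (b * \<tau>) * norm (l - l)) F"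
    by (intro tendsto_intros g u)
  have 3: "((\<lambda>y. X (g y) (u y - l)) \<longlongrightarrow> 0) F"
    by (rule Lim_null_comparison[where g = "\<lambda>y. C * exp (b * g y) * norm (u y - l)"])
      (use g(2) 2 C in \<open>auto elim: eventually_mono\<close>)
  have "\<forall>\<^sub>F y in F. X (g y) (u y - l) + X (g y) l = X (g y) (u y)"
    using g(2) by eventually_elim (metis bounded_clinear_diff diff_add_cancel sc_familyD(1)[OF X])
  then show ?thesis
    using tendsto_cong[of "\<lambda>y. X (g y) (u y - l) + X (g y) l" "\<lambda>y. X (g y) (u y)"]
      tendsto_add[OF 3 1] by simp
qed

lemma sc_family_continuous_on:
  assumes "sc_family X" "continuous_on T g" "\<And>y. y \<in> T \<Longrightarrow> 0 \<le> g y" "continuous_on T u"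
  shows "continuous_on T (\<lambda>y. X (g y) (u y))"
  unfolding continuous_on_def
proof
  fix y assume y: "y \<in> T"
  show "((\<lambda>y. X (g y) (u y)) \<longlongrightarrow> X (g y) (u y)) (at y within T)"
    by (rule sc_family_tendsto[OF assms(1)])
      (use assms y in \<open>auto simp: continuous_on_def eventually_at_filter\<close>)
qed

lemma exp_bounded_compose:
  assumes "bounded_clinear T" "exp_bounded b X"
  shows "exp_bounded b (\<lambda>t f. T (X t f))"
proof -
  obtain K where K: "K > 0" "\<And>x. norm (T x) \<le> K * norm x"
    using bounded_clinear_bound[OF assms(1)] by blast
  obtain C where C: "C > 0" "\<And>t f. 0 \<le> t \<Longrightarrow> norm (X t f) \<le> C * exp (b * t) * norm f"
    by (rule exp_boundedE[OF assms(2)]) blast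
  have "norm (T (X t f)) \<le> K * C * exp (b * t) * norm f" if "0 \<le> t" for t f
  proof -
    have "norm (T (X t f)) \<le> K * norm (X t f)" by (rule K)
    also have "\<dots> \<le> K * (C * exp (b * t) * norm f)" using K C that by (intro mult_left_mono) auto
    finally show ?thesis by (simp add: algebra_simps)
  qed
  then show ?thesis by (auto simp: exp_bounded_def)
qed

lemma exp_bounded_precompose:
  assumes "exp_bounded b X" "bounded_clinear T"
  shows "exp_bounded b (\<lambda>t f. X t (T f))"
proof -
  obtain K where K: "K > 0" "\<And>x. norm (T x) \<le> K * norm x"
    using bounded_clinear_bound[OF assms(2)] by blast
  obtain C where C: "C > 0" "\<And>t f. 0 \<le> t \<Longrightarrow> norm (X t f) \<le> C * exp (b * t) * norm f"
    by (rule exp_boundedE[OF assms(1)]) blast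
  have "norm (X t (T f)) \<le> C * K * exp (b * t) * norm f" if "0 \<le> t" for t f
  proof -
    have "norm (X t (T f)) \<le> C * exp (b * t) * norm (T f)" using C that by blast
    also have "\<dots> \<le> C * exp (b * t) * (K * norm f)" using K C that by (intro mult_left_mono) auto
    finally show ?thesis by (simp add: algebra_simps)
  qed
  then show ?thesis by (auto simp: exp_bounded_def)
qed

lemma exp_bounded_add:
  assumes "exp_bounded b X" "exp_bounded b Y"
  shows "exp_bounded b (\<lambda>t f. X t f + Y t f)"
proof -
  obtain C where C: "C > 0" "\<And>t f. 0 \<le> t \<Longrightarrow> norm (X t f) \<le> C * exp (b * t) * norm f"
    by (rule exp_boundedE[OF assms(1)]) blast
  obtain D where D: "D > 0" "\<And>t f. 0 \<le> t \<Longrightarrow> norm (Y t f) \<le> D * exp (b * t) * norm f"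
    by (rule exp_boundedE[OF assms(2)]) blast
  have "norm (X t f + Y t f) \<le> (C + D) * exp (b * t) * norm f" if "0 \<le> t" for t f
    using norm_triangle_ineq[of "X t f" "Y t f"] C(2)[OF that, of f] D(2)[OF that, of f]
    by (simp add: algebra_simps)
  then show ?thesis by (auto simp: exp_bounded_def)
qed

lemma decays_beyond_add:
  "decays_beyond a X \<Longrightarrow> decays_beyond a Y \<Longrightarrow> decays_beyond a (\<lambda>t f. X t f + Y t f)"
  by (simp add: decays_beyond_def exp_bounded_add)

lemma sc_family_compose:
  assumes "bounded_clinear T" "sc_family X"
  shows "sc_family (\<lambda>t f. T (X t f))"
  using assms exp_bounded_compose[OF assms(1)] unfolding sc_family_def
  by (auto intro: bounded_clinear_compose bounded_clinear_continuous_on)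

lemma sc_family_precompose:
  assumes "sc_family X" "bounded_clinear T"
  shows "sc_family (\<lambda>t f. X t (T f))"
  using assms exp_bounded_precompose[OF _ assms(2)] unfolding sc_family_def
  by (auto intro: bounded_clinear_compose)

lemma sc_family_add:
  assumes "sc_family X" "sc_family Y"
  shows "sc_family (\<lambda>t f. X t f + Y t f)"
proof -
  obtain b c where "exp_bounded b X" "exp_bounded c Y" using assms by (auto simp: sc_family_def)
  then have "exp_bounded (max b c) X" "exp_bounded (max b c) Y"
    by (auto intro: exp_bounded_mono)
  then have "exp_bounded (max b c) (\<lambda>t f. X t f + Y t f)" by (rule exp_bounded_add)
  then show ?thesis using assms unfolding sc_family_def
    by (auto intro!: bounded_clinear_add_map continuous_intros)
qed

section \<open>Convolution of families\<close>

text \<open>A fixed interval of integration lets continuity under the integral sign do the work for integrals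
  with a moving endpoint.\<close>

lemma integral_rescale_unit:
  fixes F :: "real \<Rightarrow> 'a::banach"
  assumes "0 \<le> t"
  shows "integral {0..t} F = t *\<^sub>R integral {0..1} (\<lambda>u. F (t * u))"
proof (cases "t = 0")
  case False
  then have "(\<lambda>x. x / t) ` {0..t} = {0..1}"
    using assms by (auto simp: image_iff intro!: bexI[of _ "_ * t"])
  then show ?thesis using integral_stretch_real[of t 0 t F] False assms by simp
qed simp

lemma conv_integrand_continuous:
  assumes "sc_family X" "sc_family Y"
  shows "continuous_on {0..t} (\<lambda>s. X s (Y (t - s) f))"
  by (rule sc_family_continuous_on[OF assms(1) _ _ sc_family_continuous_on[OF assms(2)]])
    (auto intro!: continuous_intros)

lemma conv_integrable:
  assumes "sc_family X" "sc_family Y"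
  shows "(\<lambda>s. X s (Y (t - s) f)) integrable_on {0..t}"
  by (rule integrable_continuous_real[OF conv_integrand_continuous[OF assms]])

lemma integral_bounded_clinear:
  assumes "bounded_clinear T" "F integrable_on S"
  shows "T (integral S F) = integral S (\<lambda>s. T (F s))"
  using integral_linear[OF assms(2) bounded_clinear_linear[OF assms(1)]] by (simp add: o_def)

text \<open>The slower factor is absorbed in the faster exponential. The gain \<open>1 / (c - b)\<close> is kept because it
  makes Volterra operators contractive.\<close>

lemma norm_op_conv_le:
  assumes X: "sc_family X" "\<And>t f. 0 \<le> t \<Longrightarrow> norm (X t f) \<le> C * exp (b * t) * norm f"
    and Y: "sc_family Y" "\<And>t f. 0 \<le> t \<Longrightarrow> norm (Y t f) \<le> D * exp (c * t) * norm f"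
    and C: "0 \<le> C" and D: "0 \<le> D" and bc: "b < c" and t: "0 \<le> t"
  shows "norm (op_conv X Y t f) \<le> C * D / (c - b) * exp (c * t) * norm f"
proof -
  define M where "M = C * D * exp (c * t) * norm f"
  have M: "0 \<le> M" using C D by (simp add: M_def)
  have *: "norm (X s (Y (t - s) f)) \<le> M * exp (- (c - b) * s)" if "s \<in> {0..t}" for s
  proof -
    have "norm (X s (Y (t - s) f)) \<le> C * exp (b * s) * norm (Y (t - s) f)"
      using X that by auto
    also have "\<dots> \<le> C * exp (b * s) * (D * exp (c * (t - s)) * norm f)"
      using C Y(2)[of "t - s" f] that by (intro mult_left_mono) auto
    also have "\<dots> = C * D * (exp (b * s) * exp (c * (t - s))) * norm f" by simp
    also have "exp (b * s) * exp (c * (t - s)) = exp (c * t) * exp (- (c - b) * s)"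
      by (simp add: exp_add[symmetric] algebra_simps)
    finally show ?thesis by (simp add: M_def mult_ac)
  qed
  define \<delta> where "\<delta> = c - b"
  have \<delta>: "0 < \<delta>" using bc by (simp add: \<delta>_def)
  define G where "G = (\<lambda>s. - M / \<delta> * exp (- \<delta> * s))"
  have G: "((\<lambda>s. M * exp (- (c - b) * s)) has_integral (G t - G 0)) {0..t}"
    unfolding \<delta>_def[symmetric] using t \<delta> unfolding G_def
    by (intro fundamental_theorem_of_calculus)
      (auto intro!: derivative_eq_intros simp: has_real_derivative_iff_has_vector_derivative[symmetric])
  have "norm (op_conv X Y t f) \<le> integral {0..t} (\<lambda>s. M * exp (- (c - b) * s))"
    unfolding op_conv_def
    by (rule integral_norm_bound_integral[OF conv_integrable[OF X(1) Y(1)] has_integral_integrable[OF G] *])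
  also have "\<dots> = G t - G 0" by (rule integral_unique[OF G])
  also have "\<dots> \<le> M / (c - b)" using M \<delta> by (simp add: G_def \<delta>_def[symmetric] field_simps)
  finally show ?thesis by (simp add: M_def)
qed

lemma exp_bounded_op_conv:
  assumes X: "sc_family X" "exp_bounded b X" and Y: "sc_family Y" "exp_bounded c Y" and bc: "b < c"
  shows "exp_bounded c (op_conv X Y)"
proof -
  obtain C where C: "C > 0" "\<And>t f. 0 \<le> t \<Longrightarrow> norm (X t f) \<le> C * exp (b * t) * norm f"
    by (rule exp_boundedE[OF X(2)]) blast
  obtain D where D: "D > 0" "\<And>t f. 0 \<le> t \<Longrightarrow> norm (Y t f) \<le> D * exp (c * t) * norm f"
    by (rule exp_boundedE[OF Y(2)]) blast
  have "norm (op_conv X Y t f) \<le> C * D / (c - b) * exp (c * t) * norm f" if "0 \<le> t" for t f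
    by (rule norm_op_conv_le[OF X(1) C(2) Y(1) D(2) _ _ bc that]) (use C D in auto)
  then show ?thesis unfolding exp_bounded_def by blast
qed

lemma decays_beyond_op_conv:
  assumes "sc_family X" "decays_beyond a X" "sc_family Y" "decays_beyond a Y"
  shows "decays_beyond a (op_conv X Y)"
  unfolding decays_beyond_def
proof (intro allI impI)
  fix c assume "a < c"
  then obtain b where "a < b" "b < c" using dense by blast
  then show "exp_bounded c (op_conv X Y)"
    using exp_bounded_op_conv[of X b Y c] assms exp_bounded_mono[of b Y c]
    by (auto simp: decays_beyond_def)
qed

lemma continuous_on_rescaled_conv:
  assumes X: "sc_family X" and Y: "sc_family Y"
  shows "continuous_on {0..} (\<lambda>t. integral {0..1} (\<lambda>u. X (t * u) (Y (t - t * u) f)))"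
proof -
  have "continuous_on ({0..} \<times> cbox 0 1) (\<lambda>(t, u). X (t * u) (Y (t - t * u) f))"
    unfolding case_prod_beta
  proof (rule sc_family_continuous_on[OF X _ _ sc_family_continuous_on[OF Y]])
    show "0 \<le> fst p * snd p" "0 \<le> fst p - fst p * snd p"
      if "p \<in> {0..} \<times> cbox 0 1" for p :: "real \<times> real"
      using that by (auto simp: mult_left_le)
  qed (intro continuous_on_mult continuous_on_diff continuous_on_fst continuous_on_snd
      continuous_on_id continuous_on_const)+
  then have "continuous_on {0..} (\<lambda>t. integral (cbox 0 1) (\<lambda>u. X (t * u) (Y (t - t * u) f)))"
    by (rule integral_continuous_on_param)
  then show ?thesis by (simp only: box_real)
qed

lemma sc_family_op_conv:
  assumes X: "sc_family X" and Y: "sc_family Y"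
  shows "sc_family (op_conv X Y)"
proof -
  obtain b c where "exp_bounded b X" "exp_bounded c Y" using assms by (auto simp: sc_family_def)
  then have "exp_bounded (max b c) X" "exp_bounded (max b c + 1) Y"
    by (auto intro: exp_bounded_mono)
  then have eb: "exp_bounded (max b c + 1) (op_conv X Y)"
    by (intro exp_bounded_op_conv[OF X _ Y]) auto
  have lin: "bounded_clinear (op_conv X Y t)" if t: "0 \<le> t" for t
  proof -
    note int = conv_integrable[OF X Y]
    obtain C where C: "\<And>t f. 0 \<le> t \<Longrightarrow> norm (op_conv X Y t f) \<le> C * exp ((max b c + 1) * t) * norm f"
      using eb by (auto simp: exp_bounded_def)
    show ?thesis
    proof (rule bounded_clinearI)
      fix f g
      have "integral {0..t} (\<lambda>s. X s (Y (t - s) (f + g)))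
          = integral {0..t} (\<lambda>s. X s (Y (t - s) f) + X s (Y (t - s) g))"
        by (rule integral_cong) (auto simp: bounded_clinear_add sc_familyD[OF X] sc_familyD[OF Y])
      then show "op_conv X Y t (f + g) = op_conv X Y t f + op_conv X Y t g"
        by (simp add: op_conv_def integral_add int)
    next
      fix z f
      have "integral {0..t} (\<lambda>s. X s (Y (t - s) (z *\<^sub>C f)))
          = integral {0..t} (\<lambda>s. z *\<^sub>C X s (Y (t - s) f))"
        by (rule integral_cong) (auto simp: bounded_clinear_scaleC sc_familyD[OF X] sc_familyD[OF Y])
      then show "op_conv X Y t (z *\<^sub>C f) = z *\<^sub>C op_conv X Y t f"
        by (simp add: op_conv_def integral_bounded_clinear[OF bounded_clinear_scaleC_map int])
    qed (use C[OF t] in auto)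
  qed
  have cont: "continuous_on {0..} (\<lambda>t. op_conv X Y t f)" for f
  proof -
    have "continuous_on {0..} (\<lambda>t. t *\<^sub>R integral {0..1} (\<lambda>u. X (t * u) (Y (t - t * u) f)))"
      by (rule continuous_on_scaleR[OF continuous_on_id continuous_on_rescaled_conv[OF X Y]])
    then show ?thesis
      by (rule continuous_on_eq) (auto simp: op_conv_def intro: integral_rescale_unit[symmetric])
  qed
  show ?thesis using lin cont eb by (auto simp: sc_family_def)
qed

lemma op_conv_compose:
  assumes "bounded_clinear T" "sc_family X" "sc_family Y"
  shows "T (op_conv X Y t f) = op_conv (\<lambda>t f. T (X t f)) Y t f"
  unfolding op_conv_def by (rule integral_bounded_clinear[OF assms(1) conv_integrable[OF assms(2,3)]])

lemma op_conv_add_left: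
  assumes "sc_family X" "sc_family X'" "sc_family Y"
  shows "op_conv (\<lambda>t f. X t f + X' t f) Y t f = op_conv X Y t f + op_conv X' Y t f"
  unfolding op_conv_def using assms by (intro integral_add conv_integrable)

lemma op_conv_add_right:
  assumes "sc_family X" "sc_family Y" "sc_family Y'"
  shows "op_conv X (\<lambda>t f. Y t f + Y' t f) t f = op_conv X Y t f + op_conv X Y' t f"
proof -
  have "integral {0..t} (\<lambda>s. X s (Y (t - s) f + Y' (t - s) f))
      = integral {0..t} (\<lambda>s. X s (Y (t - s) f) + X s (Y' (t - s) f))"
    by (rule integral_cong) (auto simp: bounded_clinear_add sc_familyD[OF assms(1)])
  then show ?thesis
    unfolding op_conv_def using assms by (simp add: integral_add conv_integrable)
qed

lemma op_conv_cong:
  assumes "\<And>s f. 0 \<le> s \<Longrightarrow> X s f = X' s f" "\<And>s f. 0 \<le> s \<Longrightarrow> Y s f = Y' s f"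
  shows "op_conv X Y t f = op_conv X' Y' t f"
  unfolding op_conv_def by (rule integral_cong) (use assms in auto)

lemma op_conv_reflect: "op_conv X Y t f = integral {0..t} (\<lambda>s. X (t - s) (Y s f))"
proof -
  define F where "F = (\<lambda>s. X (t - s) (Y s f))"
  have "integral {0..t} F = integral {- t..- 0} (\<lambda>x. F (- x))"
    by (rule Henstock_Kurzweil_Integration.integral_reflect_real[symmetric])
  also have "\<dots> = integral {0..t} (\<lambda>x. F (t - x))"
    using integral_shift_Icc_real[of 0 t "\<lambda>x. F (- x)" "- t"] by (simp add: o_def)
  finally show ?thesis unfolding F_def op_conv_def by simp
qed

lemma quadratic_increments_constant:
  fixes D :: "real \<Rightarrow> 'a::real_normed_vector"
  assumes "\<And>t u. 0 \<le> t \<Longrightarrow> t \<le> u \<Longrightarrow> u \<le> T \<Longrightarrow> norm (D u - D t) \<le> c * (u - t)\<^sup>2" and "0 \<le> T"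
  shows "D T = D 0"
proof -
  have inc: "norm (D u - D t) \<le> c * (u - t)\<^sup>2" if "t \<in> {0..T}" "u \<in> {0..T}" for t u
    using assms(1)[of t u] assms(1)[of u t] that norm_minus_commute[of "D u" "D t"]
      power2_commute[of u t] by (cases "t \<le> u") auto
  have "(D has_derivative (\<lambda>h. 0)) (at x within {0..T})" if "x \<in> {0..T}" for x
    unfolding has_derivative_iff_norm
  proof
    have *: "norm (D y - D x) / \<bar>y - x\<bar> \<le> c * \<bar>y - x\<bar>" if "y \<in> {0..T}" "y \<noteq> x" for y
    proof -
      have "norm (D y - D x) \<le> (c * \<bar>y - x\<bar>) * \<bar>y - x\<bar>"
        using inc[OF \<open>x \<in> {0..T}\<close> that(1)] by (simp add: power2_eq_square mult.assoc)
      then show ?thesis using that(2) by (simp add: divide_le_eq)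
    qed
    have "((\<lambda>y. c * \<bar>y - x\<bar>) \<longlongrightarrow> c * \<bar>x - x\<bar>) (at x within {0..T})"
      by (intro tendsto_intros)
    then have lim: "((\<lambda>y. c * \<bar>y - x\<bar>) \<longlongrightarrow> 0) (at x within {0..T})" by simp
    show "((\<lambda>y. norm (D y - D x - 0) / norm (y - x)) \<longlongrightarrow> 0) (at x within {0..T})"
      by (rule Lim_null_comparison[OF _ lim]) (use * in \<open>auto simp: eventually_at_filter\<close>)
  qed simp
  then obtain k where "\<forall>x\<in>{0..T}. D x = k"
    using has_derivative_zero_constant[of "{0..T}" D] by auto
  then show ?thesis using assms(2) by auto
qed

lemma continuous_on_integral_upper:
  fixes \<psi> :: "real \<Rightarrow> real \<Rightarrow> 'a::banach"
  assumes "continuous_on UNIV (\<lambda>p. \<psi> (fst p) (snd p))"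
  shows "continuous_on (UNIV \<times> {0..}) (\<lambda>p. integral {0..snd p} (\<psi> (fst p)))"
proof -
  have "continuous_on ((UNIV \<times> {0::real..}) \<times> cbox 0 1)
      (\<lambda>q. (fst (fst q) :: real, snd (fst q) * (snd q :: real)))"
    by (intro continuous_on_mult continuous_on_Pair continuous_on_fst continuous_on_snd continuous_on_id)
  from continuous_on_compose2[OF assms this]
  have "continuous_on ((UNIV \<times> {0..}) \<times> cbox 0 1) (\<lambda>(p, u). \<psi> (fst p) (snd p * u))"
    by (simp add: case_prod_beta)
  then have "continuous_on (UNIV \<times> {0..}) (\<lambda>p. integral (cbox 0 1) (\<lambda>u. \<psi> (fst p) (snd p * u)))"
    by (rule integral_continuous_on_param)
  then have "continuous_on (UNIV \<times> {0..})
      (\<lambda>p. snd p *\<^sub>R integral {0..1} (\<lambda>u. \<psi> (fst p) (snd p * u)))"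
    unfolding box_real by (rule continuous_on_scaleR[OF continuous_on_snd[OF continuous_on_id]])
  then show ?thesis
    by (rule continuous_on_eq) (auto intro: integral_rescale_unit[symmetric])
qed

text \<open>Fubini on a triangle, for a function with values in a Banach space. The double
  integral over the square of side \<open>t\<close>, less the integrals over its two halves, has increments of
  second order in \<open>t\<close>, hence is constant.\<close>

lemma integral_swap_triangle_UNIV:
  fixes \<psi> :: "real \<Rightarrow> real \<Rightarrow> 'a::banach"
  assumes cont: "continuous_on UNIV (\<lambda>p. \<psi> (fst p) (snd p))" and T: "0 \<le> T"
  shows "integral {0..T} (\<lambda>s. integral {0..s} (\<lambda>r. \<psi> s r)) =
    integral {0..T} (\<lambda>r. integral {r..T} (\<lambda>s. \<psi> s r))"
proof -
  define K where "K = (\<lambda>s t. integral {0..t} (\<lambda>r. \<psi> s r))"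
  define J where "J = (\<lambda>r t. integral {0..t} (\<lambda>s. \<psi> s r))"
  have contc: "continuous_on S (\<lambda>y. \<psi> (g y) (h y))"
    if "continuous_on S g" "continuous_on S h" for S :: "'c::topological_space set" and g h
    using continuous_on_compose2[OF cont continuous_on_Pair[OF that]] by simp
  have cont': "continuous_on UNIV (\<lambda>p. \<psi> (snd p) (fst p))"
    by (rule contc) (intro continuous_on_fst continuous_on_snd continuous_on_id)+
  have K_cont: "continuous_on S (\<lambda>y. K (g y) (h y))"
    if "continuous_on S g" "continuous_on S h" "\<And>y. y \<in> S \<Longrightarrow> 0 \<le> h y" for S :: "real set" and g h
    using continuous_on_compose2[OF continuous_on_integral_upper[OF cont] continuous_on_Pair[OF that(1,2)]]
      that(3) by (auto simp: K_def)
  have J_cont: "continuous_on S (\<lambda>y. J (g y) (h y))"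
    if "continuous_on S g" "continuous_on S h" "\<And>y. y \<in> S \<Longrightarrow> 0 \<le> h y" for S :: "real set" and g h
    using continuous_on_compose2[OF continuous_on_integral_upper[OF cont'] continuous_on_Pair[OF that(1,2)]]
      that(3) by (auto simp: J_def)
  have int1: "(\<lambda>r. \<psi> s r) integrable_on {c..d}" "(\<lambda>s. \<psi> s r) integrable_on {c..d}" for s r c d
    by (intro integrable_continuous_real contc continuous_on_const continuous_on_id)+
  have swap: "integral {c..d} (\<lambda>s. integral {p..q} (\<psi> s)) = integral {p..q} (\<lambda>r. integral {c..d} (\<lambda>s. \<psi> s r))"
    for c d p q
  proof -
    have "continuous_on (cbox (c, p) (d, q)) (\<lambda>(s, r). \<psi> s r)"
      unfolding case_prod_beta
      by (rule contc) (intro continuous_on_fst continuous_on_snd continuous_on_id)+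
    from integral_swap_continuous[OF this] show ?thesis by simp
  qed
  have K_split: "K s u - K s t = integral {t..u} (\<psi> s)" if "0 \<le> t" "t \<le> u" for s t u
    using Henstock_Kurzweil_Integration.integral_combine[OF that int1(1)[of s 0 u]] by (auto simp: K_def algebra_simps)
  have J_split: "J r u - J r t = integral {t..u} (\<lambda>s. \<psi> s r)" if "0 \<le> t" "t \<le> u" for r t u
    using Henstock_Kurzweil_Integration.integral_combine[OF that int1(2)[of r 0 u]] by (auto simp: J_def algebra_simps)
  obtain M where M: "\<And>s r. s \<in> {0..T} \<Longrightarrow> r \<in> {0..T} \<Longrightarrow> norm (\<psi> s r) \<le> M"
  proof -
    have "compact ((\<lambda>p. \<psi> (fst p) (snd p)) ` ({0..T} \<times> {0..T}))"
      by (intro compact_continuous_image continuous_on_subset[OF cont] compact_Times) auto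
    then have "bounded ((\<lambda>p. \<psi> (fst p) (snd p)) ` ({0..T} \<times> {0..T}))" by (rule compact_imp_bounded)
    then show ?thesis using that unfolding bounded_iff by force
  qed
  have K_small: "norm (K s u - K s t) \<le> M * (u - t)" if "s \<in> {0..T}" "0 \<le> t" "t \<le> u" "u \<le> T" for s t u
    unfolding K_split[OF that(2,3)]
    by (rule integral_bound[OF that(3)]) (use that M in \<open>auto intro!: contc continuous_on_const continuous_on_id\<close>)
  have J_small: "norm (J r u - J r t) \<le> M * (u - t)" if "r \<in> {0..T}" "0 \<le> t" "t \<le> u" "u \<le> T" for r t u
    unfolding J_split[OF that(2,3)]
    by (rule integral_bound[OF that(3)]) (use that M in \<open>auto intro!: contc continuous_on_const continuous_on_id\<close>)
  \<comment> \<open>The square of side \<open>t\<close> minus its two halves; \<open>K s s\<close> and \<open>J s s\<close> are the row and the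
    column that end at the diagonal point \<open>(s, s)\<close>.\<close>
  define E where "E = (\<lambda>t. integral {0..t} (\<lambda>s. K s t) - integral {0..t} (\<lambda>s. K s s + J s s))"
  have "E T = E 0"
  proof (rule quadratic_increments_constant[OF _ T])
    fix t u assume tu: "0 \<le> t" "t \<le> u" "u \<le> T"
    have i1: "(\<lambda>s. K s v) integrable_on {c..d}" "(\<lambda>s. J s v) integrable_on {c..d}" if "0 \<le> v" for v c d
      using that by (intro integrable_continuous_real K_cont J_cont continuous_on_const continuous_on_id; simp)+
    have i2: "(\<lambda>s. K s s) integrable_on {c..d}" "(\<lambda>s. J s s) integrable_on {c..d}" if "0 \<le> c" for c d
      using that by (intro integrable_continuous_real K_cont J_cont continuous_on_const continuous_on_id; simp)+
    have "integral {0..u} (\<lambda>s. K s u) = integral {0..t} (\<lambda>s. K s u) + integral {t..u} (\<lambda>s. K s u)"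
      using Henstock_Kurzweil_Integration.integral_combine[OF tu(1,2) i1(1)[of u]] tu by simp
    moreover have "integral {0..u} (\<lambda>s. K s s + J s s)
        = integral {0..t} (\<lambda>s. K s s + J s s) + integral {t..u} (\<lambda>s. K s s + J s s)"
      using Henstock_Kurzweil_Integration.integral_combine[OF tu(1,2) integrable_add[OF i2[of 0]]] by simp
    moreover have "integral {0..t} (\<lambda>s. K s u) - integral {0..t} (\<lambda>s. K s t) = integral {t..u} (\<lambda>r. J r t)"
    proof -
      have "integral {0..t} (\<lambda>s. K s u) - integral {0..t} (\<lambda>s. K s t) = integral {0..t} (\<lambda>s. K s u - K s t)"
        using tu by (simp add: integral_diff i1)
      also have "\<dots> = integral {0..t} (\<lambda>s. integral {t..u} (\<psi> s))" by (simp add: K_split tu)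
      finally show ?thesis by (simp add: swap J_def)
    qed
    ultimately have "E u - E t = integral {t..u} (\<lambda>s. K s u) + integral {t..u} (\<lambda>r. J r t)
        - integral {t..u} (\<lambda>s. K s s + J s s)"
      by (simp add: E_def algebra_simps)
    also have "\<dots> = integral {t..u} (\<lambda>s. (K s u - K s s) - (J s s - J s t))"
      using tu by (simp add: integral_add integral_diff integrable_diff integrable_add i1 i2)
    also have "norm \<dots> \<le> 2 * M * (u - t) * (u - t)"
    proof (rule integral_bound[OF tu(2)])
      show "continuous_on {t..u} (\<lambda>s. (K s u - K s s) - (J s s - J s t))"
        using tu by (intro continuous_on_diff K_cont J_cont continuous_on_const continuous_on_id) auto
      fix s assume s: "s \<in> {t..u}"
      have "norm (\<psi> s s) \<le> M" using M[of s s] s tu by auto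
      then have "0 \<le> M" using norm_ge_zero[of "\<psi> s s"] by linarith
      have "norm ((K s u - K s s) - (J s s - J s t)) \<le> norm (K s u - K s s) + norm (J s s - J s t)"
        by (rule norm_triangle_ineq4)
      also have "\<dots> \<le> M * (u - s) + M * (s - t)"
        by (intro add_mono K_small J_small) (use s tu in auto)
      also have "\<dots> = M * (u - t)" by (simp add: algebra_simps)
      also have "\<dots> \<le> 2 * M * (u - t)" using \<open>0 \<le> M\<close> tu by (simp add: algebra_simps mult_left_mono)
      finally show "norm ((K s u - K s s) - (J s s - J s t)) \<le> 2 * M * (u - t)" .
    qed
    finally show "norm (E u - E t) \<le> (2 * M) * (u - t)\<^sup>2" by (simp add: power2_eq_square)
  qed
  then have "integral {0..T} (\<lambda>s. K s T) = integral {0..T} (\<lambda>s. K s s + J s s)" by (simp add: E_def)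
  moreover have "integral {0..T} (\<lambda>s. K s T) = integral {0..T} (\<lambda>r. J r T)"
    using swap[of 0 T 0 T] by (simp add: K_def J_def)
  moreover have iT: "(\<lambda>s. K s s) integrable_on {0..T}" "(\<lambda>s. J s s) integrable_on {0..T}"
    "(\<lambda>s. J s T) integrable_on {0..T}"
    using T by (intro integrable_continuous_real K_cont J_cont continuous_on_const continuous_on_id; simp)+
  ultimately have "integral {0..T} (\<lambda>s. K s s) = integral {0..T} (\<lambda>r. J r T - J r r)"
    by (simp add: integral_add integral_diff algebra_simps)
  also have "\<dots> = integral {0..T} (\<lambda>r. integral {r..T} (\<lambda>s. \<psi> s r))"
    by (rule integral_cong) (simp add: J_split)
  finally show ?thesis by (simp add: K_def)
qed

text \<open>Clamping both arguments extends \<open>\<phi>\<close> continuously from the triangle to the plane.\<close>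

lemma integral_swap_triangle:
  fixes \<phi> :: "real \<Rightarrow> real \<Rightarrow> 'a::banach"
  assumes cont: "continuous_on {p. 0 \<le> snd p \<and> snd p \<le> fst p \<and> fst p \<le> T} (\<lambda>p. \<phi> (fst p) (snd p))"
    and T: "0 \<le> T"
  shows "integral {0..T} (\<lambda>s. integral {0..s} (\<lambda>r. \<phi> s r)) =
    integral {0..T} (\<lambda>r. integral {r..T} (\<lambda>s. \<phi> s r))"
proof -
  define cl where "cl = (\<lambda>s. min T (max 0 s))"
  define \<psi> where "\<psi> = (\<lambda>s r. \<phi> (cl s) (min (max 0 r) (cl s)))"
  have cl: "0 \<le> cl s" "cl s \<le> T" "s \<in> {0..T} \<Longrightarrow> cl s = s" for s using T by (auto simp: cl_def)
  have "continuous_on UNIV (\<lambda>p. \<psi> (fst p) (snd p))"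
    unfolding \<psi>_def
    by (rule continuous_on_compose2[OF cont,
          where f = "\<lambda>p. (cl (fst p), min (max 0 (snd p)) (cl (fst p)))", simplified])
      (auto simp: cl cl_def T intro!: continuous_on_Pair continuous_on_min continuous_on_max
        continuous_on_const continuous_on_fst continuous_on_snd continuous_on_id)
  from integral_swap_triangle_UNIV[OF this T]
  have "integral {0..T} (\<lambda>s. integral {0..s} (\<lambda>r. \<psi> s r)) =
    integral {0..T} (\<lambda>r. integral {r..T} (\<lambda>s. \<psi> s r))" .
  moreover have "integral {0..T} (\<lambda>s. integral {0..s} (\<lambda>r. \<psi> s r))
      = integral {0..T} (\<lambda>s. integral {0..s} (\<lambda>r. \<phi> s r))"
    by (intro integral_cong) (auto simp: \<psi>_def cl min_def)
  moreover have "integral {0..T} (\<lambda>r. integral {r..T} (\<lambda>s. \<psi> s r))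
      = integral {0..T} (\<lambda>r. integral {r..T} (\<lambda>s. \<phi> s r))"
    by (intro integral_cong) (auto simp: \<psi>_def cl min_def)
  ultimately show ?thesis by simp
qed

text \<open>Both sides integrate \<open>X r (Y (s - r) (Z (t - s) f))\<close> over the triangle \<open>0 \<le> r \<le> s \<le> t\<close>.\<close>

lemma op_conv_assoc:
  assumes X: "sc_family X" and Y: "sc_family Y" and Z: "sc_family Z" and t: "0 \<le> t"
  shows "op_conv (op_conv X Y) Z t f = op_conv X (op_conv Y Z) t f"
proof -
  define \<phi> where "\<phi> = (\<lambda>s r. X r (Y (s - r) (Z (t - s) f)))"
  have "continuous_on {p. 0 \<le> snd p \<and> snd p \<le> fst p \<and> fst p \<le> t} (\<lambda>p. \<phi> (fst p) (snd p))"
    unfolding \<phi>_def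
    by (rule sc_family_continuous_on[OF X _ _ sc_family_continuous_on[OF Y _ _ sc_family_continuous_on[OF Z]]])
      (auto intro!: continuous_on_diff continuous_on_const continuous_on_fst continuous_on_snd continuous_on_id)
  then have "integral {0..t} (\<lambda>s. integral {0..s} (\<lambda>r. \<phi> s r)) =
      integral {0..t} (\<lambda>r. integral {r..t} (\<lambda>s. \<phi> s r))"
    by (rule integral_swap_triangle[OF _ t])
  moreover have "op_conv (op_conv X Y) Z t f = integral {0..t} (\<lambda>s. integral {0..s} (\<lambda>r. \<phi> s r))"
    by (simp add: op_conv_def \<phi>_def)
  moreover have "op_conv X (op_conv Y Z) t f = integral {0..t} (\<lambda>r. integral {r..t} (\<lambda>s. \<phi> s r))"
    unfolding op_conv_def
  proof (rule integral_cong)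
    fix r assume r: "r \<in> {0..t}"
    have "X r (integral {0..t - r} (\<lambda>s. Y s (Z (t - r - s) f)))
        = integral {0..t - r} (\<lambda>s. X r (Y s (Z (t - r - s) f)))"
      using r by (intro integral_bounded_clinear conv_integrable Y Z sc_familyD[OF X]) auto
    also have "\<dots> = integral {0..t - r} ((\<lambda>s. \<phi> s r) \<circ> (+) r)"
      by (simp add: \<phi>_def o_def algebra_simps)
    also have "\<dots> = integral {r..t} (\<lambda>s. \<phi> s r)" by (subst integral_shift_Icc_real) simp
    finally show "X r (integral {0..t - r} (\<lambda>s. Y s (Z (t - r - s) f))) = integral {r..t} (\<lambda>s. \<phi> s r)" .
  qed
  ultimately show ?thesis by simp
qed

section \<open>The uniform boundedness principle\<close>

text \<open>Without a uniform bound the open sets \<open>U n\<close> of points at which the family exceeds \<open>n\<close> would all be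
  dense, and by Baire they would have a common point.\<close>

lemma uniform_boundedness:
  fixes T :: "'i \<Rightarrow> 'a::banach \<Rightarrow> 'b::real_normed_vector"
  assumes lin: "\<And>i. i \<in> I \<Longrightarrow> bounded_linear (T i)"
    and pointwise: "\<And>x. \<exists>K. \<forall>i\<in>I. norm (T i x) \<le> K"
  shows "\<exists>K. \<forall>i\<in>I. \<forall>x. norm (T i x) \<le> K * norm x"
proof -
  define U where "U = (\<lambda>n::nat. \<Union>i\<in>I. {x. real n < norm (T i x)})"
  have opn: "open (U n)" for n
    unfolding U_def
    by (intro open_UN ballI open_Collect_less continuous_on_const continuous_on_norm
        linear_continuous_on lin)
  have empty: "\<Inter>(range U) = {}"
  proof -
    have "\<exists>n. x \<notin> U n" for x
    proof -
      obtain K where "\<forall>i\<in>I. norm (T i x) \<le> K" using pointwise by blast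
      moreover obtain n :: nat where "K \<le> real n" using real_arch_simple by blast
      ultimately have "x \<notin> U n" unfolding U_def by (auto simp: not_less intro: order_trans)
      then show ?thesis ..
    qed
    then show ?thesis by auto
  qed
  have "\<exists>n. closure (U n) \<noteq> UNIV"
  proof (rule ccontr)
    assume "\<not> ?thesis"
    then have "Met_TC.mtopology closure_of \<Inter>(range U) = UNIV"
      by (intro Met_TC.metric_Baire_category) (auto simp: opn complete_UNIV)
    then show False using empty by simp
  qed
  then obtain n x where "x \<notin> closure (U n)" by blast
  then obtain r where r: "r > 0" "\<And>y. dist y x < r \<Longrightarrow> y \<notin> U n"
    unfolding closure_approachable by force
  have small: "norm (T i y) \<le> n" if "i \<in> I" "dist y x < r" for i y
    using r(2)[OF that(2)] that(1) by (auto simp: U_def not_less)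
  have "norm (T i h) \<le> (4 * n / r) * norm h" if i: "i \<in> I" for i h
  proof (cases "h = 0")
    case True
    then show ?thesis using lin[OF i] by (simp add: linear_simps)
  next
    case False
    define c where "c = r / (2 * norm h)"
    have c: "c > 0" using False r by (simp add: c_def)
    have "dist (x + c *\<^sub>R h) x < r" using False r by (simp add: dist_norm c_def)
    moreover have "T i (c *\<^sub>R h) = T i (x + c *\<^sub>R h) - T i x"
      using lin[OF i] by (simp add: linear_simps)
    ultimately have "norm (c *\<^sub>R T i h) \<le> real n + real n"
      using small[OF i, of "x + c *\<^sub>R h"] small[OF i, of x] r
        norm_triangle_ineq4[of "T i (x + c *\<^sub>R h)" "T i x"] lin[OF i]
      by (simp add: linear_simps)
    then have "c * norm (T i h) \<le> 2 * real n" using c by simp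
    then show ?thesis using c False r by (simp add: c_def field_simps)
  qed
  then show ?thesis by blast
qed

section \<open>The Hahn--Banach theorem and dissipativity\<close>

definition sublinear :: "('a::real_vector \<Rightarrow> real) \<Rightarrow> bool"
  where "sublinear p \<longleftrightarrow> (\<forall>x y. p (x + y) \<le> p x + p y) \<and> (\<forall>r\<ge>0. \<forall>x. p (r *\<^sub>R x) = r * p x)"

lemma sublinearD:
  assumes "sublinear p"
  shows "p (x + y) \<le> p x + p y" "0 \<le> r \<Longrightarrow> p (r *\<^sub>R x) = r * p x" "p 0 = 0" "- p (- x) \<le> p x"
proof -
  show 1: "p (x + y) \<le> p x + p y" for x y using assms by (simp add: sublinear_def)
  show 2: "0 \<le> r \<Longrightarrow> p (r *\<^sub>R x) = r * p x" for r x using assms by (simp add: sublinear_def)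
  show 3: "p 0 = 0" using 2[of 0 0] by simp
  show "- p (- x) \<le> p x" using 1[of x "- x"] 3 by simp
qed

text \<open>The modification of \<open>p\<close> in the direction \<open>y\<close>: still sublinear and below \<open>p\<close>, but at most
  \<open>- p y\<close> at \<open>- y\<close>, as a linear functional with value \<open>p y\<close> at \<open>y\<close> must be.\<close>

definition reduce :: "('a::real_vector \<Rightarrow> real) \<Rightarrow> 'a \<Rightarrow> 'a \<Rightarrow> real"
  where "reduce p y x = (INF t\<in>{0..}. p (x + t *\<^sub>R y) - t * p y)"

lemma reduce_sublinear:
  assumes p: "sublinear p"
  shows "sublinear (reduce p y)" and "reduce p y x \<le> p x" and "reduce p y x \<le> p (x + y) - p y"
proof -
  have "- p (- x) \<le> p (x + t *\<^sub>R y) - t * p y" if "0 \<le> t" for t x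
    using sublinearD(1)[OF p, of "x + t *\<^sub>R y" "- x"] sublinearD(2)[OF p that, of y] by simp
  then have bdd: "bdd_below ((\<lambda>t. p (x + t *\<^sub>R y) - t * p y) ` {0..})" for x
    by (intro bdd_belowI2) auto
  have le: "reduce p y x \<le> p (x + t *\<^sub>R y) - t * p y" if "0 \<le> t" for t x
    unfolding reduce_def by (rule cINF_lower[OF bdd]) (use that in auto)
  have ge: "m \<le> reduce p y x" if "\<And>t. 0 \<le> t \<Longrightarrow> m \<le> p (x + t *\<^sub>R y) - t * p y" for m x
    unfolding reduce_def by (rule cINF_greatest) (use that in auto)
  show "reduce p y x \<le> p x" using le[of 0 x] by simp
  show "reduce p y x \<le> p (x + y) - p y" using le[of 1 x] by simp
  have scale: "r * reduce p y x \<le> reduce p y (r *\<^sub>R x)" if r: "0 < r" for r x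
  proof (rule ge)
    fix t :: real assume t: "0 \<le> t"
    have "r * reduce p y x \<le> r * (p (x + (t / r) *\<^sub>R y) - t / r * p y)"
      using le[of "t / r" x] t r by (intro mult_left_mono) auto
    also have "\<dots> = p (r *\<^sub>R (x + (t / r) *\<^sub>R y)) - t * p y"
      using sublinearD(2)[OF p, of r "x + (t / r) *\<^sub>R y"] r by (simp add: right_diff_distrib)
    finally show "r * reduce p y x \<le> p (r *\<^sub>R x + t *\<^sub>R y) - t * p y"
      using r by (simp add: scaleR_add_right)
  qed
  show "sublinear (reduce p y)"
    unfolding sublinear_def
  proof (intro conjI allI impI)
    fix x z
    have "reduce p y (x + z) - (p (z + t *\<^sub>R y) - t * p y) \<le> reduce p y x" if t: "0 \<le> t" for t
    proof (rule ge)
      fix s :: real assume s: "0 \<le> s"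
      have "reduce p y (x + z) \<le> p ((x + s *\<^sub>R y) + (z + t *\<^sub>R y)) - (s + t) * p y"
        using le[of "s + t" "x + z"] s t by (simp add: algebra_simps)
      also have "\<dots> \<le> p (x + s *\<^sub>R y) + p (z + t *\<^sub>R y) - (s + t) * p y"
        using sublinearD(1)[OF p] by simp
      finally show "reduce p y (x + z) - (p (z + t *\<^sub>R y) - t * p y) \<le> p (x + s *\<^sub>R y) - s * p y"
        by (simp add: algebra_simps)
    qed
    then have "reduce p y (x + z) - reduce p y x \<le> reduce p y z"
      by (intro ge) (simp add: algebra_simps)
    then show "reduce p y (x + z) \<le> reduce p y x + reduce p y z" by simp
  next
    fix r :: real and x assume "0 \<le> r"
    then consider "r = 0" | "0 < r" by linarith
    then show "reduce p y (r *\<^sub>R x) = r * reduce p y x"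
    proof cases
      case 1
      have "0 \<le> reduce p y 0" by (rule ge) (simp add: sublinearD(2)[OF p])
      moreover have "reduce p y 0 \<le> 0" using le[of 0 0] sublinearD(3)[OF p] by simp
      ultimately show ?thesis using 1 by simp
    next
      case 2
      have "1 / r * reduce p y (r *\<^sub>R x) \<le> reduce p y x" using scale[of "1 / r" "r *\<^sub>R x"] 2 by simp
      then show ?thesis using scale[OF 2, of x] 2 by (simp add: field_simps)
    qed
  qed
qed

text \<open>A minimal sublinear functional below \<open>p\<close> exists by Zorn's lemma, and it is linear because it
  equals each of its reductions.\<close>

lemma sublinear_dominates_linear:
  fixes p :: "'a::real_vector \<Rightarrow> real"
  assumes p: "sublinear p"
  obtains g where "linear g" "\<And>x. g x \<le> p x"
proof -
  define A where "A = {q::'a \<Rightarrow> real. sublinear q \<and> (\<forall>x. q x \<le> p x)}"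
  define P where "P = (\<lambda>a b::'a \<Rightarrow> real. \<forall>x. b x \<le> a x)"
  have "\<exists>m\<in>A. \<forall>a\<in>A. P m a \<longrightarrow> a = m"
  proof (rule predicate_Zorn)
    show "partial_order_on A (relation_of P A)"
      by (rule partial_order_on_relation_ofI) (auto simp: P_def fun_eq_iff intro: order_trans antisym)
    fix C assume C: "C \<in> Chains (relation_of P A)"
    then have CA: "C \<subseteq> A" by (auto simp: Chains_def relation_of_def)
    have total: "P q q' \<or> P q' q" if "q \<in> C" "q' \<in> C" for q q'
      using C that by (auto simp: Chains_def relation_of_def)
    show "\<exists>u\<in>A. \<forall>a\<in>C. P a u"
    proof (cases "C = {}")
      case True
      then show ?thesis using p by (auto simp: A_def)
    next
      case False
      define u where "u = (\<lambda>x. INF q\<in>C. q x)"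
      have bdd: "bdd_below ((\<lambda>q. q x) ` C)" for x
      proof (rule bdd_belowI2)
        fix q assume "q \<in> C"
        then have "sublinear q" "q (- x) \<le> p (- x)" using CA by (auto simp: A_def)
        then show "- p (- x) \<le> q x" using sublinearD(4)[of q x] by linarith
      qed
      have le: "u x \<le> q x" if "q \<in> C" for q x
        unfolding u_def by (rule cINF_lower[OF bdd that])
      have ge: "m \<le> u x" if "\<And>q. q \<in> C \<Longrightarrow> m \<le> q x" for m x
        unfolding u_def by (rule cINF_greatest[OF False that])
      have sub: "sublinear q" if "q \<in> C" for q using that CA by (auto simp: A_def)
      have "u \<in> A"
        unfolding A_def mem_Collect_eq sublinear_def
      proof (intro conjI allI impI)
        fix x y
        have two: "u (x + y) \<le> q x + q' y" if "q \<in> C" "q' \<in> C" for q q'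
        proof -
          have "\<exists>q''\<in>C. q'' x \<le> q x \<and> q'' y \<le> q' y"
            using total[OF that] that unfolding P_def by blast
          then obtain q'' where q'': "q'' \<in> C" "q'' x \<le> q x" "q'' y \<le> q' y" by blast
          then show ?thesis using le[OF q''(1), of "x + y"] sublinearD(1)[OF sub[OF q''(1)], of x y] by linarith
        qed
        have "u (x + y) - q' y \<le> u x" if "q' \<in> C" for q'
          by (rule ge) (use two that in \<open>auto simp: algebra_simps\<close>)
        then have "u (x + y) - u x \<le> u y" by (intro ge) (auto simp: algebra_simps)
        then show "u (x + y) \<le> u x + u y" by simp
      next
        fix r :: real and x assume r: "0 \<le> r"
        have "u (r *\<^sub>R x) = (INF q\<in>C. r * q x)"
          unfolding u_def by (rule arg_cong[where f = Inf]) (auto simp: sublinearD(2)[OF sub r] image_iff)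
        moreover have "r * u x \<le> (INF q\<in>C. r * q x)"
          by (rule cINF_greatest[OF False]) (simp add: r le mult_left_mono)
        moreover have "u (r *\<^sub>R x) \<le> r * u x"
        proof (cases "r = 0")
          case True
          obtain q where "q \<in> C" using False by blast
          then show ?thesis using le[of q 0] sublinearD(3)[OF sub, of q] True by simp
        next
          case False
          have "1 / r * u (r *\<^sub>R x) \<le> u x"
          proof (rule ge)
            fix q assume q: "q \<in> C"
            show "1 / r * u (r *\<^sub>R x) \<le> q x"
              using le[OF q, of "r *\<^sub>R x"] sublinearD(2)[OF sub[OF q] r, of x] False r
              by (simp add: divide_le_eq mult.commute)
          qed
          then show ?thesis using False r by (simp add: field_simps)
        qed
        ultimately show "u (r *\<^sub>R x) = r * u x" by linarith
      next
        fix x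
        obtain q where "q \<in> C" using False by blast
        then have "q x \<le> p x" using CA by (auto simp: A_def)
        then show "u x \<le> p x" using le[OF \<open>q \<in> C\<close>, of x] by linarith
      qed
      then show ?thesis using le by (auto simp: P_def)
    qed
  qed
  then obtain m where m: "m \<in> A" and min: "\<And>a. a \<in> A \<Longrightarrow> (\<forall>x. a x \<le> m x) \<Longrightarrow> a = m"
    unfolding P_def by blast
  have sm: "sublinear m" using m by (simp add: A_def)
  have "reduce m y = m" for y
  proof (rule min)
    show "reduce m y \<in> A" using m reduce_sublinear[OF sm, of y] unfolding A_def
      by (auto intro: order_trans)
  qed (simp add: reduce_sublinear[OF sm])
  then have add: "m (x + y) = m x + m y" for x y
    using reduce_sublinear(3)[OF sm, of y x] sublinearD(1)[OF sm, of x y] by simp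
  have neg: "m (- x) = - m x" for x using add[of x "- x"] sublinearD(3)[OF sm] by simp
  have "linear m"
  proof (rule linearI)
    show "m (r *\<^sub>R x) = r *\<^sub>R m x" for r x
    proof (cases "0 \<le> r")
      case False
      then have "m (- ((- r) *\<^sub>R x)) = - ((- r) * m x)"
        unfolding neg using sublinearD(2)[OF sm, of "- r" x] by simp
      then show ?thesis by simp
    qed (simp add: sublinearD(2)[OF sm])
  qed (rule add)
  then show ?thesis using that m by (auto simp: A_def)
qed

lemma hahn_banach_support:
  fixes p :: "'a::real_vector \<Rightarrow> real"
  assumes p: "sublinear p"
  obtains g where "linear g" "\<And>x. g x \<le> p x" "g f = p f"
proof -
  obtain g where g: "linear g" "\<And>x. g x \<le> reduce p f x"
    using sublinear_dominates_linear[OF reduce_sublinear(1)[OF p]] by blast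
  have le: "g x \<le> p x" for x using g(2)[of x] reduce_sublinear(2)[OF p, of f x] by linarith
  have "g (- f) \<le> - p f"
    using g(2)[of "- f"] reduce_sublinear(3)[OF p, of f "- f"] sublinearD(3)[OF p] by simp
  then have "g f = p f" using le[of f] g(1) by (simp add: linear_neg)
  then show ?thesis using that g(1) le by blast
qed

lemma equivalent_normD:
  assumes "equivalent_norm N"
  shows "N f = 0 \<longleftrightarrow> f = 0" "N (f + g) \<le> N f + N g" "N (c *\<^sub>C f) = cmod c * N f"
    "N (r *\<^sub>R f) = \<bar>r\<bar> * N f" "0 \<le> N f"
    "\<exists>m M. 0 < m \<and> 0 < M \<and> (\<forall>f. m * norm f \<le> N f \<and> N f \<le> M * norm f)"
proof -
  show "N f = 0 \<longleftrightarrow> f = 0" "N (f + g) \<le> N f + N g" "N (c *\<^sub>C f) = cmod c * N f"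
    and ex: "\<exists>m M. 0 < m \<and> 0 < M \<and> (\<forall>f. m * norm f \<le> N f \<and> N f \<le> M * norm f)"
    using assms unfolding equivalent_norm_def by blast+
  have "N (of_real r *\<^sub>C f) = cmod (of_real r) * N f"
    using assms unfolding equivalent_norm_def by blast
  then show "N (r *\<^sub>R f) = \<bar>r\<bar> * N f" by (simp add: scaleC_of_real)
  obtain m where "0 < m" "m * norm f \<le> N f" using ex by blast
  then show "0 \<le> N f" using order_trans[of 0 "m * norm f" "N f"] by simp
qed

text \<open>Complexification of the real support functional: \<open>x \<mapsto> g x - i g (i x)\<close>.\<close>

lemma complex_support_functional:
  fixes N :: "'a::complex_banach \<Rightarrow> real"
  assumes N: "equivalent_norm N"
  obtains \<phi> where "bounded_clinear \<phi>" "\<And>x. cmod (\<phi> x) \<le> N x" "\<phi> f = of_real (N f)"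
proof -
  have "sublinear N" by (simp add: sublinear_def equivalent_normD[OF N])
  then obtain g where g: "linear g" "\<And>x. g x \<le> N x" "g f = N f" using hahn_banach_support by blast
  define \<phi> where "\<phi> = (\<lambda>x. Complex (g x) (- g (\<i> *\<^sub>C x)))"
  have g_add: "g (x + y) = g x + g y" and g_scale: "g (r *\<^sub>R x) = r * g x" for x y r
    using g(1) by (simp_all add: linear_add linear_cmul)
  have \<phi>_add: "\<phi> (x + y) = \<phi> x + \<phi> y" for x y
    by (simp add: \<phi>_def scaleC_add_right g_add complex_eq_iff)
  have \<phi>_scaleC: "\<phi> (c *\<^sub>C x) = c * \<phi> x" for c x
  proof -
    have split: "c *\<^sub>C y = Re c *\<^sub>R y + Im c *\<^sub>R (\<i> *\<^sub>C y)" for y :: 'a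
    proof -
      have "c = of_real (Re c) + of_real (Im c) * \<i>" by (simp add: complex_eq_iff)
      then show ?thesis by (metis scaleC_add_left scaleC_scaleC scaleC_of_real)
    qed
    have "\<i> *\<^sub>C (c *\<^sub>C x) = Re c *\<^sub>R (\<i> *\<^sub>C x) - Im c *\<^sub>R x"
    proof -
      have "\<i> *\<^sub>C (c *\<^sub>C x) = c *\<^sub>C (\<i> *\<^sub>C x)" by (simp add: scaleC_scaleC mult.commute)
      also have "\<dots> = Re c *\<^sub>R (\<i> *\<^sub>C x) + Im c *\<^sub>R ((- 1) *\<^sub>C x)" by (subst split) (simp add: scaleC_scaleC)
      also have "(- 1) *\<^sub>C x = - x" using scaleC_of_real[of "- 1" x] by simp
      finally show ?thesis by simp
    qed
    then have "g (\<i> *\<^sub>C (c *\<^sub>C x)) = Re c * g (\<i> *\<^sub>C x) - Im c * g x"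
      using g(1) by (simp add: linear_diff g_scale)
    moreover have "g (c *\<^sub>C x) = Re c * g x + Im c * g (\<i> *\<^sub>C x)" by (subst split) (simp add: g_add g_scale)
    ultimately show ?thesis by (simp add: \<phi>_def complex_eq_iff algebra_simps)
  qed
  have bound: "cmod (\<phi> x) \<le> N x" for x
  proof (cases "\<phi> x = 0")
    case True
    then show ?thesis using equivalent_normD(5)[OF N] by simp
  next
    case False
    \<comment> \<open>Rotate \<open>x\<close> so that \<open>\<phi> x\<close> becomes real and positive.\<close>
    define c where "c = cnj (\<phi> x) / of_real (cmod (\<phi> x))"
    have c: "cmod c = 1" using False by (simp add: c_def norm_divide)
    have "c * \<phi> x = of_real (cmod (\<phi> x))"
      using False complex_norm_square[of "\<phi> x"]
      by (simp add: c_def field_simps power2_eq_square)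
    then have "cmod (\<phi> x) = Re (\<phi> (c *\<^sub>C x))" by (simp add: \<phi>_scaleC)
    also have "\<dots> \<le> N (c *\<^sub>C x)" by (simp add: \<phi>_def g(2))
    finally show ?thesis by (simp add: equivalent_normD(3)[OF N] c)
  qed
  obtain M where M: "\<And>x. N x \<le> M * norm x" using equivalent_normD(6)[OF N] by blast
  show ?thesis
  proof (rule that[of \<phi>])
    show "bounded_clinear \<phi>"
      by (rule bounded_clinearI[where K = M])
        (auto simp: \<phi>_add \<phi>_scaleC scaleC_complex_def intro: order_trans[OF bound M])
    have "Re (\<phi> f) = N f" by (simp add: \<phi>_def g(3))
    moreover have "Im (\<phi> f) = 0"
    proof -
      have "(Re (\<phi> f))\<^sup>2 + (Im (\<phi> f))\<^sup>2 \<le> (N f)\<^sup>2"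
        using bound[of f] by (metis cmod_power2 norm_ge_zero power_mono)
      then show ?thesis using \<open>Re (\<phi> f) = N f\<close> by simp
    qed
    ultimately show "\<phi> f = of_real (N f)" by (simp add: complex_eq_iff)
  qed (rule bound)
qed

text \<open>Test \<open>f - h P f\<close> with a support functional of \<open>f\<close> for the norm \<open>N\<close>.\<close>

lemma dissipative_expansive:
  assumes N: "equivalent_norm N" and P: "dissipative N P" and f: "f \<in> dom P" and h: "0 \<le> h"
  shows "N f \<le> N (f - h *\<^sub>R the (P f))"
proof (cases "f = 0")
  case True
  then show ?thesis using equivalent_normD(1)[OF N, of f] equivalent_normD(5)[OF N] by simp
next
  case False
  then have pos: "0 < N f" using equivalent_normD(1,5)[OF N, of f] by linarith
  obtain \<phi> where \<phi>: "bounded_clinear \<phi>" "\<And>x. cmod (\<phi> x) \<le> N x" "\<phi> f = of_real (N f)"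
    by (rule complex_support_functional[OF N, where f = f]) blast
  \<comment> \<open>Dissipativity speaks of functionals whose value at \<open>f\<close> and squared dual norm are \<open>(N f)\<^sup>2\<close>.\<close>
  define \<psi> where "\<psi> = (\<lambda>x. of_real (N f) *\<^sub>C \<phi> x)"
  have \<psi>: "bounded_clinear \<psi>" unfolding \<psi>_def
    by (rule bounded_clinear_compose[OF bounded_clinear_scaleC_map \<phi>(1)])
  have bound: "cmod (\<psi> x) \<le> N f * N x" for x
    using \<phi>(2)[of x] pos by (simp add: \<psi>_def scaleC_complex_def norm_mult)
  have "dual_norm N \<psi> = N f"
    unfolding dual_norm_def
  proof (rule cSup_eq_maximum)
    have "N ((1 / N f) *\<^sub>R f) = 1" using pos by (simp add: equivalent_normD(4)[OF N])
    moreover have "cmod (\<psi> ((1 / N f) *\<^sub>R f)) = N f"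
      using pos \<psi> by (simp add: bounded_clinear_scaleR) (simp add: \<psi>_def scaleC_complex_def \<phi>(3) norm_mult)
    ultimately show "N f \<in> (\<lambda>f. cmod (\<psi> f)) ` {f. N f \<le> 1}" by (intro image_eqI[where x = "(1 / N f) *\<^sub>R f"]) auto
  next
    fix z assume "z \<in> (\<lambda>f. cmod (\<psi> f)) ` {f. N f \<le> 1}"
    then obtain x where x: "z = cmod (\<psi> x)" "N x \<le> 1" by blast
    have "N f * N x \<le> N f * 1" using x(2) pos by (intro mult_left_mono) auto
    then show "z \<le> N f" using bound[of x] x(1) by linarith
  qed
  moreover have \<psi>f: "\<psi> f = of_real ((N f)\<^sup>2)"
    by (simp add: \<psi>_def \<phi>(3) scaleC_complex_def power2_eq_square)
  ultimately have Re: "Re (\<psi> (the (P f))) \<le> 0"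
    using P f \<psi> unfolding dissipative_def by auto
  have "(N f)\<^sup>2 \<le> (N f)\<^sup>2 - h * Re (\<psi> (the (P f)))" using Re h by (simp add: mult_nonneg_nonpos)
  also have "\<dots> = Re (\<psi> (f - h *\<^sub>R the (P f)))"
    using \<psi> \<psi>f by (simp add: bounded_clinear_diff bounded_clinear_scaleR)
  also have "\<dots> \<le> cmod (\<psi> (f - h *\<^sub>R the (P f)))" by (rule complex_Re_le_cmod)
  also have "\<dots> \<le> N f * N (f - h *\<^sub>R the (P f))" by (rule bound)
  finally show ?thesis using pos by (simp add: power2_eq_square)
qed

section \<open>Strongly continuous semigroups and their generators\<close>

lemma c0_semigroupD:
  assumes "c0_semigroup S"
  shows "0 \<le> t \<Longrightarrow> bounded_clinear (S t)" "S 0 f = f"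
    "0 \<le> s \<Longrightarrow> 0 \<le> t \<Longrightarrow> S (s + t) f = S s (S t f)"
    "continuous_on {0..} (\<lambda>t. S t f)"
  using assms by (auto simp: c0_semigroup_def)

text \<open>Uniform boundedness on \<open>{0..1}\<close> and the semigroup law give an exponential bound.\<close>

lemma c0_semigroup_sc_family:
  fixes S :: "real \<Rightarrow> 'a::complex_banach \<Rightarrow> 'a"
  assumes S: "c0_semigroup S"
  shows "sc_family S"
proof -
  have "\<exists>K. \<forall>t\<in>{0..1}. \<forall>f. norm (S t f) \<le> K * norm f"
  proof (rule uniform_boundedness)
    show "bounded_linear (S t)" if "t \<in> {0..1}" for t
      using c0_semigroupD(1)[OF S, of t] that by (auto intro: bounded_clinear_linear)
    fix f
    have "compact ((\<lambda>t. S t f) ` {0..1})"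
      by (intro compact_continuous_image continuous_on_subset[OF c0_semigroupD(4)[OF S]]) auto
    then have "bounded ((\<lambda>t. S t f) ` {0..1})" by (rule compact_imp_bounded)
    then show "\<exists>K. \<forall>t\<in>{0..1}. norm (S t f) \<le> K" by (simp add: bounded_iff)
  qed
  then obtain K0 where K0: "\<And>t f. t \<in> {0..1} \<Longrightarrow> norm (S t f) \<le> K0 * norm f" by blast
  define K where "K = max K0 1"
  have K: "norm (S t f) \<le> K * norm f" if "t \<in> {0..1}" for t f
    using K0[OF that, of f] mult_right_mono[of K0 K "norm f"] by (simp add: K_def)
  have K1: "1 \<le> K" by (simp add: K_def)
  have step: "norm (S t f) \<le> K ^ (n + 1) * norm f" if "t \<in> {real n..real n + 1}" for n t f
    using that
  proof (induction n arbitrary: t)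
    case 0
    then show ?case using K[of t f] by simp
  next
    case (Suc n)
    have "S t f = S 1 (S (t - 1) f)"
      using c0_semigroupD(3)[OF S, of 1 "t - 1" f] Suc.prems by simp
    then have "norm (S t f) \<le> K * norm (S (t - 1) f)" using K[of 1] by simp
    also have "\<dots> \<le> K * (K ^ (n + 1) * norm f)"
      using Suc.IH[of "t - 1"] Suc.prems K1 by (intro mult_left_mono) auto
    finally show ?case by simp
  qed
  have "norm (S t f) \<le> K * exp (ln K * t) * norm f" if t: "0 \<le> t" for t f
  proof -
    define n where "n = nat \<lfloor>t\<rfloor>"
    have n: "real n \<le> t" "t \<le> real n + 1" using t by (auto simp: n_def)
    have "K ^ n = exp (ln K * n)" using K1 exp_of_nat_mult[of n "ln K"] by (simp add: mult.commute)
    also have "\<dots> \<le> exp (ln K * t)" using n(1) K1 by (simp add: mult_left_mono)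
    finally have "K ^ (n + 1) * norm f \<le> K * exp (ln K * t) * norm f"
      using K1 by (simp add: mult_right_mono)
    then show ?thesis using step[of t n f] n by simp
  qed
  then have "exp_bounded (ln K) S" unfolding exp_bounded_def by blast
  then show ?thesis using S by (auto simp: sc_family_def c0_semigroup_def)
qed

lemma generator_iff:
  "(f \<in> dom (generator S) \<and> the (generator S f) = g) \<longleftrightarrow>
    ((\<lambda>h. (1 / h) *\<^sub>R (S h f - f)) \<longlongrightarrow> g) (at_right 0)"
proof -
  have "Lim (at_right 0) (\<lambda>h. (1 / h) *\<^sub>R (S h f - f)) = g'"
    if "((\<lambda>h. (1 / h) *\<^sub>R (S h f - f)) \<longlongrightarrow> g') (at_right 0)" for g'
    by (rule tendsto_Lim[OF _ that]) simp
  then show ?thesis by (auto simp: generator_def dom_def split: if_splits)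
qed

lemma generatorI:
  "((\<lambda>h. (1 / h) *\<^sub>R (S h f - f)) \<longlongrightarrow> g) (at_right 0) \<Longrightarrow>
    f \<in> dom (generator S) \<and> the (generator S f) = g"
  by (simp only: generator_iff)

lemma generatorD:
  "f \<in> dom (generator S) \<Longrightarrow>
    ((\<lambda>h. (1 / h) *\<^sub>R (S h f - f)) \<longlongrightarrow> the (generator S f)) (at_right 0)"
  using generator_iff[of f S "the (generator S f)"] by blast

lemma has_vector_derivative_slope:
  fixes f :: "real \<Rightarrow> 'a::real_normed_vector"
  shows "(f has_vector_derivative D) (at x within S) \<longleftrightarrow>
    ((\<lambda>y. (1 / (y - x)) *\<^sub>R (f y - f x)) \<longlongrightarrow> D) (at x within S)"
proof -
  have eq: "norm (f y - f x - (y - x) *\<^sub>R D) / \<bar>y - x\<bar> = norm ((1 / (y - x)) *\<^sub>R (f y - f x) - D)"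
    if "y \<noteq> x" for y
  proof -
    have "(1 / (y - x)) *\<^sub>R (f y - f x) - D = (1 / (y - x)) *\<^sub>R (f y - f x - (y - x) *\<^sub>R D)"
      using that by (simp add: scaleR_diff_right)
    then show ?thesis by (simp add: divide_inverse mult.commute)
  qed
  have "(f has_vector_derivative D) (at x within S) \<longleftrightarrow>
      ((\<lambda>y. norm (f y - f x - (y - x) *\<^sub>R D) / norm (y - x)) \<longlongrightarrow> 0) (at x within S)"
    unfolding has_vector_derivative_def has_derivative_iff_norm
    by (simp add: bounded_linear_scaleR_left)
  also have "\<dots> \<longleftrightarrow> ((\<lambda>y. norm ((1 / (y - x)) *\<^sub>R (f y - f x) - D)) \<longlongrightarrow> 0) (at x within S)"
    by (rule tendsto_cong) (simp add: eventually_at_filter eq)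
  also have "\<dots> \<longleftrightarrow> ((\<lambda>y. (1 / (y - x)) *\<^sub>R (f y - f x)) \<longlongrightarrow> D) (at x within S)"
    by (simp only: tendsto_norm_zero_iff LIM_zero_iff)
  finally show ?thesis .
qed

lemma inverse_diff_swap: "1 / (t - y) = - (1 / (y - t))" for t y :: real
  by (metis minus_diff_eq minus_divide_right)

text \<open>The difference quotients on both sides of \<open>t\<close> are \<open>S (min y t)\<close> applied to the quotient at \<open>0\<close> with
  step \<open>\<bar>y - t\<bar>\<close>, so that joint continuity gives the two-sided derivative.\<close>

lemma semigroup_orbit_derivative:
  assumes S: "c0_semigroup S" and f: "f \<in> dom (generator S)" and t: "0 \<le> t"
  shows "((\<lambda>s. S s f) has_vector_derivative S t (the (generator S f))) (at t within {0..})"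
  unfolding has_vector_derivative_slope
proof -
  define d where "d = (\<lambda>h. (1 / h) *\<^sub>R (S h f - f))"
  have "filterlim (\<lambda>y. \<bar>y - t\<bar>) (at_right 0) (at t within {0..})"
    unfolding filterlim_at
    by (auto simp: eventually_at_filter intro!: tendsto_eq_intros)
  then have d: "((\<lambda>y. d \<bar>y - t\<bar>) \<longlongrightarrow> the (generator S f)) (at t within {0..})"
    using generatorD[OF f] unfolding d_def by (rule filterlim_compose[rotated])
  have "((\<lambda>y. S (min y t) (d \<bar>y - t\<bar>)) \<longlongrightarrow> S t (the (generator S f))) (at t within {0..})"
  proof (rule sc_family_tendsto[OF c0_semigroup_sc_family[OF S] _ _ t d])
    have "((\<lambda>y. min y t) \<longlongrightarrow> min t t) (at t within {0..})" by (intro tendsto_intros)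
    then show "((\<lambda>y. min y t) \<longlongrightarrow> t) (at t within {0..})" by simp
    show "\<forall>\<^sub>F y in at t within {0..}. 0 \<le> min y t" using t by (auto simp: eventually_at_filter)
  qed
  moreover have "S (min y t) (d \<bar>y - t\<bar>) = (1 / (y - t)) *\<^sub>R (S y f - S t f)" if y: "0 \<le> y" "y \<noteq> t" for y
  proof (cases "y < t")
    case True
    have "S y (S (t - y) f) = S t f" using c0_semigroupD(3)[OF S, of y "t - y" f] True y by simp
    then have "S y (d (t - y)) = (1 / (t - y)) *\<^sub>R (S t f - S y f)"
      unfolding d_def using c0_semigroupD(1)[OF S y(1)]
      by (simp add: bounded_clinear_scaleR bounded_clinear_diff)
    also have "\<dots> = (1 / (y - t)) *\<^sub>R (S y f - S t f)"
      using inverse_diff_swap[of t y] by (simp add: algebra_simps)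
    finally show ?thesis using True by (simp add: min_def)
  next
    case False
    then have "t < y" using y by simp
    have "S t (S (y - t) f) = S y f" using c0_semigroupD(3)[OF S t, of "y - t" f] \<open>t < y\<close> by simp
    then have "S t (d (y - t)) = (1 / (y - t)) *\<^sub>R (S y f - S t f)"
      unfolding d_def using c0_semigroupD(1)[OF S t]
      by (simp add: bounded_clinear_scaleR bounded_clinear_diff)
    then show ?thesis using \<open>t < y\<close> by (simp add: min_def)
  qed
  then have "\<forall>\<^sub>F y in at t within {0..}.
      S (min y t) (d \<bar>y - t\<bar>) = (1 / (y - t)) *\<^sub>R (S y f - S t f)"
    by (simp add: eventually_at_filter)
  ultimately show "((\<lambda>y. (1 / (y - t)) *\<^sub>R (S y f - S t f)) \<longlongrightarrow> S t (the (generator S f)))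
      (at t within {0..})"
    by (rule Lim_transform_eventually)
qed

text \<open>Operators that intertwine semigroups intertwine their generators; used with \<open>T\<close> an embedding, a
  projector, a scalar, or an operator of the semigroup itself.\<close>

lemma generator_intertwine:
  assumes T: "bounded_clinear T" and int: "\<And>t f. 0 \<le> t \<Longrightarrow> T (S t f) = S' t (T f)"
    and f: "f \<in> dom (generator S)"
  shows "T f \<in> dom (generator S') \<and> the (generator S' (T f)) = T (the (generator S f))"
proof (rule generatorI)
  have "((\<lambda>h. T ((1 / h) *\<^sub>R (S h f - f))) \<longlongrightarrow> T (the (generator S f))) (at_right 0)"
    by (rule bounded_clinear_tendsto[OF T generatorD[OF f]])
  moreover have "\<forall>\<^sub>F h in at_right 0. T ((1 / h) *\<^sub>R (S h f - f)) = (1 / h) *\<^sub>R (S' h (T f) - T f)"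
    by (auto simp: eventually_at_filter bounded_clinear_scaleR[OF T] bounded_clinear_diff[OF T] int)
  ultimately show "((\<lambda>h. (1 / h) *\<^sub>R (S' h (T f) - T f)) \<longlongrightarrow> T (the (generator S f))) (at_right 0)"
    by (rule Lim_transform_eventually)
qed

lemma generator_invariant:
  assumes S: "c0_semigroup S" and f: "f \<in> dom (generator S)" and t: "0 \<le> t"
  shows "S t f \<in> dom (generator S)" "the (generator S (S t f)) = S t (the (generator S f))"
proof -
  have "S t (S s g) = S s (S t g)" if "0 \<le> s" for s g
    using c0_semigroupD(3)[OF S t that, of g] c0_semigroupD(3)[OF S that t, of g]
    by (simp add: add.commute)
  from generator_intertwine[OF c0_semigroupD(1)[OF S t] this f]
  show "S t f \<in> dom (generator S)" "the (generator S (S t f)) = S t (the (generator S f))" by auto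
qed

text \<open>The averages of an orbit over \<open>{0..h}\<close> lie in the domain and tend to its starting point.\<close>

lemma generator_dense:
  fixes S :: "real \<Rightarrow> 'a::complex_banach \<Rightarrow> 'a"
  assumes S: "c0_semigroup S"
  shows "closure (dom (generator S)) = UNIV"
proof -
  have "f \<in> closure (dom (generator S))" for f
  proof -
    define I where "I = (\<lambda>t. integral {0..t} (\<lambda>s. S s f))"
    have cont: "continuous_on {0..T} (\<lambda>s. S s f)" for T
      by (rule continuous_on_subset[OF c0_semigroupD(4)[OF S]]) auto
    have deriv: "((\<lambda>r. (1 / r) *\<^sub>R (I (h + r) - I h)) \<longlongrightarrow> S h f) (at_right 0)" if h: "0 \<le> h" for h
    proof -
      have "(I has_vector_derivative S h f) (at h within {0..h + 1})"
        unfolding I_def by (rule integral_has_vector_derivative[OF cont]) (use h in auto)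
      then have *: "((\<lambda>y. (1 / (y - h)) *\<^sub>R (I y - I h)) \<longlongrightarrow> S h f) (at h within {0..h + 1})"
        by (simp add: has_vector_derivative_slope)
      have "filterlim (\<lambda>r. h + r) (at h within {0..h + 1}) (at_right 0)"
        unfolding filterlim_at
      proof
        show "\<forall>\<^sub>F r in at_right 0. h + r \<in> {0..h + 1} \<and> h + r \<noteq> h"
          using h eventually_at_right_less[of 0] eventually_at_right[of 0 1]
          unfolding eventually_at_right_field by (auto intro!: exI[of _ 1])
      next
        have "((\<lambda>r. h + r) \<longlongrightarrow> h + 0) (at_right 0)" by (intro tendsto_intros)
        then show "((\<lambda>r. h + r) \<longlongrightarrow> h) (at_right 0)" by simp
      qed
      from filterlim_compose[OF * this] show ?thesis by simp
    qed
    have shift: "S r (I h) = I (h + r) - I r" if r: "0 \<le> r" and h: "0 \<le> h" for r h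
    proof -
      have "S r (I h) = integral {0..h} (\<lambda>s. S r (S s f))"
        unfolding I_def
        by (rule integral_bounded_clinear[OF c0_semigroupD(1)[OF S r] integrable_continuous_real[OF cont]])
      also have "\<dots> = integral {0..h} ((\<lambda>s. S s f) \<circ> (+) r)"
        by (rule integral_cong) (use r in \<open>simp add: c0_semigroupD(3)[OF S]\<close>)
      also have "\<dots> = integral {r..h + r} (\<lambda>s. S s f)"
        by (subst integral_shift_Icc_real) (simp add: add.commute)
      also have "\<dots> = I (h + r) - I r"
        using Henstock_Kurzweil_Integration.integral_combine[of 0 r "h + r" "\<lambda>s. S s f"] r h
          integrable_continuous_real[OF cont] by (simp add: I_def algebra_simps)
      finally show ?thesis .
    qed
    have I0: "I 0 = 0" by (simp add: I_def)
    have "I h \<in> dom (generator S)" if h: "0 \<le> h" for h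
    proof -
      have "((\<lambda>r. (1 / r) *\<^sub>R (I (h + r) - I h) - (1 / r) *\<^sub>R (I (0 + r) - I 0)) \<longlongrightarrow> S h f - S 0 f) (at_right 0)"
        by (intro tendsto_diff deriv h) simp
      moreover have "\<forall>\<^sub>F r in at_right 0. (1 / r) *\<^sub>R (I (h + r) - I h) - (1 / r) *\<^sub>R (I (0 + r) - I 0)
          = (1 / r) *\<^sub>R (S r (I h) - I h)"
        by (auto simp: eventually_at_filter shift h I0 scaleR_diff_right)
      ultimately have "((\<lambda>r. (1 / r) *\<^sub>R (S r (I h) - I h)) \<longlongrightarrow> S h f - S 0 f) (at_right 0)"
        by (rule Lim_transform_eventually)
      then show ?thesis using generatorI by blast
    qed
    moreover have "(1 / h) *\<^sub>R g \<in> dom (generator S)" if g: "g \<in> dom (generator S)" for h g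
    proof -
      have "of_real (1 / h) *\<^sub>C S t f = S t (of_real (1 / h) *\<^sub>C f)" if "0 \<le> t" for t f
        by (rule bounded_clinear_scaleC[OF c0_semigroupD(1)[OF S that], symmetric])
      from generator_intertwine[OF bounded_clinear_scaleC_map this g]
      show ?thesis unfolding scaleC_of_real ..
    qed
    ultimately have "(1 / h) *\<^sub>R I h \<in> dom (generator S)" if "0 < h" for h
      using that by simp
    moreover have "((\<lambda>h. (1 / h) *\<^sub>R I h) \<longlongrightarrow> f) (at_right 0)"
      using deriv[of 0] by (simp add: I0 c0_semigroupD(2)[OF S])
    ultimately show ?thesis
      by (intro Lim_in_closed_set[OF closed_closure, where F = "at_right 0" and f = "\<lambda>h. (1 / h) *\<^sub>R I h"])
        (auto simp: eventually_at_filter intro!: always_eventually closure_subset[THEN subsetD])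
  qed
  then show ?thesis by auto
qed

text \<open>Variation of constants: \<open>s \<mapsto> S (t - s) (z s)\<close> has the derivative \<open>S (t - s) (z' s - P (z s))\<close>.
  Uniqueness of orbits, intertwining relations and both Duhamel formulas are instances.\<close>

lemma variation_of_constants:
  fixes S :: "real \<Rightarrow> 'a::complex_banach \<Rightarrow> 'a"
  assumes S: "c0_semigroup S" and t: "0 \<le> t"
    and z: "\<And>s. s \<in> {0..t} \<Longrightarrow> (z has_vector_derivative the (generator S (z s)) + k s) (at s within {0..t})"
    and dom: "\<And>s. s \<in> {0..t} \<Longrightarrow> z s \<in> dom (generator S)"
  shows "((\<lambda>s. S (t - s) (k s)) has_integral (z t - S t (z 0))) {0..t}"
proof -
  have "((\<lambda>s. S (t - s) (z s)) has_vector_derivative S (t - s) (k s)) (at s within {0..t})"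
    if s: "s \<in> {0..t}" for s
    unfolding has_vector_derivative_slope
  proof -
    have ts: "0 \<le> t - s" using s by simp
    let ?F = "at s within {0..t}" and ?Pz = "the (generator S (z s))"
    have "((\<lambda>y. t - y) \<longlongrightarrow> t - s) ?F" by (intro tendsto_intros)
    note lim = this
    have 1: "((\<lambda>y. S (t - y) ((1 / (y - s)) *\<^sub>R (z y - z s))) \<longlongrightarrow> S (t - s) (?Pz + k s)) ?F"
      by (rule sc_family_tendsto[OF c0_semigroup_sc_family[OF S] lim _ ts])
        (use z[OF s] in \<open>auto simp: has_vector_derivative_slope eventually_at_filter\<close>)
    have "filterlim (\<lambda>y. t - y) (at (t - s) within {0..}) ?F"
      unfolding filterlim_at using lim by (auto simp: eventually_at_filter)
    from filterlim_compose[OF semigroup_orbit_derivative[OF S dom[OF s] ts,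
          unfolded has_vector_derivative_slope] this]
    have 2: "((\<lambda>y. (1 / (s - y)) *\<^sub>R (S (t - y) (z s) - S (t - s) (z s))) \<longlongrightarrow> S (t - s) ?Pz) ?F"
      by simp
    have "S (t - s) (?Pz + k s) - S (t - s) ?Pz = S (t - s) (k s)"
      using c0_semigroupD(1)[OF S ts] by (simp add: bounded_clinear_add)
    with tendsto_diff[OF 1 2]
    have "((\<lambda>y. S (t - y) ((1 / (y - s)) *\<^sub>R (z y - z s))
        - (1 / (s - y)) *\<^sub>R (S (t - y) (z s) - S (t - s) (z s))) \<longlongrightarrow> S (t - s) (k s)) ?F"
      by simp
    moreover have "S (t - y) ((1 / (y - s)) *\<^sub>R (z y - z s))
        - (1 / (s - y)) *\<^sub>R (S (t - y) (z s) - S (t - s) (z s))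
        = (1 / (y - s)) *\<^sub>R (S (t - y) (z y) - S (t - s) (z s))" if "y \<in> {0..t}" "y \<noteq> s" for y
    proof -
      have "1 / (s - y) = - (1 / (y - s))" by (rule inverse_diff_swap)
      then show ?thesis
        using c0_semigroupD(1)[OF S, of "t - y"] that
        by (simp add: bounded_clinear_scaleR bounded_clinear_diff scaleR_diff_right)
    qed
    then have "\<forall>\<^sub>F y in ?F. S (t - y) ((1 / (y - s)) *\<^sub>R (z y - z s))
        - (1 / (s - y)) *\<^sub>R (S (t - y) (z s) - S (t - s) (z s))
        = (1 / (y - s)) *\<^sub>R (S (t - y) (z y) - S (t - s) (z s))"
      by (simp add: eventually_at_filter)
    ultimately show "((\<lambda>y. (1 / (y - s)) *\<^sub>R (S (t - y) (z y) - S (t - s) (z s))) \<longlongrightarrow> S (t - s) (k s)) ?F"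
      by (rule Lim_transform_eventually)
  qed
  from fundamental_theorem_of_calculus[OF t this]
  show ?thesis by (simp add: c0_semigroupD(2)[OF S])
qed

lemma orbit_unique:
  assumes S: "c0_semigroup S" and t: "0 \<le> t"
    and z: "\<And>s. s \<in> {0..t} \<Longrightarrow> (z has_vector_derivative the (generator S (z s))) (at s within {0..t})"
    and dom: "\<And>s. s \<in> {0..t} \<Longrightarrow> z s \<in> dom (generator S)"
  shows "z t = S t (z 0)"
proof -
  have "((\<lambda>s. S (t - s) 0) has_integral (z t - S t (z 0))) {0..t}"
    by (rule variation_of_constants[OF S t _ dom]) (use z in auto)
  moreover have "((\<lambda>s. S (t - s) 0) has_integral 0) {0..t}"
    by (rule has_integral_is_0) (use c0_semigroupD(1)[OF S] in \<open>auto simp: bounded_clinear_zero\<close>)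
  ultimately have "z t - S t (z 0) = 0" by (rule has_integral_unique)
  then show ?thesis by simp
qed

lemma orbit_derivative_on:
  assumes "c0_semigroup S" "f \<in> dom (generator S)" "s \<in> {0..t}"
  shows "((\<lambda>s. S s f) has_vector_derivative S s (the (generator S f))) (at s within {0..t})"
  by (rule has_vector_derivative_within_subset[OF semigroup_orbit_derivative[OF assms(1,2)]])
    (use assms(3) in auto)

lemma semigroup_intertwine:
  fixes T :: "'a::complex_banach \<Rightarrow> 'b::complex_banach"
  assumes S: "c0_semigroup S" and S': "c0_semigroup S'" and T: "bounded_clinear T"
    and gen: "\<And>f. f \<in> dom (generator S) \<Longrightarrow>
      T f \<in> dom (generator S') \<and> the (generator S' (T f)) = T (the (generator S f))"
    and t: "0 \<le> t"
  shows "T (S t f) = S' t (T f)"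
proof (rule bounded_clinear_eq_on_dense[OF _ _ generator_dense[OF S]])
  show "bounded_clinear (\<lambda>f. T (S t f))"
    by (rule bounded_clinear_compose[OF T c0_semigroupD(1)[OF S t]])
  show "bounded_clinear (\<lambda>f. S' t (T f))"
    by (rule bounded_clinear_compose[OF c0_semigroupD(1)[OF S' t] T])
next
  fix f assume f: "f \<in> dom (generator S)"
  have "T (S t f) = S' t (T (S 0 f))"
  proof (rule orbit_unique[OF S' t])
    fix s assume s: "s \<in> {0..t}"
    then have inv: "S s f \<in> dom (generator S)" "the (generator S (S s f)) = S s (the (generator S f))"
      using generator_invariant[OF S f] by auto
    show "T (S s f) \<in> dom (generator S')" using gen[OF inv(1)] ..
    show "((\<lambda>s. T (S s f)) has_vector_derivative the (generator S' (T (S s f)))) (at s within {0..t})"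
      using bounded_linear.has_vector_derivative[OF bounded_clinear_linear[OF T] orbit_derivative_on[OF S f s]]
        gen[OF inv(1)] inv(2) by simp
  qed
  then show "T (S t f) = S' t (T f)" by (simp add: c0_semigroupD(2)[OF S])
qed

section \<open>Bounded perturbations\<close>

lemma op_conv_uminus_right:
  assumes "sc_family X"
  shows "op_conv X (\<lambda>t f. - Y t f) t f = - op_conv X Y t f"
  unfolding op_conv_def
  by (subst Henstock_Kurzweil_Integration.integral_neg[symmetric], rule integral_cong)
    (auto simp: bounded_clinear_minus sc_familyD[OF assms])

lemma op_conv_diff_right:
  assumes "sc_family X" "sc_family Y" "sc_family Y'"
  shows "op_conv X (\<lambda>t f. Y t f - Y' t f) t f = op_conv X Y t f - op_conv X Y' t f"
proof -
  have "integral {0..t} (\<lambda>s. X s (Y (t - s) f - Y' (t - s) f))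
      = integral {0..t} (\<lambda>s. X s (Y (t - s) f) - X s (Y' (t - s) f))"
    by (rule integral_cong) (auto simp: bounded_clinear_diff sc_familyD[OF assms(1)])
  then show ?thesis
    unfolding op_conv_def using assms by (simp add: integral_diff conv_integrable)
qed

lemma sc_family_uminus:
  assumes "sc_family X"
  shows "sc_family (\<lambda>t f. - X t f)"
  using sc_family_compose[OF bounded_clinear_diff_map[OF bounded_clinear_zero_map bounded_clinear_ident] assms]
  by simp

lemma sc_family_diff:
  assumes "sc_family X" "sc_family Y"
  shows "sc_family (\<lambda>t f. X t f - Y t f)"
  using sc_family_add[OF assms(1) sc_family_uminus[OF assms(2)]] by simp

definition has_exp_bound :: "real \<Rightarrow> real \<Rightarrow> (real \<Rightarrow> 'a::complex_banach \<Rightarrow> 'b::complex_banach) \<Rightarrow> bool"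
  where "has_exp_bound C b X \<longleftrightarrow> 0 \<le> C \<and> (\<forall>t\<ge>0. \<forall>f. norm (X t f) \<le> C * exp (b * t) * norm f)"

lemma sc_family_exp_bound:
  assumes "sc_family X"
  obtains b C where "b \<ge> l" "has_exp_bound C b X"
proof -
  obtain b where "exp_bounded b X" using assms by (auto simp: sc_family_def)
  then have "exp_bounded (max b l) X" by (rule exp_bounded_mono) simp
  then obtain C where "C > 0" "\<And>t f. 0 \<le> t \<Longrightarrow> norm (X t f) \<le> C * exp (max b l * t) * norm f"
    by (rule exp_boundedE) blast
  then show ?thesis using that[of "max b l" C] by (simp add: has_exp_bound_def)
qed

lemma has_exp_bound_null_sequence:
  assumes "\<And>n. has_exp_bound (C * (1 / 2) ^ n) b (X n)" "0 \<le> t"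
  shows "(\<lambda>n. X n t f) \<longlonglongrightarrow> 0"
proof -
  have "(\<lambda>n. C * (1 / 2) ^ n * exp (b * t) * norm f) \<longlonglongrightarrow> C * 0 * exp (b * t) * norm f"
    by (intro tendsto_intros LIMSEQ_realpow_zero) auto
  then have lim: "(\<lambda>n. C * (1 / 2) ^ n * exp (b * t) * norm f) \<longlonglongrightarrow> 0" by simp
  show ?thesis
    by (rule Lim_null_comparison[OF always_eventually lim]) (use assms in \<open>auto simp: has_exp_bound_def\<close>)
qed

text \<open>Measured against a sufficiently fast exponential, convolution with \<open>K\<close> is a contraction.
  Hence Volterra equations are uniquely solvable on the whole half-line at once.\<close>

lemma volterra_halving:
  fixes K :: "real \<Rightarrow> 'a::complex_banach \<Rightarrow> 'a"
  assumes K: "sc_family K"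
  obtains l where "\<And>b C X. l \<le> b \<Longrightarrow> sc_family (X :: real \<Rightarrow> 'a \<Rightarrow> 'a) \<Longrightarrow> has_exp_bound C b X \<Longrightarrow>
    has_exp_bound (C / 2) b (op_conv K X)"
proof -
  obtain l D where D: "D > 0" "\<And>t f. 0 \<le> t \<Longrightarrow> norm (K t f) \<le> D * exp (l * t) * norm f"
    using K exp_boundedE unfolding sc_family_def by metis
  show ?thesis
  proof (rule that[of "l + 2 * D"])
    fix b C and X :: "real \<Rightarrow> 'a \<Rightarrow> 'a"
    assume b: "l + 2 * D \<le> b" and X: "sc_family X" "has_exp_bound C b X"
    have C: "0 \<le> C" "\<And>t f. 0 \<le> t \<Longrightarrow> norm (X t f) \<le> C * exp (b * t) * norm f"
      using X(2) by (auto simp: has_exp_bound_def)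
    have l: "l < b" "D / (b - l) \<le> 1 / 2" using D(1) b by (auto simp: field_simps)
    have "norm (op_conv K X t f) \<le> C / 2 * exp (b * t) * norm f" if t: "0 \<le> t" for t f
    proof -
      have "norm (op_conv K X t f) \<le> D * C / (b - l) * exp (b * t) * norm f"
        by (rule norm_op_conv_le[OF K D(2) X(1) C(2) _ C(1) l(1) t]) (use D in auto)
      also have "\<dots> = D / (b - l) * (C * exp (b * t) * norm f)" by simp
      also have "\<dots> \<le> 1 / 2 * (C * exp (b * t) * norm f)"
        using l(2) C(1) by (intro mult_right_mono) auto
      finally show ?thesis by simp
    qed
    then show "has_exp_bound (C / 2) b (op_conv K X)" using C(1) by (simp add: has_exp_bound_def)
  qed
qed

lemma volterra_zero:
  fixes K u :: "real \<Rightarrow> 'a::complex_banach \<Rightarrow> 'a"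
  assumes K: "sc_family K" and u: "sc_family u"
    and eq: "\<And>t f. 0 \<le> t \<Longrightarrow> u t f = - op_conv K u t f" and t: "0 \<le> t"
  shows "u t f = 0"
proof -
  obtain l where half: "\<And>b C X. l \<le> b \<Longrightarrow> sc_family (X :: real \<Rightarrow> 'a \<Rightarrow> 'a) \<Longrightarrow> has_exp_bound C b X \<Longrightarrow>
    has_exp_bound (C / 2) b (op_conv K X)"
    using volterra_halving[OF K] by blast
  obtain b C where b: "l \<le> b" and C: "has_exp_bound C b u" using sc_family_exp_bound[OF u] by blast
  have "has_exp_bound (C * (1 / 2) ^ n) b u" for n
  proof (induction n)
    case (Suc n)
    from half[OF b u this] show ?case by (simp add: has_exp_bound_def eq)
  qed (simp add: C)
  from has_exp_bound_null_sequence[OF this t] show ?thesis by (simp add: LIMSEQ_const_iff)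
qed

lemma sc_family_suminf:
  fixes X :: "nat \<Rightarrow> real \<Rightarrow> 'a::complex_banach \<Rightarrow> 'b::complex_banach"
  assumes X: "\<And>n. sc_family (X n)" and bound: "\<And>n. has_exp_bound (C * (1 / 2) ^ n) l (X n)"
  shows "sc_family (\<lambda>t f. \<Sum>n. X n t f)"
    and "has_exp_bound (2 * C * (1 / 2) ^ N) l (\<lambda>t f. (\<Sum>n. X n t f) - (\<Sum>n<N. X n t f))"
proof -
  have C: "0 \<le> C" using bound[of 0] by (simp add: has_exp_bound_def)
  have bound: "norm (X n t f) \<le> C * (1 / 2) ^ n * exp (l * t) * norm f" if "0 \<le> t" for n t f
    using bound[of n] that by (simp add: has_exp_bound_def)
  have geo: "summable (\<lambda>n. (1 / 2 :: real) ^ n)" by (rule summable_geometric) simp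
  have smaj: "summable (\<lambda>n. C * (1 / 2) ^ n * c)" for c :: real
    by (intro summable_mult summable_mult2 geo)
  have summ: "summable (\<lambda>n. X n t f)" if "0 \<le> t" for t f
    by (rule summable_comparison_test'[OF smaj[of "exp (l * t) * norm f"], of 0])
      (use bound[OF that] in \<open>simp add: mult.assoc\<close>)
  have tail: "norm ((\<Sum>n. X n t f) - (\<Sum>n<N. X n t f)) \<le> 2 * C * (1 / 2) ^ N * exp (l * t) * norm f"
    if t: "0 \<le> t" for t f N
  proof -
    have "(\<Sum>n. X n t f) - (\<Sum>n<N. X n t f) = (\<Sum>n. X (n + N) t f)"
      using suminf_split_initial_segment[OF summ[OF t], where k = N] by simp
    moreover have "norm (\<Sum>n. X (n + N) t f) \<le> (\<Sum>n. C * (1 / 2) ^ n * ((1 / 2) ^ N * exp (l * t) * norm f))"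
    proof (rule norm_suminf_le[OF _ smaj])
      show "norm (X (n + N) t f) \<le> C * (1 / 2) ^ n * ((1 / 2) ^ N * exp (l * t) * norm f)" for n
        using bound[OF t, of "n + N" f] by (simp add: power_add mult_ac)
    qed
    moreover have "(\<Sum>n. C * (1 / 2) ^ n * ((1 / 2) ^ N * exp (l * t) * norm f))
        = 2 * C * (1 / 2) ^ N * exp (l * t) * norm f"
      using suminf_mult2[OF summable_mult[OF geo, of C], of "(1 / 2) ^ N * exp (l * t) * norm f"]
        suminf_mult[OF geo, of C] suminf_geometric[of "1 / 2 :: real"] by simp
    ultimately show ?thesis by simp
  qed
  then show "has_exp_bound (2 * C * (1 / 2) ^ N) l (\<lambda>t f. (\<Sum>n. X n t f) - (\<Sum>n<N. X n t f))"
    using C by (simp add: has_exp_bound_def)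
  have lin: "bounded_clinear (\<lambda>f. \<Sum>n. X n t f)" if t: "0 \<le> t" for t
  proof (rule bounded_clinearI)
    show "(\<Sum>n. X n t (f + g)) = (\<Sum>n. X n t f) + (\<Sum>n. X n t g)" for f g
      by (simp add: bounded_clinear_add sc_familyD(1)[OF X t] suminf_add summ t)
    show "(\<Sum>n. X n t (c *\<^sub>C f)) = c *\<^sub>C (\<Sum>n. X n t f)" for c f
      using bounded_linear.suminf[OF bounded_clinear_linear[OF bounded_clinear_scaleC_map] summ[OF t]]
      by (simp add: bounded_clinear_scaleC sc_familyD(1)[OF X t])
    show "norm (\<Sum>n. X n t f) \<le> (2 * C * exp (l * t)) * norm f" for f
      using tail[OF t, of f 0] by simp
  qed
  have cont: "continuous_on {0..} (\<lambda>t. \<Sum>n. X n t f)" for f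
  proof -
    have "continuous_on {0..T} (\<lambda>t. \<Sum>n. X n t f)" for T
    proof (rule uniform_limit_theorem[OF _ Weierstrass_m_test[where M = "\<lambda>n. C * (1 / 2) ^ n * (exp (\<bar>l\<bar> * T) * norm f)"]])
      show "\<forall>\<^sub>F n in sequentially. continuous_on {0..T} (\<lambda>t. \<Sum>i<n. X i t f)"
        by (intro always_eventually allI continuous_on_sum continuous_on_subset[OF sc_familyD(2)[OF X]]) auto
      show "summable (\<lambda>n. C * (1 / 2) ^ n * (exp (\<bar>l\<bar> * T) * norm f))" by (rule smaj)
      fix n t assume t: "t \<in> {0..T}"
      have "l * t \<le> \<bar>l\<bar> * T" using t by (intro mult_mono) auto
      then have "C * (1 / 2) ^ n * exp (l * t) * norm f \<le> C * (1 / 2) ^ n * exp (\<bar>l\<bar> * T) * norm f"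
        using C by (intro mult_right_mono mult_left_mono) auto
      then show "norm (X n t f) \<le> C * (1 / 2) ^ n * (exp (\<bar>l\<bar> * T) * norm f)"
        using bound[of t n f] t by (simp add: mult.assoc)
    qed simp
    then show ?thesis by (rule continuous_on_atLeast_0I)
  qed
  have "exp_bounded l (\<lambda>t f. \<Sum>n. X n t f)"
    unfolding exp_bounded_def using tail[of _ _ 0] by (intro exI[of _ "2 * C"]) simp
  then show "sc_family (\<lambda>t f. \<Sum>n. X n t f)" using lin cont by (auto simp: sc_family_def)
qed

lemma volterra_solution:
  fixes K S :: "real \<Rightarrow> 'a::complex_banach \<Rightarrow> 'a"
  assumes K: "sc_family K" and S: "sc_family S"
  obtains Y where "sc_family Y" "\<And>t f. 0 \<le> t \<Longrightarrow> Y t f = S t f - op_conv K Y t f"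
proof -
  obtain l where half: "\<And>b C X. l \<le> b \<Longrightarrow> sc_family (X :: real \<Rightarrow> 'a \<Rightarrow> 'a) \<Longrightarrow> has_exp_bound C b X \<Longrightarrow>
    has_exp_bound (C / 2) b (op_conv K X)"
    using volterra_halving[OF K] by blast
  obtain b C where b: "l \<le> b" and C: "has_exp_bound C b S" using sc_family_exp_bound[OF S] by blast
  define X where "X = rec_nat S (\<lambda>_ Z t f. - op_conv K Z t f)"
  have X0: "X 0 = S" and XS: "X (Suc n) = (\<lambda>t f. - op_conv K (X n) t f)" for n
    by (simp_all add: X_def)
  have scX: "sc_family (X n)" for n
    by (induction n) (simp_all add: X0 XS S sc_family_uminus sc_family_op_conv K)
  have bound: "has_exp_bound (C * (1 / 2) ^ n) b (X n)" for n
  proof (induction n)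
    case (Suc n)
    from half[OF b scX this] show ?case by (simp add: has_exp_bound_def XS)
  qed (simp add: C X0)
  define Y where "Y = (\<lambda>t f. \<Sum>n. X n t f)"
  define P where "P = (\<lambda>N t f. \<Sum>n<N. X n t f)"
  have Y: "sc_family Y" unfolding Y_def by (rule sc_family_suminf(1)[OF scX bound])
  have tail: "has_exp_bound (2 * C * (1 / 2) ^ N) b (\<lambda>t f. Y t f - P N t f)" for N
    unfolding Y_def P_def by (rule sc_family_suminf(2)[OF scX bound])
  have scP: "sc_family (P N)" and PS: "0 \<le> t \<Longrightarrow> P (Suc N) t f = S t f - op_conv K (P N) t f" for N t f
  proof (induction N arbitrary: t f)
    case 0
    show 1: "sc_family (P 0)"
      using sc_family_compose[OF bounded_clinear_zero_map S] by (simp add: P_def)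
    have "op_conv K (P 0) t f = 0" if "0 \<le> t" for t f
    proof -
      have "integral {0..t} (\<lambda>s. K s 0) = integral {0..t} (\<lambda>s. 0)"
        by (rule integral_cong) (simp add: bounded_clinear_zero sc_familyD(1)[OF K])
      then show ?thesis by (simp add: op_conv_def P_def)
    qed
    then show "P (Suc 0) t f = S t f - op_conv K (P 0) t f" if "0 \<le> t" for t f
      using that by (simp add: P_def X0)
  next
    case (Suc N)
    have P': "P (Suc N) = (\<lambda>t f. P N t f + X N t f)" for N by (simp add: P_def)
    show "sc_family (P (Suc N))" unfolding P' by (rule sc_family_add[OF Suc.IH(1) scX])
    show "P (Suc (Suc N)) t f = S t f - op_conv K (P (Suc N)) t f" if "0 \<le> t" for t f
      unfolding P'[of "Suc N"] Suc.IH(2)[OF that] XS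
      unfolding P' by (simp add: op_conv_add_right[OF K Suc.IH(1) scX])
  qed
  have "Y t f = S t f - op_conv K Y t f" if t: "0 \<le> t" for t f
  proof -
    have "has_exp_bound (C * (1 / 2) ^ N) b (op_conv K (\<lambda>t f. Y t f - P N t f))" for N
      using half[OF b sc_family_diff[OF Y scP] tail, of N] by simp
    from has_exp_bound_null_sequence[OF this t]
    have "(\<lambda>N. op_conv K Y t f - op_conv K (P N) t f) \<longlonglongrightarrow> 0"
      by (simp add: op_conv_diff_right[OF K Y scP])
    moreover have "(\<lambda>N. Y t f - P (Suc N) t f) \<longlonglongrightarrow> 0"
      by (rule LIMSEQ_Suc[OF has_exp_bound_null_sequence[OF tail t]])
    ultimately have "(\<lambda>N. (Y t f - P (Suc N) t f) + (op_conv K Y t f - op_conv K (P N) t f)) \<longlonglongrightarrow> 0 + 0"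
      by (intro tendsto_add)
    then have "(\<lambda>N::nat. Y t f - S t f + op_conv K Y t f) \<longlonglongrightarrow> 0"
      by (simp add: PS[OF t] algebra_simps)
    then have "Y t f - S t f + op_conv K Y t f = 0" by (simp add: LIMSEQ_const_iff)
    then show ?thesis by (simp add: algebra_simps)
  qed
  then show ?thesis using that Y by blast
qed

text \<open>After rescaling, the quotient is the integral over \<open>{0..1}\<close> of a function that depends continuously
  on \<open>h\<close>.\<close>

lemma op_conv_initial_slope:
  assumes X: "sc_family X" and Y: "sc_family Y"
  shows "((\<lambda>h. (1 / h) *\<^sub>R op_conv X Y h f) \<longlongrightarrow> X 0 (Y 0 f)) (at_right 0)"
proof -
  have "continuous_on {0..} (\<lambda>h. integral {0..1} (\<lambda>u. X (h * u) (Y (h - h * u) f)))"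
    by (rule continuous_on_rescaled_conv[OF X Y])
  then have "((\<lambda>h. integral {0..1} (\<lambda>u. X (h * u) (Y (h - h * u) f)))
      \<longlongrightarrow> integral {0..1} (\<lambda>u. X (0 * u) (Y (0 - 0 * u) f))) (at 0 within {0..})"
    unfolding continuous_on_def by (rule bspec) simp
  then have "((\<lambda>h. integral {0..1} (\<lambda>u. X (h * u) (Y (h - h * u) f))) \<longlongrightarrow> X 0 (Y 0 f)) (at_right 0)"
    by (intro tendsto_within_subset[of _ _ 0 "{0..}" "{0<..}"]) auto
  moreover have "(1 / h) *\<^sub>R op_conv X Y h f = integral {0..1} (\<lambda>u. X (h * u) (Y (h - h * u) f))"
    if "0 < h" for h
    unfolding op_conv_def by (subst integral_rescale_unit) (use that in auto)
  then have "\<forall>\<^sub>F h in at_right 0.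
      integral {0..1} (\<lambda>u. X (h * u) (Y (h - h * u) f)) = (1 / h) *\<^sub>R op_conv X Y h f"
    by (simp add: eventually_at_filter)
  ultimately show ?thesis by (rule Lim_transform_eventually)
qed

text \<open>The perturbed semigroup is the solution \<open>Y\<close> of \<open>Y = S - (S a) * Y\<close>. The convolution has the slope
  \<open>a f\<close> at \<open>0\<close> for every \<open>f\<close>, so \<open>Y\<close> and \<open>S\<close> are differentiable at \<open>0\<close> on the same vectors.\<close>

lemma bounded_perturbation_generates:
  fixes S :: "real \<Rightarrow> 'a::complex_banach \<Rightarrow> 'a"
  assumes S: "c0_semigroup S" and a: "bounded_clinear a"
    and B: "dom B = dom (generator S)" "\<And>f. f \<in> dom B \<Longrightarrow> the (B f) = the (generator S f) - a f"
  shows "generates_c0_semigroup B"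
proof -
  note scS = c0_semigroup_sc_family[OF S]
  define K where "K = (\<lambda>t f. S t (a f))"
  have K: "sc_family K" unfolding K_def by (rule sc_family_precompose[OF scS a])
  obtain Y where Y: "sc_family Y" "\<And>t f. 0 \<le> t \<Longrightarrow> Y t f = S t f - op_conv K Y t f"
    by (rule volterra_solution[OF K scS]) blast
  have Y0: "Y 0 f = f" for f using Y(2)[of 0 f] by (simp add: op_conv_def c0_semigroupD(2)[OF S])
  \<comment> \<open>Both \<open>Y (t + s)\<close> and \<open>Y t Y s\<close> solve the Volterra equation with initial datum \<open>Y s\<close>.\<close>
  have Y_add: "Y (t + s) f = Y t (Y s f)" if s: "0 \<le> s" and t: "0 \<le> t" for s t f
  proof -
    define V where "V = (\<lambda>t. Y (t + s))"
    define W where "W = (\<lambda>t f. Y t (Y s f))"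
    have V: "sc_family V"
    proof -
      obtain b C where C: "C > 0" "\<And>t f. 0 \<le> t \<Longrightarrow> norm (Y t f) \<le> C * exp (b * t) * norm f"
        using Y(1) exp_boundedE unfolding sc_family_def by metis
      have "norm (V t f) \<le> C * exp (b * s) * exp (b * t) * norm f" if "0 \<le> t" for t f
        using C(2)[of "t + s" f] that s by (simp add: V_def distrib_left exp_add mult_ac)
      then have "exp_bounded b V" unfolding exp_bounded_def by blast
      moreover have "continuous_on {0..} (\<lambda>t. V t f)" for f
        unfolding V_def
        by (rule sc_family_continuous_on[OF Y(1)]) (use s in \<open>auto intro!: continuous_intros\<close>)
      ultimately show ?thesis using sc_familyD(1)[OF Y(1)] s by (auto simp: sc_family_def V_def)
    qed
    have W: "sc_family W" unfolding W_def by (rule sc_family_precompose[OF Y(1) sc_familyD(1)[OF Y(1) s]])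
    have eqW: "W t f = S t (Y s f) - op_conv K W t f" if "0 \<le> t" for t f
      using Y(2)[OF that, of "Y s f"] by (simp add: W_def op_conv_def)
    have eqV: "V t f = S t (Y s f) - op_conv K V t f" if t: "0 \<le> t" for t f
    proof -
      have "op_conv K Y (t + s) f = integral {0..t} (\<lambda>r. K r (Y (t + s - r) f))
          + integral {t..t + s} (\<lambda>r. K r (Y (t + s - r) f))"
        unfolding op_conv_def
        by (rule Henstock_Kurzweil_Integration.integral_combine[symmetric])
          (use t s conv_integrable[OF K Y(1)] in auto)
      also have "integral {0..t} (\<lambda>r. K r (Y (t + s - r) f)) = op_conv K V t f"
        by (simp add: op_conv_def V_def algebra_simps)
      also have "integral {t..t + s} (\<lambda>r. K r (Y (t + s - r) f))
          = integral {0..s} ((\<lambda>r. K r (Y (t + s - r) f)) \<circ> (+) t)"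
        by (subst integral_shift_Icc_real) (simp add: add.commute)
      also have "\<dots> = integral {0..s} (\<lambda>r. S t (K r (Y (s - r) f)))"
        by (rule integral_cong) (use t in \<open>simp add: K_def c0_semigroupD(3)[OF S]\<close>)
      also have "\<dots> = S t (op_conv K Y s f)"
        unfolding op_conv_def
        by (rule integral_bounded_clinear[OF c0_semigroupD(1)[OF S t] conv_integrable[OF K Y(1)], symmetric])
      finally have "V t f = S t (S s f - op_conv K Y s f) - op_conv K V t f"
        using Y(2)[of "t + s" f] s t
        by (simp add: V_def c0_semigroupD(3)[OF S] bounded_clinear_diff[OF c0_semigroupD(1)[OF S t]])
      then show ?thesis using Y(2)[OF s, of f] by simp
    qed
    have "V t f - W t f = 0"
    proof (rule volterra_zero[OF K sc_family_diff[OF V W] _ t])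
      fix t f assume "0 \<le> (t::real)"
      then show "V t f - W t f = - op_conv K (\<lambda>t f. V t f - W t f) t f"
        by (simp add: op_conv_diff_right[OF K V W] eqV eqW)
    qed
    then show ?thesis by (simp add: V_def W_def)
  qed
  have c0: "c0_semigroup Y"
    unfolding c0_semigroup_def using sc_familyD[OF Y(1)] Y0 Y_add
    by (auto simp: fun_eq_iff)
  have slope: "((\<lambda>h. (1 / h) *\<^sub>R op_conv K Y h f) \<longlongrightarrow> a f) (at_right 0)" for f
    using op_conv_initial_slope[OF K Y(1), of f] by (simp add: K_def Y0 c0_semigroupD(2)[OF S])
  have split: "\<forall>\<^sub>F h in at_right 0. (1 / h) *\<^sub>R (S h f - f) - (1 / h) *\<^sub>R op_conv K Y h f
      = (1 / h) *\<^sub>R (Y h f - f)" for f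
  proof -
    have "(1 / h) *\<^sub>R (S h f - f) - (1 / h) *\<^sub>R op_conv K Y h f = (1 / h) *\<^sub>R (Y h f - f)" if "0 < h" for h
      unfolding Y(2)[OF less_imp_le[OF that]] by (simp add: scaleR_diff_right)
    then show ?thesis by (simp add: eventually_at_filter)
  qed
  have "generator Y f = B f" for f
  proof (cases "f \<in> dom B")
    case True
    then have "((\<lambda>h. (1 / h) *\<^sub>R (S h f - f)) \<longlongrightarrow> the (generator S f)) (at_right 0)"
      using generatorD B(1) by blast
    from Lim_transform_eventually[OF tendsto_diff[OF this slope] split]
    have "f \<in> dom (generator Y) \<and> the (generator Y f) = the (B f)"
      unfolding B(2)[OF True] by (rule generatorI)
    then show ?thesis using True by (metis domD option.sel)
  next
    case False
    have "f \<notin> dom (generator Y)"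
    proof
      assume "f \<in> dom (generator Y)"
      from tendsto_add[OF generatorD[OF this] slope]
      have "((\<lambda>h. (1 / h) *\<^sub>R (S h f - f)) \<longlongrightarrow> the (generator Y f) + a f) (at_right 0)"
      proof (rule Lim_transform_eventually)
        show "\<forall>\<^sub>F h in at_right 0. (1 / h) *\<^sub>R (Y h f - f) + (1 / h) *\<^sub>R op_conv K Y h f = (1 / h) *\<^sub>R (S h f - f)"
          using split[of f] by eventually_elim (simp add: algebra_simps)
      qed
      then show False using generatorI False B(1) by blast
    qed
    then show ?thesis using False by (metis domIff)
  qed
  then show ?thesis using c0 by (auto simp: generates_c0_semigroup_def)
qed

section \<open>Growth of semigroups with hypodissipative generators\<close>

text \<open>Continuous induction from right to left: the set of \<open>s\<close> with \<open>\<psi> T \<le> \<psi> s + e (T - s)\<close> is compact, and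
  its least element can only be \<open>0\<close>.\<close>

lemma nonincreasing_from_left:
  fixes \<psi> :: "real \<Rightarrow> real"
  assumes cont: "continuous_on {0..T} \<psi>" and T: "0 \<le> T"
    and left: "\<And>s e. 0 < s \<Longrightarrow> s \<le> T \<Longrightarrow> 0 < e \<Longrightarrow> \<exists>r. 0 \<le> r \<and> r < s \<and> \<psi> s \<le> \<psi> r + e * (s - r)"
  shows "\<psi> T \<le> \<psi> 0"
proof -
  have "\<psi> T \<le> \<psi> 0 + e * T" if e: "0 < e" for e
  proof -
    define A where "A = {s \<in> {0..T}. \<psi> T \<le> \<psi> s + e * (T - s)}"
    have "closed A" unfolding A_def
      by (intro continuous_on_closed_Collect_le continuous_intros cont)
    moreover have "bounded A" by (rule bounded_subset[OF bounded_closed_interval[of 0 T]]) (auto simp: A_def)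
    ultimately have "compact A" by (simp add: compact_eq_bounded_closed)
    moreover have "T \<in> A" using T by (simp add: A_def)
    ultimately obtain s where s: "s \<in> A" "\<And>r. r \<in> A \<Longrightarrow> s \<le> r"
      using compact_attains_inf[of A] by blast
    have "s = 0"
    proof (rule ccontr)
      assume "s \<noteq> 0"
      then obtain r where r: "0 \<le> r" "r < s" "\<psi> s \<le> \<psi> r + e * (s - r)"
        using left[of s e] s(1) e by (auto simp: A_def)
      then have "\<psi> T \<le> \<psi> r + e * (T - r)" using s(1) by (auto simp: A_def algebra_simps)
      then have "r \<in> A" using r s(1) by (auto simp: A_def)
      then show False using s(2) r(2) by force
    qed
    then show ?thesis using s(1) by (simp add: A_def)
  qed
  note bound = this
  show ?thesis
  proof (cases "T = 0")
    case False
    show ?thesis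
    proof (rule field_le_epsilon)
      fix e :: real assume "0 < e"
      then show "\<psi> T \<le> \<psi> 0 + e" using bound[of "e / T"] False T by simp
    qed
  qed simp
qed

text \<open>Along an orbit \<open>v\<close> of the shifted generator \<open>P\<close>, dissipativity gives
  \<open>N (v s) \<le> N (v s - h P (v s)) = N (v (s - h)) + o(h)\<close>, so \<open>N\<close> does not increase along \<open>v\<close>.\<close>

lemma hypodissipative_exp_bounded:
  fixes S :: "real \<Rightarrow> 'a::complex_banach \<Rightarrow> 'a"
  assumes S: "c0_semigroup S" and diss: "hypodissipative (op_shift (generator S) a)"
  shows "exp_bounded a S"
proof -
  define P where "P = op_shift (generator S) a"
  obtain N where N: "equivalent_norm N" and D: "dissipative N P"
    using diss unfolding hypodissipative_def P_def by blast
  have P: "dom P = dom (generator S)" "f \<in> dom P \<Longrightarrow> the (P f) = the (generator S f) - a *\<^sub>R f" for f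
    by (auto simp: P_def op_shift_def dom_def split: if_splits)
  obtain m M where mM: "0 < m" "0 < M" "\<And>f. m * norm f \<le> N f" "\<And>f. N f \<le> M * norm f"
    using equivalent_normD(6)[OF N] by blast
  have N_diff: "\<bar>N f - N g\<bar> \<le> M * norm (f - g)" for f g
    using equivalent_normD(2)[OF N, of "f - g" g] equivalent_normD(2)[OF N, of "g - f" f]
      mM(4)[of "f - g"] mM(4)[of "g - f"] norm_minus_commute[of f g] by simp
  have contraction: "N (exp (- a * t) *\<^sub>R S t f) \<le> N f" if f: "f \<in> dom (generator S)" and t: "0 \<le> t" for f t
  proof -
    define v where "v = (\<lambda>s. exp (- a * s) *\<^sub>R S s f)"
    have v': "(v has_vector_derivative the (P (v s))) (at s within {0..t})" and vdom: "v s \<in> dom P"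
      if s: "s \<in> {0..t}" for s
    proof -
      have s0: "0 \<le> s" using s by simp
      note inv = generator_invariant[OF S f s0]
      have comm: "exp (- a * s) *\<^sub>R S h g = S h (exp (- a * s) *\<^sub>R g)" if "0 \<le> h" for h g
        using bounded_clinear_scaleR[OF c0_semigroupD(1)[OF S that]] by simp
      have "bounded_clinear (\<lambda>g::'a. exp (- a * s) *\<^sub>R g)"
        using bounded_clinear_scaleC_map[of "of_real (exp (- a * s))"] unfolding scaleC_of_real .
      from generator_intertwine[OF this comm inv(1)]
      have vs: "v s \<in> dom (generator S)" "the (generator S (v s)) = exp (- a * s) *\<^sub>R S s (the (generator S f))"
        unfolding v_def inv(2) by auto
      then show "v s \<in> dom P" by (simp add: P)
      then have Pv: "the (P (v s)) = exp (- a * s) *\<^sub>R S s (the (generator S f)) - a *\<^sub>R v s"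
        using P(2) vs(2) by simp
      have "((\<lambda>s. exp (- a * s)) has_field_derivative (- a * exp (- a * s))) (at s within {0..t})"
        by (auto intro!: derivative_eq_intros)
      from has_vector_derivative_scaleR[OF this orbit_derivative_on[OF S f s]]
      show "(v has_vector_derivative the (P (v s))) (at s within {0..t})"
        unfolding Pv by (simp add: v_def)
    qed
    have vcont: "continuous_on {0..t} v"
      unfolding v_def
      by (intro continuous_intros continuous_on_subset[OF c0_semigroupD(4)[OF S]]) auto
    have "N (v t) \<le> N (v 0)"
    proof (rule nonincreasing_from_left[OF _ t])
      have "M-lipschitz_on UNIV N"
        by (rule lipschitz_onI) (use N_diff mM(2) in \<open>auto simp: dist_norm\<close>)
      from continuous_on_compose2[OF lipschitz_on_continuous_on[OF this] vcont]
      show "continuous_on {0..t} (\<lambda>s. N (v s))" by simp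
      fix s e :: real assume s: "0 < s" "s \<le> t" and e: "0 < e"
      have st: "s \<in> {0..t}" using s by simp
      have "\<exists>d>0. \<forall>y\<in>{0..t}. norm (y - s) < d \<longrightarrow>
          norm (v y - v s - (y - s) *\<^sub>R the (P (v s))) \<le> e / M * norm (y - s)"
        using v'[OF st] divide_pos_pos[OF e mM(2)]
        unfolding has_vector_derivative_def has_derivative_within_alt by blast
      then obtain d where d: "0 < d" "\<And>y. y \<in> {0..t} \<Longrightarrow> norm (y - s) < d \<Longrightarrow>
          norm (v y - v s - (y - s) *\<^sub>R the (P (v s))) \<le> e / M * norm (y - s)"
        by blast
      define r where "r = max 0 (s - d / 2)"
      have r: "0 \<le> r" "r < s" "norm (r - s) < d" using d(1) s by (auto simp: r_def)
      have "N (v s) \<le> N (v s - (s - r) *\<^sub>R the (P (v s)))"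
        by (rule dissipative_expansive[OF N D vdom[OF st]]) (use r in simp)
      also have "\<dots> \<le> N (v r) + M * norm (v r - (v s - (s - r) *\<^sub>R the (P (v s))))"
        using N_diff[of "v r" "v s - (s - r) *\<^sub>R the (P (v s))"] by linarith
      also have "v r - (v s - (s - r) *\<^sub>R the (P (v s))) = v r - v s - (r - s) *\<^sub>R the (P (v s))"
        by (simp add: algebra_simps)
      also have "N (v r) + M * norm \<dots> \<le> N (v r) + M * (e / M * norm (r - s))"
        using d(2)[OF _ r(3)] r s mM(2) by (intro add_left_mono mult_left_mono) auto
      also have "\<dots> = N (v r) + e * (s - r)" using r mM(2) by simp
      finally show "\<exists>r. 0 \<le> r \<and> r < s \<and> N (v s) \<le> N (v r) + e * (s - r)" using r by blast
    qed
    then show ?thesis by (simp add: v_def c0_semigroupD(2)[OF S])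
  qed
  have "norm (S t f) \<le> M / m * exp (a * t) * norm f" if t: "0 \<le> t" for t f
  proof -
    have "closed {f. norm (S t f) \<le> M / m * exp (a * t) * norm f}"
      by (intro closed_Collect_le continuous_intros bounded_clinear_continuous_on[OF c0_semigroupD(1)[OF S t]])
    moreover have "dom (generator S) \<subseteq> {f. norm (S t f) \<le> M / m * exp (a * t) * norm f}"
    proof
      fix f assume f: "f \<in> dom (generator S)"
      have "m * (exp (- a * t) * norm (S t f)) \<le> M * norm f"
        using mM(3)[of "exp (- a * t) *\<^sub>R S t f"] contraction[OF f t] mM(4)[of f] by simp
      then show "f \<in> {f. norm (S t f) \<le> M / m * exp (a * t) * norm f}"
        using mM(1) by (simp add: exp_minus field_simps)
    qed
    ultimately have "closure (dom (generator S)) \<subseteq> {f. norm (S t f) \<le> M / m * exp (a * t) * norm f}"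
      by (intro closure_minimal)
    then show ?thesis using generator_dense[OF S] by auto
  qed
  then show ?thesis unfolding exp_bounded_def by blast
qed

section \<open>Duhamel formulas\<close>

lemma
  fixes S T :: "real \<Rightarrow> 'a::complex_banach \<Rightarrow> 'a"
  assumes S: "c0_semigroup S" and T: "c0_semigroup T" and a: "bounded_clinear a"
    and dom: "dom (generator S) = dom (generator T)"
    and gen: "\<And>f. f \<in> dom (generator T) \<Longrightarrow> the (generator S f) = a f + the (generator T f)"
    and t: "0 \<le> t"
  shows duhamel_left: "S t f = T t f + op_conv (\<lambda>t f. T t (a f)) S t f"
    and duhamel_right: "S t f = T t f + op_conv S (\<lambda>t f. a (T t f)) t f"
proof -
  note scS = c0_semigroup_sc_family[OF S] and scT = c0_semigroup_sc_family[OF T]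
  have Ta: "sc_family (\<lambda>t f. T t (a f))" by (rule sc_family_precompose[OF scT a])
  have aT: "sc_family (\<lambda>t f. a (T t f))" by (rule sc_family_compose[OF a scT])
  have lS: "bounded_clinear (\<lambda>f. S t f)" and lT: "bounded_clinear (\<lambda>f. T t f)"
    using sc_familyD(1)[OF scS t] sc_familyD(1)[OF scT t] by simp_all
  show "S t f = T t f + op_conv (\<lambda>t f. T t (a f)) S t f"
  proof (rule bounded_clinear_eq_on_dense[OF lS _ generator_dense[OF S]])
    show "bounded_clinear (\<lambda>f. T t f + op_conv (\<lambda>t f. T t (a f)) S t f)"
      by (rule bounded_clinear_add_map[OF lT sc_familyD(1)[OF sc_family_op_conv[OF Ta scS] t]])
    fix f assume f: "f \<in> dom (generator S)"
    have "((\<lambda>s. T (t - s) (a (S s f))) has_integral (S t f - T t (S 0 f))) {0..t}"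
    proof (rule variation_of_constants[OF T t])
      fix s assume s: "s \<in> {0..t}"
      then have s0: "0 \<le> s" by simp
      show d: "S s f \<in> dom (generator T)" using generator_invariant(1)[OF S f s0] dom by simp
      show "((\<lambda>s. S s f) has_vector_derivative the (generator T (S s f)) + a (S s f)) (at s within {0..t})"
        using orbit_derivative_on[OF S f s] generator_invariant(2)[OF S f s0] gen[OF d]
        by (simp add: add.commute)
    qed
    from integral_unique[OF this]
    show "S t f = T t f + op_conv (\<lambda>t f. T t (a f)) S t f"
      by (simp add: op_conv_reflect c0_semigroupD(2)[OF S])
  qed
  show "S t f = T t f + op_conv S (\<lambda>t f. a (T t f)) t f"
  proof (rule bounded_clinear_eq_on_dense[OF lS _ generator_dense[OF S]])
    show "bounded_clinear (\<lambda>f. T t f + op_conv S (\<lambda>t f. a (T t f)) t f)"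
      by (rule bounded_clinear_add_map[OF lT sc_familyD(1)[OF sc_family_op_conv[OF scS aT] t]])
    fix f assume "f \<in> dom (generator S)"
    then have f: "f \<in> dom (generator T)" using dom by simp
    have "((\<lambda>s. S (t - s) (- a (T s f))) has_integral (T t f - S t (T 0 f))) {0..t}"
    proof (rule variation_of_constants[OF S t])
      fix s assume s: "s \<in> {0..t}"
      then have s0: "0 \<le> s" by simp
      have d: "T s f \<in> dom (generator T)" using generator_invariant(1)[OF T f s0] .
      then show "T s f \<in> dom (generator S)" using dom by simp
      show "((\<lambda>s. T s f) has_vector_derivative the (generator S (T s f)) + - a (T s f)) (at s within {0..t})"
        using orbit_derivative_on[OF T f s] generator_invariant(2)[OF T f s0] gen[OF d] by simp
    qed
    from integral_unique[OF this]
    have "op_conv S (\<lambda>t f. - a (T t f)) t f = T t f - S t f"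
      by (simp add: op_conv_reflect c0_semigroupD(2)[OF T])
    then have "op_conv S (\<lambda>t f. a (T t f)) t f = S t f - T t f"
      unfolding op_conv_uminus_right[OF scS] by (metis minus_diff_eq minus_minus)
    then show "S t f = T t f + op_conv S (\<lambda>t f. a (T t f)) t f" by simp
  qed
qed

lemma conv_power_sc_family: "sc_family K \<Longrightarrow> sc_family (conv_power K (Suc l))"
  by (induction l) (simp_all add: sc_family_op_conv)

lemma conv_power_decays:
  assumes "sc_family K" "decays_beyond a K"
  shows "decays_beyond a (conv_power K (Suc l))"
  by (induction l) (simp_all add: assms decays_beyond_op_conv conv_power_sc_family)

text \<open>The powers are nested to the right; this moves the last factor \<open>K\<close> to the front.\<close>

lemma conv_power_commute:
  assumes K: "sc_family K" and t: "0 \<le> t"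
  shows "op_conv (conv_power K (Suc l)) K t f = op_conv K (conv_power K (Suc l)) t f"
  using t
proof (induction l arbitrary: t f)
  case (Suc l)
  have "op_conv (conv_power K (Suc (Suc l))) K t f = op_conv K (op_conv (conv_power K (Suc l)) K) t f"
    using op_conv_assoc[OF K conv_power_sc_family[OF K] K Suc.prems] by simp
  also have "\<dots> = op_conv K (op_conv K (conv_power K (Suc l))) t f"
    by (rule op_conv_cong) (simp_all add: Suc.IH)
  finally show ?case by simp
qed simp

text \<open>Iterating a Duhamel formula exchanges a convolution power of \<open>K\<close> in the remainder for
  explicit terms that decay like \<open>T\<close>.\<close>

lemma iterated_duhamel_right:
  assumes S: "sc_family S" and T: "sc_family T" "decays_beyond a T" and K: "sc_family K" "decays_beyond a K"
    and eq: "\<And>t f. 0 \<le> t \<Longrightarrow> S t f = T t f + op_conv S K t f"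
  obtains Y where "sc_family Y" "decays_beyond a Y"
    "\<And>t f. 0 \<le> t \<Longrightarrow> S t f = Y t f + op_conv S (conv_power K (Suc l)) t f"
proof -
  have "\<exists>Y. sc_family Y \<and> decays_beyond a Y \<and>
      (\<forall>t\<ge>0. \<forall>f. S t f = Y t f + op_conv S (conv_power K (Suc l)) t f)"
  proof (induction l)
    case 0
    show ?case using T eq by (intro exI[of _ T]) simp
  next
    case (Suc l)
    then obtain Y where Y: "sc_family Y" "decays_beyond a Y"
      "\<And>t f. 0 \<le> t \<Longrightarrow> S t f = Y t f + op_conv S (conv_power K (Suc l)) t f" by blast
    let ?Kl = "conv_power K (Suc l)"
    note Kl = conv_power_sc_family[OF K(1), of l] conv_power_decays[OF K, of l]
    note TK = sc_family_op_conv[OF T(1) Kl(1)] decays_beyond_op_conv[OF T Kl]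
    have "S t f = (Y t f + op_conv T ?Kl t f) + op_conv S (conv_power K (Suc (Suc l))) t f"
      if t: "0 \<le> t" for t f
    proof -
      have "op_conv S ?Kl t f = op_conv (\<lambda>t f. T t f + op_conv S K t f) ?Kl t f"
        by (rule op_conv_cong) (simp_all add: eq)
      also have "\<dots> = op_conv T ?Kl t f + op_conv (op_conv S K) ?Kl t f"
        by (rule op_conv_add_left[OF T(1) sc_family_op_conv[OF S K(1)] Kl(1)])
      also have "op_conv (op_conv S K) ?Kl t f = op_conv S (conv_power K (Suc (Suc l))) t f"
        using op_conv_assoc[OF S K(1) Kl(1) t] by simp
      finally show ?thesis using Y(3)[OF t, of f] by simp
    qed
    then show ?case
      by (intro exI[of _ "\<lambda>t f. Y t f + op_conv T ?Kl t f"])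
        (simp add: sc_family_add Y TK decays_beyond_add)
  qed
  then show ?thesis using that by blast
qed

lemma iterated_duhamel_left:
  assumes S: "sc_family S" and T: "sc_family T" "decays_beyond a T" and K: "sc_family K" "decays_beyond a K"
    and eq: "\<And>t f. 0 \<le> t \<Longrightarrow> S t f = T t f + op_conv K S t f"
  obtains Y where "sc_family Y" "decays_beyond a Y"
    "\<And>t f. 0 \<le> t \<Longrightarrow> S t f = Y t f + op_conv (conv_power K (Suc l)) S t f"
proof -
  have "\<exists>Y. sc_family Y \<and> decays_beyond a Y \<and>
      (\<forall>t\<ge>0. \<forall>f. S t f = Y t f + op_conv (conv_power K (Suc l)) S t f)"
  proof (induction l)
    case 0
    show ?case using T eq by (intro exI[of _ T]) simp
  next
    case (Suc l)
    then obtain Y where Y: "sc_family Y" "decays_beyond a Y"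
      "\<And>t f. 0 \<le> t \<Longrightarrow> S t f = Y t f + op_conv (conv_power K (Suc l)) S t f" by blast
    let ?Kl = "conv_power K (Suc l)"
    note Kl = conv_power_sc_family[OF K(1), of l] conv_power_decays[OF K, of l]
    note KT = sc_family_op_conv[OF Kl(1) T(1)] decays_beyond_op_conv[OF Kl T]
    have "S t f = (Y t f + op_conv ?Kl T t f) + op_conv (conv_power K (Suc (Suc l))) S t f"
      if t: "0 \<le> t" for t f
    proof -
      have "op_conv ?Kl S t f = op_conv ?Kl (\<lambda>t f. T t f + op_conv K S t f) t f"
        by (rule op_conv_cong) (simp_all add: eq)
      also have "\<dots> = op_conv ?Kl T t f + op_conv ?Kl (op_conv K S) t f"
        by (rule op_conv_add_right[OF Kl(1) T(1) sc_family_op_conv[OF K(1) S]])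
      also have "op_conv ?Kl (op_conv K S) t f = op_conv (op_conv ?Kl K) S t f"
        by (rule op_conv_assoc[OF Kl(1) K(1) S t, symmetric])
      also have "\<dots> = op_conv (conv_power K (Suc (Suc l))) S t f"
        by (rule op_conv_cong) (simp_all add: conv_power_commute[OF K(1)])
      finally show ?thesis using Y(3)[OF t, of f] by simp
    qed
    then show ?case
      by (intro exI[of _ "\<lambda>t f. Y t f + op_conv ?Kl T t f"])
        (simp add: sc_family_add Y KT decays_beyond_add)
  qed
  then show ?thesis using that by blast
qed

section \<open>Finite-rank spectral projectors\<close>

interpretation cvec: vector_space "scaleC :: complex \<Rightarrow> 'a::complex_banach \<Rightarrow> 'a"
  by (rule vector_space_scaleC)

text \<open>Induction on \<open>F\<close>: the coefficient of a new vector \<open>x\<close> is controlled by the distance of \<open>x\<close> to the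
  closed span of the others, so coefficients of a convergent sequence converge.\<close>

lemma closed_span_finite:
  fixes F :: "'a::real_normed_vector set"
  assumes "finite F"
  shows "closed (span F)"
  using assms
proof (induction F)
  case (insert x F)
  show ?case
  proof (cases "x \<in> span F")
    case True
    then show ?thesis using insert by (simp add: span_redundant)
  next
    case False
    then obtain d where d: "d > 0" "\<And>y. y \<in> span F \<Longrightarrow> d \<le> dist y x"
      using insert.IH unfolding closed_def open_contains_ball
      by (metis ComplI ComplD dist_commute mem_ball not_le subsetD)
    have coef: "\<bar>c\<bar> * d \<le> norm (c *\<^sub>R x + y)" if "y \<in> span F" for c y
    proof (cases "c = 0")
      case False
      have "(- 1 / c) *\<^sub>R y \<in> span F" using that by (rule span_scale)
      then have "d \<le> norm ((- 1 / c) *\<^sub>R y - x)" using d(2) by (simp add: dist_norm)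
      then have "\<bar>c\<bar> * d \<le> \<bar>c\<bar> * norm ((- 1 / c) *\<^sub>R y - x)" by (intro mult_left_mono) auto
      also have "\<dots> = norm (c *\<^sub>R ((- 1 / c) *\<^sub>R y - x))" by simp
      also have "c *\<^sub>R ((- 1 / c) *\<^sub>R y - x) = - (c *\<^sub>R x + y)" using False by (simp add: algebra_simps)
      finally show ?thesis by (simp only: norm_minus_cancel)
    qed simp
    show ?thesis
      unfolding closed_sequential_limits
    proof (intro allI impI)
      fix s l assume "(\<forall>n. s n \<in> span (insert x F)) \<and> s \<longlonglongrightarrow> l"
      then have s: "\<And>n. s n \<in> span (insert x F)" "s \<longlonglongrightarrow> l" by auto
      have "\<forall>n. \<exists>c. s n - c *\<^sub>R x \<in> span F" using s(1) by (simp add: span_breakdown_eq)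
      then obtain c where c: "\<And>n. s n - c n *\<^sub>R x \<in> span F" by metis
      have "Cauchy c"
        unfolding Cauchy_def
      proof (intro allI impI)
        fix e :: real assume "0 < e"
        then have "0 < e * d" using d by simp
        then obtain M where M: "\<And>m n. m \<ge> M \<Longrightarrow> n \<ge> M \<Longrightarrow> dist (s m) (s n) < e * d"
          using LIMSEQ_imp_Cauchy[OF s(2)] unfolding Cauchy_def by blast
        have "dist (c m) (c n) < e" if "m \<ge> M" "n \<ge> M" for m n
        proof -
          have "(s m - c m *\<^sub>R x) - (s n - c n *\<^sub>R x) \<in> span F" by (intro span_diff c)
          from coef[OF this, of "c m - c n"] have "\<bar>c m - c n\<bar> * d \<le> dist (s m) (s n)"
            by (simp add: dist_norm algebra_simps)
          then have "\<bar>c m - c n\<bar> * d < e * d" using M[OF that] by linarith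
          then show ?thesis using d by (simp add: dist_real_def)
        qed
        then show "\<exists>M. \<forall>m\<ge>M. \<forall>n\<ge>M. dist (c m) (c n) < e" by blast
      qed
      then obtain k where "c \<longlonglongrightarrow> k" using Cauchy_convergent_iff convergent_def by blast
      then have "(\<lambda>n. s n - c n *\<^sub>R x) \<longlonglongrightarrow> l - k *\<^sub>R x" by (intro tendsto_intros s)
      then have "l - k *\<^sub>R x \<in> span F"
        by (rule closed_sequentially[OF insert.IH c])
      then show "l \<in> span (insert x F)" by (auto simp: span_breakdown_eq)
    qed
  qed
qed simp

lemma closed_finite_dim_subspace:
  fixes W :: "'a::real_normed_vector set"
  assumes W: "subspace W" and F: "finite F" "W \<subseteq> span F"
  shows "closed W"
proof -
  obtain B where B: "B \<subseteq> W" "independent B" "W \<subseteq> span B" using maximal_independent_subset by blast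
  then have "finite B" using real_vector.independent_span_bound[OF F(1) B(2)] F(2) by blast
  moreover have "span B = W" using B W by (simp add: span_minimal subset_antisym)
  ultimately show ?thesis using closed_span_finite by metis
qed

lemma complex_span_subset_real_span:
  "cvec.span F \<subseteq> span (F \<union> (\<lambda>x. \<i> *\<^sub>C x) ` F)" (is "_ \<subseteq> span ?G")
proof
  fix x :: 'a assume "x \<in> cvec.span F"
  then show "x \<in> span ?G"
  proof (rule cvec.span_induct_alt)
    show "0 \<in> span ?G" by (rule span_zero)
    fix c x y assume x: "x \<in> F" and y: "y \<in> span ?G"
    have "c = of_real (Re c) + of_real (Im c) * \<i>" by (simp add: complex_eq_iff)
    then have "c *\<^sub>C x = Re c *\<^sub>R x + Im c *\<^sub>R (\<i> *\<^sub>C x)"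
      by (metis scaleC_add_left scaleC_scaleC scaleC_of_real)
    moreover have "x \<in> span ?G" "\<i> *\<^sub>C x \<in> span ?G" using x by (auto intro: span_base)
    ultimately have "c *\<^sub>C x \<in> span ?G" by (auto intro!: span_add span_scale)
    then show "c *\<^sub>C x + y \<in> span ?G" using y by (rule span_add)
  qed
qed

lemma generator_linear:
  assumes S: "c0_semigroup S" and f: "f \<in> dom (generator S)"
  shows "g \<in> dom (generator S) \<Longrightarrow> f + g \<in> dom (generator S) \<and>
      the (generator S (f + g)) = the (generator S f) + the (generator S g)"
    and "c *\<^sub>C f \<in> dom (generator S) \<and> the (generator S (c *\<^sub>C f)) = c *\<^sub>C the (generator S f)"
proof -
  show "c *\<^sub>C f \<in> dom (generator S) \<and> the (generator S (c *\<^sub>C f)) = c *\<^sub>C the (generator S f)"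
    by (rule generator_intertwine[OF bounded_clinear_scaleC_map _ f])
      (simp add: bounded_clinear_scaleC c0_semigroupD(1)[OF S])
  assume g: "g \<in> dom (generator S)"
  show "f + g \<in> dom (generator S) \<and>
      the (generator S (f + g)) = the (generator S f) + the (generator S g)"
  proof (rule generatorI)
    have "\<forall>\<^sub>F h in at_right 0. (1 / h) *\<^sub>R (S h f - f) + (1 / h) *\<^sub>R (S h g - g) = (1 / h) *\<^sub>R (S h (f + g) - (f + g))"
      by (auto simp: eventually_at_filter bounded_clinear_add c0_semigroupD(1)[OF S] algebra_simps
          intro!: always_eventually)
    then show "((\<lambda>h. (1 / h) *\<^sub>R (S h (f + g) - (f + g))) \<longlongrightarrow> the (generator S f) + the (generator S g)) (at_right 0)"
      by (rule Lim_transform_eventually[OF tendsto_add[OF generatorD[OF f] generatorD[OF g]]])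
  qed
qed

text \<open>\<open>\<pi>\<close> maps the dense domain into itself and onto a dense subspace of its range, which is closed
  because it is finite-dimensional.\<close>

lemma finite_rank_range_in_dom:
  fixes S :: "real \<Rightarrow> 'a::complex_banach \<Rightarrow> 'a"
  assumes S: "c0_semigroup S" and \<pi>: "finite_rank_projector \<pi>" and comm: "commutes_with \<pi> (generator S)"
  shows "\<pi> f \<in> dom (generator S)"
proof -
  let ?D = "dom (generator S)"
  obtain F where F: "finite F" "range \<pi> \<subseteq> cvec.span F" and lin: "bounded_clinear \<pi>"
    using \<pi> unfolding finite_rank_projector_def by blast
  have D: "0 \<in> ?D"
  proof -
    have "((\<lambda>h. (1 / h) *\<^sub>R (S h 0 - 0)) \<longlongrightarrow> 0) (at_right 0)"
      by (rule tendsto_eventually)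
        (auto simp: eventually_at_filter bounded_clinear_zero c0_semigroupD(1)[OF S] intro!: always_eventually)
    then show ?thesis using generatorI by blast
  qed
  have "subspace (\<pi> ` ?D)"
    unfolding subspace_def
  proof (intro conjI ballI allI)
    show "0 \<in> \<pi> ` ?D" using D bounded_clinear_zero[OF lin] by force
    fix x y assume "x \<in> \<pi> ` ?D" "y \<in> \<pi> ` ?D"
    then obtain f g where fg: "f \<in> ?D" "g \<in> ?D" and [simp]: "x = \<pi> f" "y = \<pi> g" by auto
    have "x + y = \<pi> (f + g)" by (simp add: bounded_clinear_add[OF lin])
    then show "x + y \<in> \<pi> ` ?D" using generator_linear(1)[OF S fg] by blast
  next
    fix c x assume "x \<in> \<pi> ` ?D"
    then obtain f where f: "f \<in> ?D" and [simp]: "x = \<pi> f" by auto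
    have "c *\<^sub>R x = \<pi> (of_real c *\<^sub>C f)" by (simp add: bounded_clinear_scaleR[OF lin] scaleC_of_real)
    then show "c *\<^sub>R x \<in> \<pi> ` ?D" using generator_linear(2)[OF S f] by blast
  qed
  then have "closed (\<pi> ` ?D)"
    by (rule closed_finite_dim_subspace[of _ "F \<union> (\<lambda>x. \<i> *\<^sub>C x) ` F"])
      (use F complex_span_subset_real_span[of F] in auto)
  moreover have "\<pi> f \<in> closure (\<pi> ` ?D)"
    using image_closure_subset[of ?D \<pi> "closure (\<pi> ` ?D)"] closure_subset[of "\<pi> ` ?D"]
      generator_dense[OF S] bounded_clinear_continuous_on[OF lin continuous_on_id] by auto
  ultimately obtain g where "g \<in> ?D" "\<pi> f = \<pi> g" by auto
  then show ?thesis using comm unfolding commutes_with_def by metis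
qed

lemma spectrum_eigenvalue:
  assumes spec: "spectrum_on V (P |` V) = {\<xi>}" and "c \<noteq> \<xi>" and v: "v \<in> V" "v \<in> dom P" "the (P v) = c *\<^sub>C v"
    and zero: "0 \<in> V" "0 \<in> dom P" "the (P 0) = 0"
  shows "v = 0"
proof -
  have "c \<in> resolvent_set_on V (P |` V)" using assms(1,2) by (auto simp: spectrum_on_def)
  then have "inj_on (\<lambda>f. c *\<^sub>C f - the ((P |` V) f)) (dom (P |` V))"
    by (auto simp: resolvent_set_on_def bij_betw_def)
  from inj_onD[OF this, of v 0] show ?thesis using v zero by simp
qed

definition poly_apply :: "('a::complex_banach \<Rightarrow> 'a) \<Rightarrow> complex poly \<Rightarrow> 'a \<Rightarrow> 'a"
  where "poly_apply N p w = (\<Sum>i\<le>degree p. coeff p i *\<^sub>C (N ^^ i) w)"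

lemma poly_apply_bound:
  assumes "degree p \<le> n"
  shows "poly_apply N p w = (\<Sum>i\<le>n. coeff p i *\<^sub>C (N ^^ i) w)"
  unfolding poly_apply_def
  by (rule sum.mono_neutral_left) (use assms in \<open>auto simp: coeff_eq_0\<close>)

lemma poly_apply_linear_factor:
  assumes N: "bounded_clinear N"
  shows "poly_apply N ([:- z, 1:] * q) w = poly_apply N q (N w - z *\<^sub>C w)"
proof -
  define n where "n = degree q"
  have *: "(N ^^ i) (N w - z *\<^sub>C w) = (N ^^ Suc i) w - z *\<^sub>C (N ^^ i) w" for i
    using bounded_clinear_funpow[OF N, of i]
    by (simp add: bounded_clinear_diff bounded_clinear_scaleC funpow_swap1)
  have "degree ([:- z, 1:] * q) \<le> Suc n"
    using degree_mult_le[of "[:- z, 1:]" q] by (simp add: n_def)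
  then have "poly_apply N ([:- z, 1:] * q) w = (\<Sum>i\<le>Suc n. coeff ([:- z, 1:] * q) i *\<^sub>C (N ^^ i) w)"
    by (rule poly_apply_bound)
  also have "\<dots> = (\<Sum>i\<le>Suc n. (coeff (pCons 0 q) i *\<^sub>C (N ^^ i) w) - z *\<^sub>C coeff q i *\<^sub>C (N ^^ i) w)"
    by (rule sum.cong) (auto simp: scaleC_scaleC cvec.scale_left_diff_distrib[symmetric])
  also have "\<dots> = (\<Sum>i\<le>Suc n. coeff (pCons 0 q) i *\<^sub>C (N ^^ i) w) - (\<Sum>i\<le>Suc n. z *\<^sub>C coeff q i *\<^sub>C (N ^^ i) w)"
    by (rule sum_subtractf)
  also have "(\<Sum>i\<le>Suc n. coeff (pCons 0 q) i *\<^sub>C (N ^^ i) w) = (\<Sum>i\<le>n. coeff q i *\<^sub>C (N ^^ Suc i) w)"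
    by (subst sum.atMost_Suc_shift) simp
  also have "(\<Sum>i\<le>Suc n. z *\<^sub>C coeff q i *\<^sub>C (N ^^ i) w) = (\<Sum>i\<le>n. z *\<^sub>C coeff q i *\<^sub>C (N ^^ i) w)"
    by (simp add: n_def coeff_eq_0)
  also have "(\<Sum>i\<le>n. coeff q i *\<^sub>C (N ^^ Suc i) w) - (\<Sum>i\<le>n. z *\<^sub>C coeff q i *\<^sub>C (N ^^ i) w)
      = (\<Sum>i\<le>n. coeff q i *\<^sub>C (N ^^ i) (N w - z *\<^sub>C w))"
    unfolding * sum_subtractf[symmetric]
    by (rule sum.cong) (simp_all add: scaleC_diff_right scaleC_scaleC mult.commute)
  finally show ?thesis by (simp add: poly_apply_def n_def)
qed

text \<open>By the fundamental theorem of algebra an annihilating polynomial of \<open>w\<close> splits into linear factors;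
  those with a nonzero root can be cancelled, and only powers of \<open>N\<close> remain.\<close>

lemma locally_nilpotent_of_annihilator:
  fixes N :: "'a::complex_banach \<Rightarrow> 'a"
  assumes N: "bounded_clinear N" and V: "cvec.subspace V" "\<And>v. v \<in> V \<Longrightarrow> N v \<in> V"
    and inj: "\<And>z v. z \<noteq> 0 \<Longrightarrow> v \<in> V \<Longrightarrow> N v = z *\<^sub>C v \<Longrightarrow> v = 0"
    and "p \<noteq> 0" "w \<in> V" "poly_apply N p w = 0"
  shows "\<exists>m. (N ^^ m) w = 0"
  using assms(5-)
proof (induction "degree p" arbitrary: p w rule: less_induct)
  case less
  have powV: "(N ^^ m) v \<in> V" if "v \<in> V" for m v using that by (induction m) (auto intro: V)
  show ?case
  proof (cases "degree p = 0")
    case True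
    then have "coeff p 0 \<noteq> 0" "coeff p 0 *\<^sub>C w = 0"
      using less.prems leading_coeff_0_iff[of p] by (auto simp: poly_apply_def)
    then have "w = 0" by (simp add: cvec.scale_eq_0_iff)
    then show ?thesis by (intro exI[of _ 0]) simp
  next
    case False
    then have "\<not> constant (poly p)" by (simp add: constant_degree)
    then obtain z where "poly p z = 0" using fundamental_theorem_of_algebra by blast
    then obtain q where q: "p = [:- z, 1:] * q" using poly_eq_0_iff_dvd by (metis dvdE)
    then have "q \<noteq> 0" using less.prems(1) by auto
    then have "degree q < degree p" unfolding q by (subst degree_mult_eq) auto
    moreover have "N w - z *\<^sub>C w \<in> V"
      using less.prems(2) by (intro cvec.subspace_diff V cvec.subspace_scale)
    moreover have "poly_apply N q (N w - z *\<^sub>C w) = 0"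
      using less.prems(3) unfolding q poly_apply_linear_factor[OF N] .
    ultimately obtain m where "(N ^^ m) (N w - z *\<^sub>C w) = 0" using less.hyps \<open>q \<noteq> 0\<close> by blast
    then have m: "N ((N ^^ m) w) = z *\<^sub>C (N ^^ m) w"
      using bounded_clinear_funpow[OF N, of m]
      by (simp add: bounded_clinear_diff bounded_clinear_scaleC funpow_swap1)
    show ?thesis
    proof (cases "z = 0")
      case True
      then show ?thesis using m by (intro exI[of _ "Suc m"]) simp
    next
      case False
      then show ?thesis using inj[OF False powV[OF less.prems(2)] m] by blast
    qed
  qed
qed

lemma finite_span_sequence_dependent:
  fixes x :: "nat \<Rightarrow> 'a::complex_banach"
  assumes F: "finite F" and x: "\<And>i. x i \<in> cvec.span F"
  shows "\<exists>c. (\<exists>i\<le>card F. c i \<noteq> 0) \<and> (\<Sum>i\<le>card F. c i *\<^sub>C x i) = 0"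
proof (cases "inj_on x {..card F}")
  case True
  have "\<not> cvec.independent (x ` {..card F})"
  proof
    assume "cvec.independent (x ` {..card F})"
    from cvec.independent_span_bound[OF F this] x have "card (x ` {..card F}) \<le> card F" by blast
    then show False using card_image[OF True] by simp
  qed
  then obtain u where u: "\<exists>v\<in>x ` {..card F}. u v \<noteq> 0" "(\<Sum>v\<in>x ` {..card F}. u v *\<^sub>C v) = 0"
    using cvec.dependent_finite[of "x ` {..card F}"] by blast
  have "(\<Sum>i\<le>card F. u (x i) *\<^sub>C x i) = 0" using u(2) by (simp add: sum.reindex[OF True])
  then show ?thesis using u(1) by (intro exI[of _ "\<lambda>i. u (x i)"]) auto
next
  case False
  then obtain i j where ij: "i \<le> card F" "j \<le> card F" "x i = x j" "i \<noteq> j" by (auto simp: inj_on_def)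
  define c where "c = (\<lambda>k. (if k = i then 1 else 0) + (if k = j then - 1 else 0 :: complex))"
  have "(\<Sum>k\<le>card F. c k *\<^sub>C x k) = (\<Sum>k\<le>card F. (if k = i then x k else 0) + (if k = j then - x k else 0))"
    by (rule sum.cong) (auto simp: c_def)
  also have "\<dots> = 0" using ij by (simp add: sum.distrib)
  finally show ?thesis using ij by (intro exI[of _ c]) (auto simp: c_def)
qed

lemma finite_span_annihilator:
  fixes N :: "'a::complex_banach \<Rightarrow> 'a"
  assumes F: "finite F" and x: "\<And>i. (N ^^ i) w \<in> cvec.span F"
  shows "\<exists>p. p \<noteq> 0 \<and> poly_apply N p w = 0"
proof -
  have "\<exists>c. (\<exists>i\<le>card F. c i \<noteq> 0) \<and> (\<Sum>i\<le>card F. c i *\<^sub>C (N ^^ i) w) = 0"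
    by (rule finite_span_sequence_dependent[OF F x])
  then obtain c where c': "(\<exists>i\<le>card F. c i \<noteq> 0) \<and> (\<Sum>i\<le>card F. c i *\<^sub>C (N ^^ i) w) = 0"
    by (rule exE)
  note c = conjunct1[OF c'] conjunct2[OF c']
  define p where "p = (\<Sum>i\<le>card F. monom (c i) i)"
  have coeff: "coeff p k = (if k \<le> card F then c k else 0)" for k
    by (simp add: p_def coeff_sum)
  have "degree p \<le> card F" by (rule degree_le) (simp add: coeff)
  then have "poly_apply N p w = (\<Sum>i\<le>card F. coeff p i *\<^sub>C (N ^^ i) w)" by (rule poly_apply_bound)
  then have "poly_apply N p w = 0" using c(2) by (simp add: coeff)
  moreover have "p \<noteq> 0"
  proof -
    obtain i where "i \<le> card F" "c i \<noteq> 0" using c(1) by blast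
    then have "coeff p i \<noteq> 0" by (simp add: coeff)
    then show ?thesis by auto
  qed
  ultimately show ?thesis by blast
qed

definition spectral_projector :: "(real \<Rightarrow> 'a::complex_banach \<Rightarrow> 'a) \<Rightarrow> complex \<Rightarrow> ('a \<Rightarrow> 'a) \<Rightarrow> bool"
  where "spectral_projector S \<xi> \<pi> \<longleftrightarrow> finite_rank_projector \<pi> \<and> commutes_with \<pi> (generator S) \<and>
    spectrum_on (range \<pi>) (generator S |` range \<pi>) = {\<xi>}"

lemma spectral_projectorD:
  assumes "spectral_projector S \<xi> \<pi>"
  shows "finite_rank_projector \<pi>" "commutes_with \<pi> (generator S)"
    "spectrum_on (range \<pi>) (generator S |` range \<pi>) = {\<xi>}"
    "bounded_clinear \<pi>" "\<pi> (\<pi> f) = \<pi> f"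
    "c0_semigroup S \<Longrightarrow> 0 \<le> t \<Longrightarrow> \<pi> (S t f) = S t (\<pi> f)"
proof -
  show *: "finite_rank_projector \<pi>" "commutes_with \<pi> (generator S)"
    "spectrum_on (range \<pi>) (generator S |` range \<pi>) = {\<xi>}"
    using assms by (auto simp: spectral_projector_def)
  show lin: "bounded_clinear \<pi>" and "\<pi> (\<pi> f) = \<pi> f"
    using *(1) by (auto simp: finite_rank_projector_def fun_eq_iff)
  show "\<pi> (S t f) = S t (\<pi> f)" if "c0_semigroup S" "0 \<le> t"
    by (rule semigroup_intertwine[OF that(1,1) lin _ that(2)]) (use *(2) in \<open>auto simp: commutes_with_def\<close>)
qed

text \<open>\<open>N\<close> is the generator minus \<open>\<xi>\<close> on the range of \<open>\<pi>\<close>. It is a pointwise limit of difference quotients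
  of bounded operators, hence bounded, and it has no nonzero eigenvalue, hence is nilpotent.\<close>

lemma spectral_projector_nilpotent:
  fixes S :: "real \<Rightarrow> 'a::complex_banach \<Rightarrow> 'a"
  assumes S: "c0_semigroup S" and \<pi>: "spectral_projector S \<xi> \<pi>"
  obtains N m where "bounded_clinear N" "\<And>f. N (\<pi> f) = N f" "\<And>f. \<pi> (N f) = N f"
    "\<And>f. (N ^^ m) f = 0" "\<And>f. the (generator S (\<pi> f)) = \<xi> *\<^sub>C \<pi> f + N f"
proof -
  let ?P = "generator S"
  note frp = spectral_projectorD(1)[OF \<pi>] and comm = spectral_projectorD(2)[OF \<pi>]
    and spec = spectral_projectorD(3)[OF \<pi>] and lin = spectral_projectorD(4)[OF \<pi>]
    and idem = spectral_projectorD(5)[OF \<pi>]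
  note dom = finite_rank_range_in_dom[OF S frp comm]
  obtain F where F: "finite F" "range \<pi> \<subseteq> cvec.span F"
    using frp unfolding finite_rank_projector_def by blast
  define N where "N = (\<lambda>f. the (?P (\<pi> f)) - \<xi> *\<^sub>C \<pi> f)"
  have "bounded_clinear (\<lambda>f. the (?P (\<pi> f)))"
  proof -
    define T where "T = (\<lambda>k f. real (Suc k) *\<^sub>R (S (1 / real (Suc k)) (\<pi> f) - \<pi> f))"
    have lim: "(\<lambda>k. T k f) \<longlonglongrightarrow> the (?P (\<pi> f))" for f
    proof -
      have "filterlim (\<lambda>k. 1 / real (Suc k)) (at_right 0) sequentially"
        unfolding filterlim_at using LIMSEQ_inverse_real_of_nat by (auto simp: inverse_eq_divide)
      from filterlim_compose[OF generatorD[OF dom] this] show ?thesis by (simp add: T_def)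
    qed
    have "\<exists>K. \<forall>k\<in>UNIV. \<forall>f. norm (T k f) \<le> K * norm f"
    proof (rule uniform_boundedness)
      have "bounded_clinear (\<lambda>f. of_real (real (Suc k)) *\<^sub>C (S (1 / real (Suc k)) (\<pi> f) - \<pi> f))" for k
        by (rule bounded_clinear_compose[OF bounded_clinear_scaleC_map
              bounded_clinear_diff_map[OF bounded_clinear_compose[OF c0_semigroupD(1)[OF S] lin] lin]]) simp
      then show "bounded_linear (T k)" for k
        unfolding scaleC_of_real T_def by (rule bounded_clinear_linear)
      show "\<exists>K. \<forall>k\<in>UNIV. norm (T k f) \<le> K" for f
        using convergent_imp_Bseq[OF convergentI[OF lim]] unfolding Bseq_def by blast
    qed
    then obtain K where K: "\<And>k f. norm (T k f) \<le> K * norm f" by blast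
    show ?thesis
    proof (rule bounded_clinearI)
      show "norm (the (?P (\<pi> f))) \<le> K * norm f" for f
        by (rule LIMSEQ_le_const2[OF tendsto_norm[OF lim]]) (use K in auto)
    qed (use generator_linear[OF S dom] dom in \<open>auto simp: bounded_clinear_add[OF lin] bounded_clinear_scaleC[OF lin]\<close>)
  qed
  then have N: "bounded_clinear N"
    unfolding N_def by (intro bounded_clinear_diff_map bounded_clinear_compose[OF bounded_clinear_scaleC_map lin])
  have N\<pi>: "N (\<pi> f) = N f" for f by (simp add: N_def idem)
  have \<pi>N: "\<pi> (N f) = N f" for f
    using comm dom[of f] idem[of f] unfolding commutes_with_def N_def
    by (metis (no_types, lifting) bounded_clinear_diff bounded_clinear_scaleC lin)
  define V where "V = range \<pi>"
  have V: "v \<in> V \<longleftrightarrow> \<pi> v = v" for v using idem by (auto simp: V_def) (metis rangeI)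
  have sub: "cvec.subspace V"
    by (auto simp: cvec.subspace_def V bounded_clinear_zero[OF lin] bounded_clinear_add[OF lin] bounded_clinear_scaleC[OF lin])
  have inj: "v = 0" if "z \<noteq> 0" "v \<in> V" "N v = z *\<^sub>C v" for z v
  proof (rule spectrum_eigenvalue[OF spec, folded V_def])
    show "\<xi> + z \<noteq> \<xi>" using that by simp
    show "v \<in> V" by (rule that)
    then have v: "\<pi> v = v" by (simp add: V)
    show "v \<in> dom ?P" using dom[of v] v by simp
    show "the (?P v) = (\<xi> + z) *\<^sub>C v" using that(3) v by (simp add: N_def scaleC_add_left algebra_simps)
    show "0 \<in> V" by (rule cvec.subspace_0[OF sub])
    show "0 \<in> dom ?P" using dom[of 0] by (simp add: bounded_clinear_zero[OF lin])
    show "the (?P 0) = 0" using bounded_clinear_zero[OF N] by (simp add: N_def bounded_clinear_zero[OF lin])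
  qed
  have NV: "N v \<in> V" if "v \<in> V" for v by (simp add: V \<pi>N)
  have powV: "(N ^^ i) v \<in> V" if "v \<in> V" for i v
    using that by (induction i) (auto simp: NV)
  have local_nil: "\<exists>m. (N ^^ m) v = 0" if v: "v \<in> V" for v
  proof -
    have "(N ^^ i) v \<in> cvec.span F" for i using powV[OF v] F(2) by (auto simp: V_def)
    then obtain p where p: "p \<noteq> 0" "poly_apply N p v = 0"
      using finite_span_annihilator[OF F(1)] by blast
    show ?thesis
    proof (rule locally_nilpotent_of_annihilator[OF N sub NV _ p(1) v p(2)])
      fix z u assume "z \<noteq> 0" "u \<in> V" "N u = z *\<^sub>C u"
      then show "u = 0" by (rule inj)
    qed
  qed
  then have "\<forall>x. \<exists>m. (N ^^ m) (\<pi> x) = 0" by (simp add: V_def)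
  from choice[OF this] obtain m where m: "\<forall>x. (N ^^ m x) (\<pi> x) = 0" ..
  \<comment> \<open>The successor makes the exponent positive, so that \<open>N (\<pi> f) = N f\<close> removes the projector below.\<close>
  define M where "M = Suc (\<Sum>x\<in>F. m x)"
  have N0: "(N ^^ k) 0 = 0" for k by (rule bounded_clinear_zero[OF bounded_clinear_funpow[OF N]])
  have vanish: "(N ^^ M) (\<pi> x) = 0" if "x \<in> F" for x
  proof -
    have "m x \<le> M" using member_le_sum[OF that _ F(1), of m] by (simp add: M_def)
    then have "(N ^^ M) (\<pi> x) = (N ^^ (M - m x)) ((N ^^ m x) (\<pi> x))"
      by (metis comp_apply funpow_add le_add_diff_inverse2)
    then show ?thesis by (simp add: m N0)
  qed
  have "(N ^^ M) (\<pi> f) = 0" if "f \<in> cvec.span F" for f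
    using that
  proof (rule cvec.span_induct_alt)
    show "(N ^^ M) (\<pi> 0) = 0" by (simp add: bounded_clinear_zero[OF lin] N0)
    show "(N ^^ M) (\<pi> (c *\<^sub>C x + y)) = 0" if "x \<in> F" "(N ^^ M) (\<pi> y) = 0" for c x y
      using that vanish
      by (simp add: bounded_clinear_add[OF lin] bounded_clinear_scaleC[OF lin]
          bounded_clinear_add[OF bounded_clinear_funpow[OF N]] bounded_clinear_scaleC[OF bounded_clinear_funpow[OF N]])
  qed
  then have "(N ^^ M) (\<pi> (\<pi> f)) = 0" for f using F(2) by blast
  moreover have "(N ^^ M) (\<pi> f) = (N ^^ M) f" for f
    unfolding M_def by (simp add: funpow_swap1 N\<pi> del: funpow.simps) (simp add: funpow_Suc_right N\<pi> del: funpow.simps)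
  ultimately have nil: "(N ^^ M) f = 0" for f by (simp add: idem)
  show ?thesis by (rule that[OF N N\<pi> \<pi>N nil]) (simp add: N_def)
qed

section \<open>Running the semigroup backwards on a spectral subspace\<close>

lemma power_over_fact_le_exp:
  fixes x :: real
  assumes "0 \<le> x"
  shows "x ^ k / fact k \<le> exp x"
proof -
  have "(\<Sum>n\<in>{k}. x ^ n /\<^sub>R fact n) \<le> (\<Sum>n. x ^ n /\<^sub>R fact n)"
    by (rule sum_le_suminf) (use assms summable_exp_generic[of x] in auto)
  then show ?thesis by (simp add: exp_def divide_inverse mult.commute)
qed

lemma exp_bounded_product:
  assumes "exp_bounded b X" "exp_bounded c Y"
  shows "exp_bounded (b + c) (\<lambda>t f. X t (Y t f))"
proof -
  obtain C where C: "C > 0" "\<And>t f. 0 \<le> t \<Longrightarrow> norm (X t f) \<le> C * exp (b * t) * norm f"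
    by (rule exp_boundedE[OF assms(1)]) blast
  obtain D where D: "D > 0" "\<And>t f. 0 \<le> t \<Longrightarrow> norm (Y t f) \<le> D * exp (c * t) * norm f"
    by (rule exp_boundedE[OF assms(2)]) blast
  have "norm (X t (Y t f)) \<le> C * D * exp ((b + c) * t) * norm f" if t: "0 \<le> t" for t f
  proof -
    have "norm (X t (Y t f)) \<le> C * exp (b * t) * (D * exp (c * t) * norm f)"
      by (rule order_trans[OF C(2)[OF t]], intro mult_left_mono D(2) t) (use C in auto)
    moreover have "exp ((b + c) * t) = exp (b * t) * exp (c * t)" by (simp add: distrib_right exp_add)
    ultimately show ?thesis by (simp only: mult_ac)
  qed
  then show ?thesis unfolding exp_bounded_def by blast
qed

lemma sc_family_product:
  assumes X: "sc_family X" and Y: "sc_family Y"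
  shows "sc_family (\<lambda>t f. X t (Y t f))"
proof -
  obtain b c where "exp_bounded b X" "exp_bounded c Y" using assms by (auto simp: sc_family_def)
  then have "exp_bounded (b + c) (\<lambda>t f. X t (Y t f))" by (rule exp_bounded_product)
  moreover have "bounded_clinear (\<lambda>f. X t (Y t f))" if "0 \<le> t" for t
    by (rule bounded_clinear_compose[OF sc_familyD(1)[OF X that] sc_familyD(1)[OF Y that]])
  moreover have "continuous_on {0..} (\<lambda>t. X t (Y t f))" for f
    by (rule sc_family_continuous_on[OF X continuous_on_id _ sc_familyD(2)[OF Y]]) simp
  ultimately show ?thesis unfolding sc_family_def by blast
qed

lemma sc_family_sum:
  assumes "finite I" "\<And>i. i \<in> I \<Longrightarrow> sc_family (X i)"
  shows "sc_family (\<lambda>t f. \<Sum>i\<in>I. X i t f)"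
  using assms
proof (induction I)
  case empty
  have "exp_bounded 0 (\<lambda>t f. 0)" by (auto simp: exp_bounded_def intro!: exI[of _ 0])
  then show ?case by (auto simp: sc_family_def bounded_clinear_zero_map)
qed (simp add: sc_family_add)

lemma exp_bounded_sum:
  assumes "finite I" "\<And>i. i \<in> I \<Longrightarrow> exp_bounded b (X i)"
  shows "exp_bounded b (\<lambda>t f. \<Sum>i\<in>I. X i t f)"
  using assms
proof (induction I)
  case empty
  show ?case by (auto simp: exp_bounded_def intro!: exI[of _ 0])
qed (simp add: exp_bounded_add)

text \<open>\<open>R t = exp (- \<xi> t) (\<Sum>k<m. (- t N)\<^sup>k / k!) \<pi>\<close>, the exponential series of the inverse group on the range of
  \<open>\<pi>\<close>, cut off by nilpotency. The powers of \<open>t\<close> cost the gap between \<open>b\<close> and \<open>Re \<xi>\<close>.\<close>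

lemma backward_family:
  fixes S :: "real \<Rightarrow> 'a::complex_banach \<Rightarrow> 'a"
  assumes S: "c0_semigroup S" and \<pi>: "spectral_projector S \<xi> \<pi>" and b: "b < Re \<xi>"
  obtains R where "sc_family R" "exp_bounded (- b) R" "\<And>f. R 0 f = \<pi> f"
    "\<And>s t f. 0 \<le> s \<Longrightarrow> s \<le> t \<Longrightarrow> S s (R t f) = R (t - s) f"
    "\<And>s t f. 0 \<le> s \<Longrightarrow> s \<le> t \<Longrightarrow> R t (S s f) = R (t - s) f"
proof -
  obtain N m where N: "bounded_clinear N" "\<And>f. N (\<pi> f) = N f" "\<And>f. \<pi> (N f) = N f"
    and nil: "\<And>f. (N ^^ m) f = 0" and gen: "\<And>f. the (generator S (\<pi> f)) = \<xi> *\<^sub>C \<pi> f + N f"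
    using spectral_projector_nilpotent[OF S \<pi>] by blast
  note lin = spectral_projectorD(4)[OF \<pi>] and idem = spectral_projectorD(5)[OF \<pi>]
  note dom = finite_rank_range_in_dom[OF S spectral_projectorD(1,2)[OF \<pi>]]
  note Nk = bounded_clinear_funpow[OF N(1)]
  define e where "e = (\<lambda>k (t::real). exp (- \<xi> * of_real t) * (- of_real t) ^ k / fact k)"
  define R where "R = (\<lambda>t f. \<Sum>k<m. e k t *\<^sub>C (N ^^ k) (\<pi> f))"
  \<comment> \<open>The derivative of \<open>e k\<close>; the case distinction stands for \<open>e (-1) = 0\<close>.\<close>
  define e' where "e' = (\<lambda>k t. - \<xi> * e k t - (if k = 0 then 0 else e (k - 1) t))"
  have e_deriv: "(e k has_vector_derivative e' k t) (at t)" for k t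
  proof -
    have "((\<lambda>z. exp (- \<xi> * z) * (- z) ^ k / fact k) has_field_derivative e' k t) (at (of_real t))"
    proof (cases k)
      case 0
      then show ?thesis unfolding e'_def e_def by (auto intro!: derivative_eq_intros)
    next
      case (Suc j)
      have 1: "((\<lambda>z. exp (- \<xi> * z)) has_field_derivative - \<xi> * exp (- \<xi> * of_real t)) (at (of_real t))"
        by (auto intro!: derivative_eq_intros)
      have 2: "((\<lambda>z. (- z) ^ Suc j / fact (Suc j)) has_field_derivative - ((- of_real t) ^ j / fact j))
          (at (of_real t :: complex))"
      proof -
        have "((\<lambda>z::complex. (- z) ^ Suc j / fact (Suc j)) has_field_derivative
            of_nat (Suc j) * (- 1 * (- of_real t) ^ (Suc j - Suc 0)) / fact (Suc j)) (at (of_real t))"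
          by (intro DERIV_cdivide DERIV_power DERIV_minus DERIV_ident)
        then show ?thesis by (simp del: of_nat_Suc power_Suc)
      qed
      from DERIV_mult[OF 1 2] show ?thesis unfolding e'_def e_def Suc
        by (simp add: mult_ac del: fact_Suc)
    qed
    then show ?thesis unfolding e_def by (rule has_vector_derivative_real_field)
  qed
  have lin_z: "bounded_clinear (\<lambda>z::complex. z *\<^sub>C v)" for v :: 'a
    by (rule bounded_clinearI[where K = "norm v"])
      (auto simp: scaleC_add_left scaleC_complex_def scaleC_scaleC norm_scaleC mult.commute)
  have term_deriv: "((\<lambda>t. e k t *\<^sub>C v) has_vector_derivative e' k t *\<^sub>C v) (at t)" for k t and v :: 'a
    by (rule bounded_linear.has_vector_derivative[OF bounded_clinear_linear[OF lin_z[of v]] e_deriv[of k t]])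
  have NR: "N (R t f) = (\<Sum>k<m. e k t *\<^sub>C (N ^^ Suc k) (\<pi> f))" for t f
    unfolding R_def by (simp add: bounded_clinear_sum[OF N(1)] bounded_clinear_scaleC[OF N(1)])
  have \<pi>Nk: "\<pi> ((N ^^ k) (\<pi> f)) = (N ^^ k) (\<pi> f)" for k f by (cases k) (simp_all add: N(3) idem)
  have \<pi>R: "\<pi> (R t f) = R t f" for t f
    unfolding R_def by (simp add: bounded_clinear_sum[OF lin] bounded_clinear_scaleC[OF lin] \<pi>Nk)
  have PR: "R t f \<in> dom (generator S)" "the (generator S (R t f)) = \<xi> *\<^sub>C R t f + N (R t f)" for t f
    using dom[of "R t f"] gen[of "R t f"] by (simp_all add: \<pi>R)
  have R_deriv: "((\<lambda>t. R t f) has_vector_derivative - the (generator S (R t f))) (at t)" for t f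
  proof -
    have "((\<lambda>t. R t f) has_vector_derivative (\<Sum>k<m. e' k t *\<^sub>C (N ^^ k) (\<pi> f))) (at t)"
      unfolding R_def by (rule has_vector_derivative_sum) (rule term_deriv)
    moreover have "(\<Sum>k<m. e' k t *\<^sub>C (N ^^ k) (\<pi> f)) = - (\<xi> *\<^sub>C R t f + N (R t f))"
    proof -
      let ?h = "\<lambda>k. (if k = 0 then 0 else e (k - 1) t) *\<^sub>C (N ^^ k) (\<pi> f)"
      \<comment> \<open>The extra summand contains \<open>N\<^sup>m = 0\<close>; it makes room for the index shift.\<close>
      have "(\<Sum>k<m. ?h k) = (\<Sum>k<Suc m. ?h k)" by (simp add: nil)
      also have "\<dots> = N (R t f)" unfolding NR by (subst sum.lessThan_Suc_shift) simp
      finally have h: "(\<Sum>k<m. ?h k) = N (R t f)" .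
      have "(\<Sum>k<m. e' k t *\<^sub>C (N ^^ k) (\<pi> f)) = (\<Sum>k<m. - (\<xi> *\<^sub>C e k t *\<^sub>C (N ^^ k) (\<pi> f)) - ?h k)"
      proof (rule sum.cong)
        fix k
        have "e' k t *\<^sub>C x = - (\<xi> *\<^sub>C e k t *\<^sub>C x) - (if k = 0 then 0 else e (k - 1) t) *\<^sub>C x" for x :: 'a
          unfolding e'_def by (simp add: cvec.scale_left_diff_distrib scaleC_scaleC)
        then show "e' k t *\<^sub>C (N ^^ k) (\<pi> f) = - (\<xi> *\<^sub>C e k t *\<^sub>C (N ^^ k) (\<pi> f)) - ?h k" .
      qed simp
      also have "\<dots> = - (\<xi> *\<^sub>C R t f) - N (R t f)"
        unfolding sum_subtractf h sum_negf R_def by (simp add: cvec.scale_sum_right)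
      finally show ?thesis by simp
    qed
    ultimately show ?thesis by (simp add: PR(2))
  qed
  have e_bound: "\<exists>K\<ge>0. \<forall>t\<ge>0. cmod (e k t) \<le> K * exp (- b * t)" for k
  proof -
    define d where "d = Re \<xi> - b"
    have d: "0 < d" using b by (simp add: d_def)
    have "cmod (e k t) \<le> (1 / d ^ k) * exp (- b * t)" if t: "0 \<le> t" for t
    proof -
      have "cmod (e k t) = exp (- Re \<xi> * t) * (t ^ k / fact k)"
        using t by (simp add: e_def norm_mult norm_divide norm_power)
      also have "\<dots> = (1 / d ^ k) * exp (- Re \<xi> * t) * ((d * t) ^ k / fact k)"
        using d by (simp add: power_mult_distrib)
      also have "\<dots> \<le> (1 / d ^ k) * exp (- Re \<xi> * t) * exp (d * t)"
        by (intro mult_left_mono power_over_fact_le_exp) (use d t in auto)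
      also have "\<dots> = (1 / d ^ k) * exp (- b * t)"
        by (simp add: d_def exp_add[symmetric] algebra_simps)
      finally show ?thesis .
    qed
    then show ?thesis using d by (intro exI[of _ "1 / d ^ k"]) auto
  qed
  have summand: "sc_family (\<lambda>t f. e k t *\<^sub>C (N ^^ k) (\<pi> f)) \<and> exp_bounded (- b) (\<lambda>t f. e k t *\<^sub>C (N ^^ k) (\<pi> f))" for k
  proof -
    note linNk\<pi> = bounded_clinear_compose[OF Nk[of k] lin]
    obtain K where K: "K \<ge> 0" "\<And>t. 0 \<le> t \<Longrightarrow> cmod (e k t) \<le> K * exp (- b * t)" using e_bound by blast
    have "exp_bounded (- b) (\<lambda>t f::'a. e k t *\<^sub>C f)"
      unfolding exp_bounded_def using K by (auto simp: norm_scaleC intro!: exI[of _ K] mult_right_mono)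
    from exp_bounded_precompose[OF this linNk\<pi>]
    have eb: "exp_bounded (- b) (\<lambda>t f. e k t *\<^sub>C (N ^^ k) (\<pi> f))" .
    have "continuous_on {0..} (\<lambda>t. e k t *\<^sub>C (N ^^ k) (\<pi> f))" for f
      by (intro continuous_at_imp_continuous_on ballI has_vector_derivative_continuous[OF term_deriv])
    then show ?thesis
      using eb bounded_clinear_compose[OF bounded_clinear_scaleC_map linNk\<pi>] unfolding sc_family_def by blast
  qed
  have R: "sc_family R" "exp_bounded (- b) R"
    unfolding R_def using summand by (auto intro!: sc_family_sum exp_bounded_sum)
  have R0: "R 0 f = \<pi> f" for f
  proof (cases m)
    case 0
    then have "\<pi> f = 0" using nil[of "\<pi> f"] by simp
    then show ?thesis using 0 by (simp add: R_def)
  next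
    case (Suc j)
    then show ?thesis unfolding R_def Suc by (subst sum.lessThan_Suc_shift) (simp add: e_def)
  qed
  have SR: "S s (R t f) = R (t - s) f" if s: "0 \<le> s" for s t f
  proof -
    have "R (t - s) f = S s (R (t - 0) f)"
    proof (rule orbit_unique[OF S s])
      fix r :: real
      show "R (t - r) f \<in> dom (generator S)" by (rule PR)
      have "((\<lambda>r. t - r) has_vector_derivative - 1) (at r)" by (auto intro!: derivative_eq_intros)
      from vector_diff_chain_at[OF this R_deriv]
      have "((\<lambda>r. R (t - r) f) has_vector_derivative the (generator S (R (t - r) f))) (at r)"
        by (simp add: o_def)
      then show "((\<lambda>r. R (t - r) f) has_vector_derivative the (generator S (R (t - r) f))) (at r within {0..s})"
        by (rule has_vector_derivative_at_within)
    qed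
    then show ?thesis by simp
  qed
  have RS: "R t (S s f) = S s (R t f)" if s: "0 \<le> s" for s t f
  proof -
    note linS = c0_semigroupD(1)[OF S s]
    note \<pi>S = spectral_projectorD(6)[OF \<pi> S s]
    have NS: "N (S s f) = S s (N f)" for f
    proof -
      have "\<xi> *\<^sub>C S s (\<pi> f) + N (S s f) = S s (the (generator S (\<pi> f)))"
        using gen[of "S s f"] generator_invariant(2)[OF S dom s, of f] by (simp add: \<pi>S)
      also have "\<dots> = \<xi> *\<^sub>C S s (\<pi> f) + S s (N f)"
        by (simp add: gen bounded_clinear_add[OF linS] bounded_clinear_scaleC[OF linS])
      finally show ?thesis by simp
    qed
    have "(N ^^ k) (S s f) = S s ((N ^^ k) f)" for k f by (induction k) (simp_all add: NS)
    then show ?thesis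
      unfolding R_def by (simp add: \<pi>S bounded_clinear_sum[OF linS] bounded_clinear_scaleC[OF linS])
  qed
  show ?thesis by (rule that[OF R R0]) (simp_all add: SR RS)
qed

section \<open>Factorisation of the projectors through the small space\<close>

text \<open>The projector on the other space will be such an improper integral, whichever direction is proved;
  integer endpoints suffice to identify it.\<close>

lemma decaying_integral:
  fixes X :: "real \<Rightarrow> 'a::complex_banach \<Rightarrow> 'b::complex_banach"
  assumes X: "sc_family X" "exp_bounded b X" and b: "b < 0"
  obtains J where "bounded_clinear J" "\<And>f. (\<lambda>n. integral {0..real n} (\<lambda>s. X s f)) \<longlonglongrightarrow> J f"
proof -
  obtain C where C: "C > 0" "\<And>t f. 0 \<le> t \<Longrightarrow> norm (X t f) \<le> C * exp (b * t) * norm f"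
    by (rule exp_boundedE[OF X(2)]) blast
  define G where "G = (\<lambda>s. C / b * exp (b * s))"
  define I where "I = (\<lambda>t f. integral {0..t} (\<lambda>s. X s f))"
  have cont: "continuous_on {t..u} (\<lambda>s. X s f)" if "0 \<le> t" for t u f
    by (rule continuous_on_subset[OF sc_familyD(2)[OF X(1)]]) (use that in auto)
  have piece: "norm (integral {t..u} (\<lambda>s. X s f)) \<le> - C / b * exp (b * t) * norm f"
    if tu: "0 \<le> t" "t \<le> u" for t u f
  proof -
    have G: "((\<lambda>s. C * exp (b * s)) has_integral (G u - G t)) {t..u}"
      using b tu unfolding G_def
      by (intro fundamental_theorem_of_calculus)
        (auto intro!: derivative_eq_intros simp: has_real_derivative_iff_has_vector_derivative[symmetric])
    have "norm (integral {t..u} (\<lambda>s. X s f)) \<le> integral {t..u} (\<lambda>s. C * exp (b * s) * norm f)"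
      by (rule integral_norm_bound_integral[OF integrable_continuous_real[OF cont[OF tu(1)]]
            has_integral_integrable[OF has_integral_mult_left[OF G]]])
        (use C tu in auto)
    also have "\<dots> = (G u - G t) * norm f" by (rule integral_unique[OF has_integral_mult_left[OF G]])
    also have "\<dots> \<le> - G t * norm f"
      using C(1) b by (intro mult_right_mono) (auto simp: G_def divide_le_0_iff mult_le_0_iff)
    finally show ?thesis by (simp add: G_def)
  qed
  have diff: "norm (I u f - I t f) \<le> - C / b * exp (b * t) * norm f" if tu: "0 \<le> t" "t \<le> u" for t u f
  proof -
    have "I u f - I t f = integral {t..u} (\<lambda>s. X s f)"
      using Henstock_Kurzweil_Integration.integral_combine[OF tu integrable_continuous_real[OF cont[OF order_refl, where f = f]]]
      by (simp add: I_def algebra_simps)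
    then show ?thesis using piece[OF tu] by simp
  qed
  have lin: "bounded_clinear (I t)" if t: "0 \<le> t" for t
  proof -
    have id: "sc_family (\<lambda>(t::real) f::'a. f)"
    proof -
      have "exp_bounded 0 (\<lambda>(t::real) f::'a. f)" unfolding exp_bounded_def by (intro exI[of _ 1]) simp
      then show ?thesis by (auto simp: sc_family_def bounded_clinear_ident)
    qed
    have "I t = op_conv X (\<lambda>t f. f) t" by (simp add: fun_eq_iff I_def op_conv_def)
    then show ?thesis using sc_familyD(1)[OF sc_family_op_conv[OF X(1) id] t] by simp
  qed
  have "convergent (\<lambda>n. I (real n) f)" for f
  proof (rule Cauchy_convergent)
    have "(\<lambda>n. - C / b * exp (b * real n) * norm f) \<longlonglongrightarrow> 0"
    proof -
      have "(\<lambda>n. exp b ^ n) \<longlonglongrightarrow> 0" by (rule LIMSEQ_realpow_zero) (use b in auto)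
      then have "(\<lambda>n. - C / b * exp b ^ n * norm f) \<longlonglongrightarrow> - C / b * 0 * norm f"
        by (intro tendsto_mult tendsto_const)
      then show ?thesis by (simp add: exp_of_nat_mult[symmetric] mult.commute)
    qed
    note small = this
    show "Cauchy (\<lambda>n. I (real n) f)"
      unfolding Cauchy_altdef
    proof (intro allI impI)
      fix e :: real assume "0 < e"
      from order_tendstoD(2)[OF small this]
      obtain M where M: "\<And>n. n \<ge> M \<Longrightarrow> - C / b * exp (b * real n) * norm f < e"
        unfolding eventually_sequentially by blast
      show "\<exists>M. \<forall>m\<ge>M. \<forall>n>m. dist (I (real m) f) (I (real n) f) < e"
      proof (intro exI[of _ M] allI impI)
        fix m n assume "M \<le> m" "m < n"
        then show "dist (I (real m) f) (I (real n) f) < e"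
          using diff[of "real m" "real n" f] M[of m] by (simp add: dist_norm norm_minus_commute)
      qed
    qed
  qed
  then have "\<forall>f. \<exists>l. (\<lambda>n. I (real n) f) \<longlonglongrightarrow> l" by (simp add: convergent_def)
  from choice[OF this] obtain J where J': "\<forall>f. (\<lambda>n. I (real n) f) \<longlonglongrightarrow> J f" ..
  note J = J'[rule_format]
  have "bounded_clinear J"
  proof (rule bounded_clinearI)
    fix f g c
    have "(\<lambda>n. I (real n) (f + g)) \<longlonglongrightarrow> J f + J g"
      using tendsto_add[OF J J] by (simp add: bounded_clinear_add[OF lin])
    then show "J (f + g) = J f + J g" by (rule LIMSEQ_unique[OF J])
    have "(\<lambda>n. I (real n) (c *\<^sub>C f)) \<longlonglongrightarrow> c *\<^sub>C J f"
      using bounded_clinear_tendsto[OF bounded_clinear_scaleC_map J] by (simp add: bounded_clinear_scaleC[OF lin])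
    then show "J (c *\<^sub>C f) = c *\<^sub>C J f" by (rule LIMSEQ_unique[OF J])
    show "norm (J f) \<le> (- C / b) * norm f"
    proof (rule LIMSEQ_le_const2[OF tendsto_norm[OF J]], intro exI allI impI)
      show "norm (I (real n) f) \<le> - C / b * norm f" for n
        using diff[of 0 "real n" f] by (simp add: I_def)
    qed
  qed
  then show ?thesis using that J by (simp add: I_def)
qed

lemma exp_bounded_tendsto_0:
  assumes "exp_bounded b X" "b < 0"
  shows "(\<lambda>n. X (real n) f) \<longlonglongrightarrow> 0"
proof -
  obtain C where C: "C > 0" "\<And>t f. 0 \<le> t \<Longrightarrow> norm (X t f) \<le> C * exp (b * t) * norm f"
    by (rule exp_boundedE[OF assms(1)]) blast
  have "(\<lambda>n. exp b ^ n) \<longlonglongrightarrow> 0" by (rule LIMSEQ_realpow_zero) (use assms(2) in auto)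
  then have "(\<lambda>n. C * exp b ^ n * norm f) \<longlonglongrightarrow> C * 0 * norm f"
    by (intro tendsto_mult tendsto_const)
  then have lim: "(\<lambda>n. C * exp (b * real n) * norm f) \<longlonglongrightarrow> 0"
    by (simp add: exp_of_nat_mult[symmetric] mult.commute)
  show ?thesis by (rule Lim_null_comparison[OF _ lim]) (simp add: C(2))
qed

text \<open>For each \<open>t\<close>, \<open>\<pi> f = R t (S t f) = R t (Y t f) + \<integral>\<^sub>0\<^sup>t R s (T s (i f)) ds\<close>, since \<open>R t\<close> undoes
  \<open>S (t - s)\<close> up to \<open>R s\<close>; let \<open>t\<close> tend to infinity.\<close>

lemma projector_extends:
  fixes i :: "'a::complex_banach \<Rightarrow> 'b::complex_banach" and S :: "real \<Rightarrow> 'a \<Rightarrow> 'a"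
  assumes S: "c0_semigroup S" and \<pi>: "spectral_projector S \<xi> \<pi>" and \<xi>: "a < Re \<xi>"
    and i: "bounded_clinear i" and T: "sc_family T" "exp_bounded a T" and Y: "decays_beyond a Y"
    and eq: "\<And>t f. 0 \<le> t \<Longrightarrow> S t f = Y t f + op_conv S (\<lambda>t f. T t (i f)) t f"
  shows "\<exists>Q. bounded_clinear Q \<and> (\<forall>f. Q (i f) = \<pi> f)"
proof -
  obtain b where b: "a < b" "b < Re \<xi>" using dense[OF \<xi>] by blast
  obtain c where c: "a < c" "c < b" using dense[OF b(1)] by blast
  obtain R where R: "sc_family R" "exp_bounded (- b) R" "\<And>f. R 0 f = \<pi> f"
    "\<And>s t f. 0 \<le> s \<Longrightarrow> s \<le> t \<Longrightarrow> S s (R t f) = R (t - s) f"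
    "\<And>s t f. 0 \<le> s \<Longrightarrow> s \<le> t \<Longrightarrow> R t (S s f) = R (t - s) f"
    by (rule backward_family[OF S \<pi> b(2)]) (rule that)
  have "exp_bounded (- b + a) (\<lambda>t g. R t (T t g))" by (rule exp_bounded_product[OF R(2) T(2)])
  then obtain J where J: "bounded_clinear J" "\<And>g. (\<lambda>n. integral {0..real n} (\<lambda>s. R s (T s g))) \<longlonglongrightarrow> J g"
    by (rule decaying_integral[OF sc_family_product[OF R(1) T(1)]]) (use b(1) in simp, rule that)
  have "J (i f) = \<pi> f" for f
  proof -
    have "\<pi> f = R (real n) (Y (real n) f) + integral {0..real n} (\<lambda>s. R s (T s (i f)))" for n
    proof -
      let ?t = "real n"
      note linR = sc_familyD(1)[OF R(1) of_nat_0_le_iff[of n]]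
      note Ti = sc_family_precompose[OF T(1) i]
      have "\<pi> f = R ?t (S ?t f)" using R(3) R(5)[of ?t ?t f] by simp
      also have "\<dots> = R ?t (Y ?t f) + R ?t (op_conv S (\<lambda>t f. T t (i f)) ?t f)"
        by (subst eq) (simp_all add: bounded_clinear_add[OF linR])
      also have "op_conv S (\<lambda>t f. T t (i f)) ?t f = integral {0..?t} (\<lambda>s. S (?t - s) (T s (i f)))"
        by (rule op_conv_reflect)
      also have "R ?t \<dots> = integral {0..?t} (\<lambda>s. R ?t (S (?t - s) (T s (i f))))"
      proof (rule integral_bounded_clinear[OF linR integrable_continuous_real])
        show "continuous_on {0..?t} (\<lambda>s. S (?t - s) (T s (i f)))"
          by (rule sc_family_continuous_on[OF c0_semigroup_sc_family[OF S] _ _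
                continuous_on_subset[OF sc_familyD(2)[OF Ti]]])
            (auto intro!: continuous_on_diff continuous_on_const continuous_on_id)
      qed
      also have "\<dots> = integral {0..?t} (\<lambda>s. R s (T s (i f)))"
        by (rule integral_cong) (use R(5)[of "?t - _" ?t] in auto)
      finally show ?thesis .
    qed
    moreover have "(\<lambda>n. R (real n) (Y (real n) f)) \<longlonglongrightarrow> 0"
      by (rule exp_bounded_tendsto_0[OF exp_bounded_product[OF R(2), of c Y]])
        (use Y c in \<open>auto simp: decays_beyond_def\<close>)
    from tendsto_add[OF this J(2)[of "i f"]]
    have "(\<lambda>n. R (real n) (Y (real n) f) + integral {0..real n} (\<lambda>s. R s (T s (i f)))) \<longlonglongrightarrow> J (i f)" by simp
    ultimately have "(\<lambda>n::nat. \<pi> f) \<longlonglongrightarrow> J (i f)" by simp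
    then show ?thesis by (simp add: LIMSEQ_const_iff)
  qed
  then show ?thesis using J(1) by blast
qed

text \<open>The mirror image of the previous argument, with \<open>R\<close> on the right:
  \<open>\<pi> g = S t (R t g) = Y t (R t g) + i (\<integral>\<^sub>0\<^sup>t T s (R s g) ds)\<close>.\<close>

lemma projector_regularises:
  fixes i :: "'a::complex_banach \<Rightarrow> 'b::complex_banach" and S :: "real \<Rightarrow> 'b \<Rightarrow> 'b"
  assumes S: "c0_semigroup S" and \<pi>: "spectral_projector S \<xi> \<pi>" and \<xi>: "a < Re \<xi>"
    and i: "bounded_clinear i" and T: "sc_family T" "exp_bounded a T" and Y: "decays_beyond a Y"
    and eq: "\<And>t g. 0 \<le> t \<Longrightarrow> S t g = Y t g + op_conv (\<lambda>t g. i (T t g)) S t g"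
  shows "\<exists>Q. bounded_clinear Q \<and> (\<forall>g. i (Q g) = \<pi> g)"
proof -
  obtain b where b: "a < b" "b < Re \<xi>" using dense[OF \<xi>] by blast
  obtain c where c: "a < c" "c < b" using dense[OF b(1)] by blast
  obtain R where R: "sc_family R" "exp_bounded (- b) R" "\<And>f. R 0 f = \<pi> f"
    "\<And>s t f. 0 \<le> s \<Longrightarrow> s \<le> t \<Longrightarrow> S s (R t f) = R (t - s) f"
    "\<And>s t f. 0 \<le> s \<Longrightarrow> s \<le> t \<Longrightarrow> R t (S s f) = R (t - s) f"
    by (rule backward_family[OF S \<pi> b(2)]) (rule that)
  have "exp_bounded (a + - b) (\<lambda>t g. T t (R t g))" by (rule exp_bounded_product[OF T(2) R(2)])
  then obtain J where J: "bounded_clinear J" "\<And>g. (\<lambda>n. integral {0..real n} (\<lambda>s. T s (R s g))) \<longlonglongrightarrow> J g"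
    by (rule decaying_integral[OF sc_family_product[OF T(1) R(1)]]) (use b(1) in simp, rule that)
  have "i (J g) = \<pi> g" for g
  proof -
    have "\<pi> g = Y (real n) (R (real n) g) + i (integral {0..real n} (\<lambda>s. T s (R s g)))" for n
    proof -
      let ?t = "real n"
      have "\<pi> g = S ?t (R ?t g)" using R(3) R(4)[of ?t ?t g] by simp
      also have "\<dots> = Y ?t (R ?t g) + op_conv (\<lambda>t g. i (T t g)) S ?t (R ?t g)" by (rule eq) simp
      also have "op_conv (\<lambda>t g. i (T t g)) S ?t (R ?t g) = integral {0..?t} (\<lambda>s. i (T s (R s g)))"
        unfolding op_conv_def by (rule integral_cong) (use R(4)[of "?t - _" ?t] in auto)
      also have "\<dots> = i (integral {0..?t} (\<lambda>s. T s (R s g)))"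
        by (rule integral_bounded_clinear[OF i integrable_continuous_real
              [OF continuous_on_subset[OF sc_familyD(2)[OF sc_family_product[OF T(1) R(1)]]]], symmetric]) auto
      finally show ?thesis .
    qed
    moreover have "(\<lambda>n. Y (real n) (R (real n) g)) \<longlonglongrightarrow> 0"
      by (rule exp_bounded_tendsto_0[OF exp_bounded_product[OF _ R(2), of c Y]])
        (use Y c in \<open>auto simp: decays_beyond_def\<close>)
    from tendsto_add[OF this bounded_clinear_tendsto[OF i J(2)[of g]]]
    have "(\<lambda>n. Y (real n) (R (real n) g) + i (integral {0..real n} (\<lambda>s. T s (R s g)))) \<longlonglongrightarrow> i (J g)" by simp
    ultimately have "(\<lambda>n::nat. \<pi> g) \<longlonglongrightarrow> i (J g)" by simp
    then show ?thesis by (simp add: LIMSEQ_const_iff)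
  qed
  then show ?thesis using J(1) by blast
qed

section \<open>Transfer of projectors between the two spaces\<close>

lemma commutes_with_of_intertwining:
  assumes i: "bounded_clinear i" and q: "bounded_clinear q"
    and int: "\<And>t f. 0 \<le> t \<Longrightarrow> i (S t f) = S' t (i f)" "\<And>t g. 0 \<le> t \<Longrightarrow> q (S' t g) = S t (q g)"
  shows "commutes_with (\<lambda>g. i (q g)) (generator S')"
proof -
  have "i (q (S' t g)) = S' t (i (q g))" if "0 \<le> t" for t g by (simp add: int that)
  from generator_intertwine[where T = "\<lambda>g. i (q g)" and S = S' and S' = S', OF bounded_clinear_compose[OF i q] this]
  show ?thesis unfolding commutes_with_def by blast
qed

lemma finite_rank_projector_swap:
  assumes i: "bounded_clinear i" and q: "bounded_clinear q" and iq: "\<And>g. i (q (i (q g))) = i (q g)"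
    and \<pi>: "finite_rank_projector (\<lambda>f. q (i f))"
  shows "finite_rank_projector (\<lambda>g. i (q g))"
proof -
  obtain F where F: "finite F" "range (\<lambda>f. q (i f)) \<subseteq> cvec.span F"
    using \<pi> unfolding finite_rank_projector_def by blast
  have img: "i x \<in> cvec.span (i ` F)" if "x \<in> cvec.span F" for x
    using that
  proof (rule cvec.span_induct_alt)
    show "i 0 \<in> cvec.span (i ` F)" by (simp add: bounded_clinear_zero[OF i] cvec.span_zero)
    show "i (c *\<^sub>C x + y) \<in> cvec.span (i ` F)" if "x \<in> F" "i y \<in> cvec.span (i ` F)" for c x y
      unfolding bounded_clinear_add[OF i] bounded_clinear_scaleC[OF i]
      by (rule cvec.span_add[OF cvec.span_scale[OF cvec.span_base[OF imageI[OF that(1)]]] that(2)])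
  qed
  have "range (\<lambda>g. i (q g)) \<subseteq> cvec.span (i ` F)"
  proof
    fix y assume "y \<in> range (\<lambda>g. i (q g))"
    then obtain g where "y = i (q (i (q g)))" using iq by auto
    then show "y \<in> cvec.span (i ` F)" using img F(2) by blast
  qed
  then show ?thesis
    unfolding finite_rank_projector_def
    using F(1) iq bounded_clinear_compose[OF i q] by (auto simp: fun_eq_iff intro!: exI[of _ "i ` F"])
qed

text \<open>\<open>i\<close> and \<open>q\<close> are mutually inverse between the two ranges and conjugate the two operators there. The
  hypotheses are symmetric in \<open>i\<close> and \<open>q\<close>, so the reverse inclusion is an instance.\<close>

lemma resolvent_set_transfer:
  fixes i :: "'a::complex_banach \<Rightarrow> 'b::complex_banach"
  assumes i: "bounded_clinear i" and q: "bounded_clinear q"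
    and qi: "\<And>f. q (i (q (i f))) = q (i f)" and iq: "\<And>g. i (q (i (q g))) = i (q g)"
    and gen_i: "\<And>f. f \<in> dom P \<Longrightarrow> i f \<in> dom P' \<and> the (P' (i f)) = i (the (P f))"
    and gen_q: "\<And>g. g \<in> dom P' \<Longrightarrow> q g \<in> dom P \<and> the (P (q g)) = q (the (P' g))"
  shows "resolvent_set_on (range (\<lambda>f. q (i f))) (P |` range (\<lambda>f. q (i f)))
    \<subseteq> resolvent_set_on (range (\<lambda>g. i (q g))) (P' |` range (\<lambda>g. i (q g)))"
proof
  fix z
  define V where "V = range (\<lambda>f. q (i f))"
  define V' where "V' = range (\<lambda>g. i (q g))"
  define T where "T = (\<lambda>f. z *\<^sub>C f - the (P f))"
  define T' where "T' = (\<lambda>g. z *\<^sub>C g - the (P' g))"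
  have V: "v \<in> V \<longleftrightarrow> q (i v) = v" for v using qi unfolding V_def by (metis rangeE rangeI)
  have V': "v \<in> V' \<longleftrightarrow> i (q v) = v" for v using iq unfolding V'_def by (metis rangeE rangeI)
  have iV: "i v \<in> V'" if "v \<in> V" for v using that by (simp add: V V')
  have qV: "q v \<in> V" if "v \<in> V'" for v using that by (simp add: V V')
  let ?D = "dom (P |` V)" and ?D' = "dom (P' |` V')"
  have D: "?D = dom P \<inter> V" "?D' = dom P' \<inter> V'" by auto
  have iT: "i (T f) = T' (i f)" if "f \<in> dom P" for f
    using gen_i[OF that] by (simp add: T_def T'_def bounded_clinear_diff[OF i] bounded_clinear_scaleC[OF i])
  have qT: "q (T' g) = T (q g)" if "g \<in> dom P'" for g
    using gen_q[OF that] by (simp add: T_def T'_def bounded_clinear_diff[OF q] bounded_clinear_scaleC[OF q])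
  assume "z \<in> resolvent_set_on V (P |` V)"
  then have bij: "bij_betw (\<lambda>f. z *\<^sub>C f - the ((P |` V) f)) ?D V"
    and "\<exists>M. \<forall>f\<in>?D. norm f \<le> M * norm (z *\<^sub>C f - the ((P |` V) f))"
    by (auto simp: resolvent_set_on_def)
  then obtain M where M: "\<And>f. f \<in> ?D \<Longrightarrow> norm f \<le> M * norm (T f)" by (auto simp: T_def)
  have bijT: "bij_betw T ?D V"
    using bij by (rule iffD1[OF bij_betw_cong, rotated]) (auto simp: T_def)
  have "bij_betw q ?D' ?D"
    unfolding D
  proof (rule bij_betw_byWitness[where f' = i])
    show "\<forall>g\<in>dom P' \<inter> V'. i (q g) = g" "\<forall>f\<in>dom P \<inter> V. q (i f) = f" using V V' by auto
    show "q ` (dom P' \<inter> V') \<subseteq> dom P \<inter> V" using gen_q qV by blast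
    show "i ` (dom P \<inter> V) \<subseteq> dom P' \<inter> V'" using gen_i iV by blast
  qed
  from bij_betw_trans[OF bij_betw_trans[OF this bijT]]
  have "bij_betw (i \<circ> (T \<circ> q)) ?D' V'"
    using bij_betw_byWitness[of V q i V'] V V' iV qV by (simp add: image_subset_iff)
  moreover have T'_eq: "(i \<circ> (T \<circ> q)) g = z *\<^sub>C g - the ((P' |` V') g)" if "g \<in> ?D'" for g
    using that iT[of "q g"] gen_q[of g] V'[of g] unfolding D by (auto simp: T'_def)
  ultimately have "bij_betw (\<lambda>g. z *\<^sub>C g - the ((P' |` V') g)) ?D' V'"
    by (rule iffD1[OF bij_betw_cong, rotated])
  moreover have "\<exists>M. \<forall>g\<in>?D'. norm g \<le> M * norm (z *\<^sub>C g - the ((P' |` V') g))"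
  proof -
    obtain Ki where Ki: "Ki > 0" "\<And>x. norm (i x) \<le> Ki * norm x" using bounded_clinear_bound[OF i] by blast
    obtain Kq where Kq: "Kq > 0" "\<And>x. norm (q x) \<le> Kq * norm x" using bounded_clinear_bound[OF q] by blast
    have "norm g \<le> (Ki * \<bar>M\<bar> * Kq) * norm (z *\<^sub>C g - the ((P' |` V') g))" if g: "g \<in> ?D'" for g
    proof -
      have gP: "g \<in> dom P'" and gV: "i (q g) = g" using g V' unfolding D by auto
      have "q g \<in> ?D" using g gen_q qV unfolding D by auto
      then have "norm (q g) \<le> M * norm (T (q g))" by (rule M)
      also have "\<dots> \<le> \<bar>M\<bar> * norm (T (q g))" by (intro mult_right_mono) auto
      also have "T (q g) = q (T' g)" by (rule qT[OF gP, symmetric])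
      also have "\<bar>M\<bar> * norm (q (T' g)) \<le> \<bar>M\<bar> * (Kq * norm (T' g))" by (intro mult_left_mono Kq) auto
      finally have "Ki * norm (q g) \<le> Ki * (\<bar>M\<bar> * (Kq * norm (T' g)))"
        using Ki(1) by (intro mult_left_mono) auto
      then have "norm g \<le> Ki * (\<bar>M\<bar> * (Kq * norm (T' g)))" using Ki(2)[of "q g"] gV by simp
      moreover have "T' g = z *\<^sub>C g - the ((P' |` V') g)" using g unfolding D by (simp add: T'_def)
      ultimately show ?thesis by (simp add: mult.assoc)
    qed
    then show ?thesis by blast
  qed
  ultimately show "z \<in> resolvent_set_on V' (P' |` V')" by (simp add: resolvent_set_on_def)
qed

lemma spectral_projector_transfer:
  fixes i :: "'a::complex_banach \<Rightarrow> 'b::complex_banach"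
  assumes i: "bounded_clinear i" and q: "bounded_clinear q"
    and qi: "\<And>f. q (i (q (i f))) = q (i f)" and iq: "\<And>g. i (q (i (q g))) = i (q g)"
    and int: "\<And>t f. 0 \<le> t \<Longrightarrow> i (S t f) = S' t (i f)" "\<And>t g. 0 \<le> t \<Longrightarrow> q (S' t g) = S t (q g)"
    and \<pi>: "spectral_projector S \<xi> (\<lambda>f. q (i f))"
  shows "spectral_projector S' \<xi> (\<lambda>g. i (q g))"
  unfolding spectral_projector_def
proof (intro conjI)
  show "finite_rank_projector (\<lambda>g. i (q g))"
    by (rule finite_rank_projector_swap[OF i q iq spectral_projectorD(1)[OF \<pi>]])
  show "commutes_with (\<lambda>g. i (q g)) (generator S')"
    by (rule commutes_with_of_intertwining[where S = S and S' = S', OF i q int])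
  have gen_i: "i f \<in> dom (generator S') \<and> the (generator S' (i f)) = i (the (generator S f))"
    if "f \<in> dom (generator S)" for f by (rule generator_intertwine[where S = S and S' = S', OF i int(1) that])
  have gen_q: "q g \<in> dom (generator S) \<and> the (generator S (q g)) = q (the (generator S' g))"
    if "g \<in> dom (generator S')" for g by (rule generator_intertwine[where S = S' and S' = S, OF q int(2) that])
  have "resolvent_set_on (range (\<lambda>f. q (i f))) (generator S |` range (\<lambda>f. q (i f)))
      = resolvent_set_on (range (\<lambda>g. i (q g))) (generator S' |` range (\<lambda>g. i (q g)))"
  proof
    show "resolvent_set_on (range (\<lambda>f. q (i f))) (generator S |` range (\<lambda>f. q (i f)))
        \<subseteq> resolvent_set_on (range (\<lambda>g. i (q g))) (generator S' |` range (\<lambda>g. i (q g)))"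
      by (rule resolvent_set_transfer[OF i q qi iq gen_i gen_q])
    show "resolvent_set_on (range (\<lambda>g. i (q g))) (generator S' |` range (\<lambda>g. i (q g)))
        \<subseteq> resolvent_set_on (range (\<lambda>f. q (i f))) (generator S |` range (\<lambda>f. q (i f)))"
      by (rule resolvent_set_transfer[OF q i iq qi gen_q gen_i])
  qed
  then show "spectrum_on (range (\<lambda>g. i (q g))) (generator S' |` range (\<lambda>g. i (q g))) = {\<xi>}"
    using spectral_projectorD(3)[OF \<pi>] by (simp add: spectrum_on_def)
qed

section \<open>Asymptotics in the two spaces\<close>

text \<open>The asymptotics as a property of the semigroup, with pointwise bounds in place of operator norms.\<close>

definition semigroup_asymptotics :: "real \<Rightarrow> (real \<Rightarrow> 'a::complex_banach \<Rightarrow> 'a) \<Rightarrow> bool"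
  where "semigroup_asymptotics a S \<longleftrightarrow>
    (\<exists>(k::nat) (\<xi> :: nat \<Rightarrow> complex) (\<pi> :: nat \<Rightarrow> 'a \<Rightarrow> 'a).
      inj_on \<xi> {1..k} \<and> (\<forall>j\<in>{1..k}. Re (\<xi> j) > a \<and> spectral_projector S (\<xi> j) (\<pi> j)) \<and>
      decays_beyond a (\<lambda>t f. S t f - (\<Sum>j=1..k. S t (\<pi> j f))))"

lemma decays_beyond_onorm:
  assumes lin: "\<And>t. 0 \<le> t \<Longrightarrow> bounded_clinear (X t)"
  shows "decays_beyond a X \<longleftrightarrow> (\<forall>a'>a. \<exists>C>0. \<forall>t\<ge>0. onorm (X t) \<le> C * exp (a' * t))"
proof -
  have "exp_bounded b X \<longleftrightarrow> (\<exists>C>0. \<forall>t\<ge>0. onorm (X t) \<le> C * exp (b * t))" for b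
  proof
    assume "exp_bounded b X"
    then obtain C where C: "C > 0" "\<And>t f. 0 \<le> t \<Longrightarrow> norm (X t f) \<le> C * exp (b * t) * norm f"
      by (rule exp_boundedE) blast
    then show "\<exists>C>0. \<forall>t\<ge>0. onorm (X t) \<le> C * exp (b * t)"
      by (intro exI[of _ C]) (auto intro!: onorm_bound)
  next
    assume "\<exists>C>0. \<forall>t\<ge>0. onorm (X t) \<le> C * exp (b * t)"
    then show "exp_bounded b X" unfolding exp_bounded_def
      using bounded_clinear_onormI[OF lin] by blast
  qed
  then show ?thesis by (simp add: decays_beyond_def)
qed

lemma finite_rank_asymptotics_iff:
  assumes S: "c0_semigroup S" and gen: "generator S = P" and sg: "semigroup_of P = S"
  shows "finite_rank_asymptotics a P \<longleftrightarrow> semigroup_asymptotics a S"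
proof -
  have "(\<forall>a'>a. \<exists>C>0. \<forall>t\<ge>0. onorm (\<lambda>f. S t f - (\<Sum>j=1..k. S t (\<pi> j f))) \<le> C * exp (a' * t))
      \<longleftrightarrow> decays_beyond a (\<lambda>t f. S t f - (\<Sum>j=1..k. S t (\<pi> j f)))"
    if "\<forall>j\<in>{1..k}. finite_rank_projector (\<pi> j)" for k :: nat and \<pi>
    by (rule decays_beyond_onorm[symmetric],
        rule bounded_clinear_diff_map[OF c0_semigroupD(1)[OF S] bounded_clinear_sum_map],
        assumption,
        rule bounded_clinear_compose[OF c0_semigroupD(1)[OF S]], assumption)
      (use that in \<open>auto simp: finite_rank_projector_def\<close>)
  then show ?thesis
    unfolding finite_rank_asymptotics_def semigroup_asymptotics_def spectral_projector_def sg gen by (intro ex_cong1) blast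
qed

lemma decays_beyond_compose: "bounded_clinear T \<Longrightarrow> decays_beyond a X \<Longrightarrow> decays_beyond a (\<lambda>t f. T (X t f))"
  by (simp add: decays_beyond_def exp_bounded_compose)

lemma decays_beyond_precompose: "decays_beyond a X \<Longrightarrow> bounded_clinear T \<Longrightarrow> decays_beyond a (\<lambda>t f. X t (T f))"
  by (simp add: decays_beyond_def exp_bounded_precompose)

lemma decays_beyond_cong:
  assumes "decays_beyond a X" "\<And>t f. 0 \<le> t \<Longrightarrow> X t f = X' t f"
  shows "decays_beyond a X'"
  using assms by (simp add: decays_beyond_def exp_bounded_def)

lemma sc_family_cong:
  assumes X: "sc_family X" and eq: "\<And>t f. 0 \<le> t \<Longrightarrow> X t f = X' t f"
  shows "sc_family X'"
proof -
  have "bounded_clinear (X' t)" if "0 \<le> t" for t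
  proof -
    have "X t = X' t" using eq[OF that] by (simp add: fun_eq_iff)
    then show ?thesis using sc_familyD(1)[OF X that] by simp
  qed
  moreover have "continuous_on {0..} (\<lambda>t. X' t f)" for f
    by (rule continuous_on_eq[OF sc_familyD(2)[OF X]]) (simp add: eq)
  moreover have "\<exists>b. exp_bounded b X'" using X eq by (simp add: sc_family_def exp_bounded_def)
  ultimately show ?thesis by (simp add: sc_family_def)
qed

text \<open>Put \<open>p = 1 - \<Sum> \<pi>'\<close>, where \<open>\<pi>' = i Q\<close> extends \<open>\<pi>\<close>. Apply \<open>p\<close> from the left: since \<open>T\<close> takes values in
  the small space, \<open>p S' i\<close> is the complementary semigroup of \<open>S\<close>, which decays by hypothesis.\<close>

lemma enlargement:
  fixes i :: "'a::complex_banach \<Rightarrow> 'b::complex_banach"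
  assumes S: "c0_semigroup S" and S': "c0_semigroup S'" and i: "bounded_clinear i" and dense: "closure (range i) = UNIV"
    and int: "\<And>t f. 0 \<le> t \<Longrightarrow> i (S t f) = S' t (i f)"
    and T: "sc_family T" "exp_bounded a T" and Y: "decays_beyond a Y" "decays_beyond a Y'"
    and eq: "\<And>t f. 0 \<le> t \<Longrightarrow> S t f = Y t f + op_conv S (\<lambda>t f. T t (i f)) t f"
    and eq': "\<And>t g. 0 \<le> t \<Longrightarrow> S' t g = Y' t g + op_conv S' (\<lambda>t g. i (T t g)) t g"
    and asym: "semigroup_asymptotics a S"
  shows "semigroup_asymptotics a S'"
proof -
  obtain k :: nat and \<xi> \<pi> where inj: "inj_on \<xi> {1..k}"
    and \<pi>: "\<And>j. j \<in> {1..k} \<Longrightarrow> a < Re (\<xi> j)" "\<And>j. j \<in> {1..k} \<Longrightarrow> spectral_projector S (\<xi> j) (\<pi> j)"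
    and dec: "decays_beyond a (\<lambda>t f. S t f - (\<Sum>j=1..k. S t (\<pi> j f)))"
    using asym unfolding semigroup_asymptotics_def by blast
  note idem = spectral_projectorD(5)[OF \<pi>(2)]
  have "\<forall>j\<in>{1..k}. \<exists>Q. bounded_clinear Q \<and> (\<forall>f. Q (i f) = \<pi> j f)"
    using projector_extends[OF S \<pi>(2,1) i T Y(1) eq] by blast
  from bchoice[OF this] obtain Q
    where Q: "\<And>j. j \<in> {1..k} \<Longrightarrow> bounded_clinear (Q j)" "\<And>j f. j \<in> {1..k} \<Longrightarrow> Q j (i f) = \<pi> j f" by blast
  have QiQ: "Q j (i (Q j g)) = Q j g" if j: "j \<in> {1..k}" for j g
    by (rule bounded_clinear_eq_on_dense[OF bounded_clinear_compose[OF Q(1)[OF j]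
            bounded_clinear_compose[OF i Q(1)[OF j]]] Q(1)[OF j] dense])
      (auto simp: Q(2)[OF j] idem[OF j])
  have QS: "Q j (S' t g) = S t (Q j g)" if j: "j \<in> {1..k}" and t: "0 \<le> t" for j t g
  proof (rule bounded_clinear_eq_on_dense[OF _ _ dense])
    show "bounded_clinear (\<lambda>g. Q j (S' t g))"
      by (rule bounded_clinear_compose[OF Q(1)[OF j] c0_semigroupD(1)[OF S' t]])
    show "bounded_clinear (\<lambda>g. S t (Q j g))"
      by (rule bounded_clinear_compose[OF c0_semigroupD(1)[OF S t] Q(1)[OF j]])
    fix g assume "g \<in> range i"
    then obtain f where g: "g = i f" by blast
    show "Q j (S' t g) = S t (Q j g)"
      unfolding g int[OF t, symmetric] Q(2)[OF j] by (rule spectral_projectorD(6)[OF \<pi>(2)[OF j] S t])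
  qed
  define \<pi>' where "\<pi>' = (\<lambda>j g. i (Q j g))"
  have \<pi>_eq: "\<pi> j = (\<lambda>f. Q j (i f))" if "j \<in> {1..k}" for j using Q(2)[OF that] by auto
  have transfer: "spectral_projector S' (\<xi> j) (\<pi>' j)" if j: "j \<in> {1..k}" for j
    unfolding \<pi>'_def
    by (rule spectral_projector_transfer[OF i Q(1)[OF j] _ _ int QS[OF j] \<pi>(2)[OF j, unfolded \<pi>_eq[OF j]]])
      (simp_all add: QiQ[OF j])
  define p where "p = (\<lambda>g. g - (\<Sum>j=1..k. \<pi>' j g))"
  have p: "bounded_clinear p"
    unfolding p_def \<pi>'_def
    by (rule bounded_clinear_diff_map[OF bounded_clinear_ident bounded_clinear_sum_map])
      (rule bounded_clinear_compose[OF i Q(1)])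
  note scS' = c0_semigroup_sc_family[OF S'] and scS = c0_semigroup_sc_family[OF S]
  define Z where "Z = (\<lambda>t f. i (S t f - (\<Sum>j=1..k. S t (\<pi> j f))))"
  have Z: "decays_beyond a Z" unfolding Z_def by (rule decays_beyond_compose[OF i dec])
  have Z_eq: "Z t f = p (S' t (i f))" if t: "0 \<le> t" for t f
  proof -
    have "S t (\<pi> j f) = Q j (i (S t f))" if "j \<in> {1..k}" for j
      using QS[OF that t, of "i f"] by (simp add: int[OF t] Q(2)[OF that])
    then have "(\<Sum>j=1..k. i (S t (\<pi> j f))) = (\<Sum>j=1..k. \<pi>' j (i (S t f)))"
      by (intro sum.cong) (simp_all add: \<pi>'_def)
    then show ?thesis
      by (simp add: Z_def p_def bounded_clinear_diff[OF i] bounded_clinear_sum[OF i] int[OF t, symmetric])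
  qed
  have scZ: "sc_family Z"
  proof -
    have "sc_family (\<lambda>t f. p (S' t (i f)))"
      by (rule sc_family_precompose[OF sc_family_compose[OF p scS'] i])
    then show ?thesis by (rule sc_family_cong) (simp add: Z_eq)
  qed
  have iT: "sc_family (\<lambda>t g. i (T t g))" by (rule sc_family_compose[OF i T(1)])
  have main: "p (Y' t g) + op_conv Z T t g = S' t g - (\<Sum>j=1..k. S' t (\<pi>' j g))" if t: "0 \<le> t" for t g
  proof -
    have "S' t (\<pi>' j g) = \<pi>' j (S' t g)" if "j \<in> {1..k}" for j
      by (simp add: \<pi>'_def QS[OF that t] int[OF t])
    then have "S' t g - (\<Sum>j=1..k. S' t (\<pi>' j g)) = p (S' t g)" by (simp add: p_def)
    also have "\<dots> = p (Y' t g) + p (op_conv S' (\<lambda>t g. i (T t g)) t g)"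
      by (subst eq'[OF t]) (rule bounded_clinear_add[OF p])
    also have "p (op_conv S' (\<lambda>t g. i (T t g)) t g) = op_conv (\<lambda>t g. p (S' t g)) (\<lambda>t g. i (T t g)) t g"
      by (rule op_conv_compose[OF p scS' iT])
    also have "\<dots> = op_conv Z T t g"
      unfolding op_conv_def by (rule integral_cong) (simp add: Z_eq)
    finally show ?thesis by simp
  qed
  have "decays_beyond a (\<lambda>t g. S' t g - (\<Sum>j=1..k. S' t (\<pi>' j g)))"
    by (rule decays_beyond_cong[OF decays_beyond_add[OF decays_beyond_compose[OF p Y(2)]
            decays_beyond_op_conv[OF scZ Z T(1) exp_bounded_decays[OF T(2)]]] main])
  then show ?thesis
    unfolding semigroup_asymptotics_def using inj \<pi>(1) transfer by blast
qed

text \<open>Put \<open>p = 1 - \<Sum> \<pi>'\<close>, where \<open>\<pi>' = Q i\<close> restricts \<open>\<pi>\<close>. Apply the formula to \<open>p f\<close>: the factor \<open>i S p\<close>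
  is the complementary semigroup of \<open>S'\<close>, whose decay is measured in the large space, and \<open>T\<close> brings
  the convolution back to the small one.\<close>

lemma shrinking:
  fixes i :: "'a::complex_banach \<Rightarrow> 'b::complex_banach"
  assumes S: "c0_semigroup S" and S': "c0_semigroup S'" and i: "bounded_clinear i" and inj_i: "inj i"
    and int: "\<And>t f. 0 \<le> t \<Longrightarrow> i (S t f) = S' t (i f)"
    and T: "sc_family T" "exp_bounded a T" and Y: "decays_beyond a Y" "decays_beyond a Y'"
    and eq: "\<And>t f. 0 \<le> t \<Longrightarrow> S t f = Y t f + op_conv (\<lambda>t f. T t (i f)) S t f"
    and eq': "\<And>t g. 0 \<le> t \<Longrightarrow> S' t g = Y' t g + op_conv (\<lambda>t g. i (T t g)) S' t g"
    and asym: "semigroup_asymptotics a S'"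
  shows "semigroup_asymptotics a S"
proof -
  obtain k :: nat and \<xi> \<pi> where inj: "inj_on \<xi> {1..k}"
    and \<pi>: "\<And>j. j \<in> {1..k} \<Longrightarrow> a < Re (\<xi> j)" "\<And>j. j \<in> {1..k} \<Longrightarrow> spectral_projector S' (\<xi> j) (\<pi> j)"
    and dec: "decays_beyond a (\<lambda>t f. S' t f - (\<Sum>j=1..k. S' t (\<pi> j f)))"
    using asym unfolding semigroup_asymptotics_def by blast
  note idem = spectral_projectorD(5)[OF \<pi>(2)]
  have "\<forall>j\<in>{1..k}. \<exists>Q. bounded_clinear Q \<and> (\<forall>g. i (Q g) = \<pi> j g)"
    using projector_regularises[OF S' \<pi>(2,1) i T Y(2) eq'] by blast
  from bchoice[OF this] obtain Q
    where Q: "\<And>j. j \<in> {1..k} \<Longrightarrow> bounded_clinear (Q j)" "\<And>j g. j \<in> {1..k} \<Longrightarrow> i (Q j g) = \<pi> j g" by blast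
  have QiQ: "Q j (i (Q j g)) = Q j g" if j: "j \<in> {1..k}" for j g
    by (rule injD[OF inj_i]) (simp add: Q(2)[OF j] idem[OF j])
  have QS: "Q j (S' t g) = S t (Q j g)" if j: "j \<in> {1..k}" and t: "0 \<le> t" for j t g
    by (rule injD[OF inj_i])
      (simp add: int[OF t] Q(2)[OF j] spectral_projectorD(6)[OF \<pi>(2)[OF j] S' t])
  define \<pi>' where "\<pi>' = (\<lambda>j f. Q j (i f))"
  have \<pi>_eq: "\<pi> j = (\<lambda>g. i (Q j g))" if "j \<in> {1..k}" for j using Q(2)[OF that] by auto
  have transfer: "spectral_projector S (\<xi> j) (\<pi>' j)" if j: "j \<in> {1..k}" for j
    unfolding \<pi>'_def
    by (rule spectral_projector_transfer[OF Q(1)[OF j] i _ _ QS[OF j] int \<pi>(2)[OF j, unfolded \<pi>_eq[OF j]]])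
      (simp_all add: QiQ[OF j])
  define p where "p = (\<lambda>f. f - (\<Sum>j=1..k. \<pi>' j f))"
  have p: "bounded_clinear p"
    unfolding p_def \<pi>'_def
    by (rule bounded_clinear_diff_map[OF bounded_clinear_ident bounded_clinear_sum_map])
      (rule bounded_clinear_compose[OF Q(1) i])
  note scS' = c0_semigroup_sc_family[OF S'] and scS = c0_semigroup_sc_family[OF S]
  define Z where "Z = (\<lambda>t f. S' t (i f) - (\<Sum>j=1..k. S' t (\<pi> j (i f))))"
  have Z: "decays_beyond a Z" unfolding Z_def by (rule decays_beyond_precompose[OF dec i])
  have Z_eq: "Z t f = i (S t (p f))" if t: "0 \<le> t" for t f
  proof -
    note linS' = c0_semigroupD(1)[OF S' t]
    have "i (p f) = i f - (\<Sum>j=1..k. \<pi> j (i f))"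
      by (simp add: p_def \<pi>'_def bounded_clinear_diff[OF i] bounded_clinear_sum[OF i] Q(2))
    then show ?thesis
      by (simp add: int[OF t] Z_def bounded_clinear_diff[OF linS'] bounded_clinear_sum[OF linS'])
  qed
  have scZ: "sc_family Z"
  proof -
    have "sc_family (\<lambda>t f. i (S t (p f)))"
      by (rule sc_family_precompose[OF sc_family_compose[OF i scS] p])
    then show ?thesis by (rule sc_family_cong) (simp add: Z_eq)
  qed
  have main: "Y t (p f) + op_conv T Z t f = S t f - (\<Sum>j=1..k. S t (\<pi>' j f))" if t: "0 \<le> t" for t f
  proof -
    note linS = c0_semigroupD(1)[OF S t]
    have "S t f - (\<Sum>j=1..k. S t (\<pi>' j f)) = S t (p f)"
      by (simp add: p_def bounded_clinear_diff[OF linS] bounded_clinear_sum[OF linS])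
    also have "\<dots> = Y t (p f) + op_conv (\<lambda>t f. T t (i f)) S t (p f)" by (rule eq[OF t])
    also have "op_conv (\<lambda>t f. T t (i f)) S t (p f) = op_conv T Z t f"
      unfolding op_conv_def by (rule integral_cong) (simp add: Z_eq)
    finally show ?thesis by simp
  qed
  have "decays_beyond a (\<lambda>t f. S t f - (\<Sum>j=1..k. S t (\<pi>' j f)))"
    by (rule decays_beyond_cong[OF decays_beyond_add[OF decays_beyond_precompose[OF Y(1) p]
            decays_beyond_op_conv[OF T(1) exp_bounded_decays[OF T(2)] scZ Z]] main])
  then show ?thesis
    unfolding semigroup_asymptotics_def using inj \<pi>(1) transfer by blast
qed

section \<open>The convolution powers as families into the small space\<close>

text \<open>Strong continuity of \<open>T\<close> as a family into the small space: approximate \<open>g\<close> by \<open>i (f n)\<close>; then \<open>T t g\<close>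
  is the locally uniform limit of the continuous functions \<open>K t (f n)\<close>.\<close>

lemma strongly_continuous_into:
  fixes i :: "'a::complex_banach \<Rightarrow> 'b::complex_banach"
  assumes emb: "cont_dense_embedding i" and K: "sc_family K"
    and int: "\<And>t f. 0 \<le> t \<Longrightarrow> i (K t f) = K' t (i f)"
    and into: "\<And>t. 0 \<le> t \<Longrightarrow> bounded_into i (K' t)"
    and bound: "\<And>t. 0 \<le> t \<Longrightarrow> norm_into i (K' t) \<le> C * exp (a * t)"
  obtains T where "sc_family T" "exp_bounded a T" "\<And>t g. 0 \<le> t \<Longrightarrow> i (T t g) = K' t g"
    "\<And>t f. 0 \<le> t \<Longrightarrow> T t (i f) = K t f"
proof -
  have i: "bounded_clinear i" "inj i" "closure (range i) = UNIV"
    using emb by (auto simp: cont_dense_embedding_def)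
  define T where "T = (\<lambda>t. inv i \<circ> K' t)"
  have lin: "bounded_clinear (T t)" and iT: "i (T t g) = K' t g" if "0 \<le> t" for t g
    using into[OF that] by (auto simp: bounded_into_def T_def intro!: f_inv_into_f)
  have T_bound: "norm (T t g) \<le> C * exp (a * t) * norm g" if "0 \<le> t" for t g
    by (rule bounded_clinear_onormI[OF lin[OF that]]) (use bound[OF that] in \<open>simp add: norm_into_def T_def\<close>)
  have Ti: "T t (i f) = K t f" if "0 \<le> t" for t f
    using int[OF that, of f] i(2) by (simp add: T_def inv_f_eq)
  have C: "0 \<le> C"
    using bound[of 0] onorm_pos_le[OF bounded_clinear_linear[OF lin[of 0]]] by (simp add: norm_into_def T_def)
  have cont: "continuous_on {0..} (\<lambda>t. T t g)" for g
  proof -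
    have "g \<in> closure (range i)" using i(3) by simp
    then obtain x where x: "\<And>n. x n \<in> range i" "x \<longlonglongrightarrow> g" unfolding closure_sequential by blast
    then have "\<forall>n. \<exists>f. x n = i f" by blast
    from choice[OF this] obtain f where f: "\<And>n. x n = i (f n)" by blast
    have "continuous_on {0..N} (\<lambda>t. T t g)" for N
    proof (rule uniform_limit_theorem)
      show "\<forall>\<^sub>F n in sequentially. continuous_on {0..N} (\<lambda>t. K t (f n))"
        by (intro always_eventually allI continuous_on_subset[OF sc_familyD(2)[OF K]]) auto
      show "uniform_limit {0..N} (\<lambda>n t. K t (f n)) (\<lambda>t. T t g) sequentially"
      proof (rule uniform_limitI)
        fix e :: real assume e: "0 < e"
        have "(\<lambda>n. C * exp (\<bar>a\<bar> * N) * norm (x n - g)) \<longlonglongrightarrow> C * exp (\<bar>a\<bar> * N) * norm (g - g)"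
          by (intro tendsto_intros x(2))
        then have "\<forall>\<^sub>F n in sequentially. C * exp (\<bar>a\<bar> * N) * norm (x n - g) < e"
          using e by (intro order_tendstoD(2)) auto
        then show "\<forall>\<^sub>F n in sequentially. \<forall>t\<in>{0..N}. dist (K t (f n)) (T t g) < e"
        proof eventually_elim
          case (elim n)
          show ?case
          proof
            fix t assume t: "t \<in> {0..N}"
            then have t0: "0 \<le> t" by simp
            have "K t (f n) - T t g = T t (x n - g)"
              by (simp add: bounded_clinear_diff[OF lin[OF t0]] f Ti[OF t0])
            then have "dist (K t (f n)) (T t g) \<le> C * exp (a * t) * norm (x n - g)"
              using T_bound[OF t0, of "x n - g"] by (simp add: dist_norm)
            also have "a * t \<le> \<bar>a\<bar> * N" using t by (intro mult_mono) auto
            then have "C * exp (a * t) * norm (x n - g) \<le> C * exp (\<bar>a\<bar> * N) * norm (x n - g)"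
              using C by (intro mult_right_mono mult_left_mono) auto
            finally show "dist (K t (f n)) (T t g) < e" using elim by linarith
          qed
        qed
      qed
    qed simp
    then show ?thesis by (rule continuous_on_atLeast_0I)
  qed
  have eb: "exp_bounded a T" unfolding exp_bounded_def using T_bound by blast
  then have "sc_family T" using lin cont by (auto simp: sc_family_def)
  then show ?thesis using that eb iT Ti by blast
qed

lemma conv_power_intertwine:
  fixes i :: "'a::complex_banach \<Rightarrow> 'b::complex_banach"
  assumes i: "bounded_clinear i" and K: "sc_family K" and int: "\<And>t f. 0 \<le> t \<Longrightarrow> i (K t f) = K' t (i f)" and t: "0 \<le> t"
  shows "i (conv_power K (Suc l) t f) = conv_power K' (Suc l) t (i f)"
  using t
proof (induction l arbitrary: t f)
  case (Suc l)
  have "i (op_conv K (conv_power K (Suc l)) t f) = op_conv (\<lambda>t f. i (K t f)) (conv_power K (Suc l)) t f"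
    by (rule op_conv_compose[OF i K conv_power_sc_family[OF K]])
  also have "\<dots> = op_conv K' (conv_power K' (Suc l)) t (i f)"
    unfolding op_conv_def by (rule integral_cong) (simp add: int Suc.IH)
  finally show ?case by simp
qed (simp add: int)

lemma semigroup_of_generator:
  assumes "generates_c0_semigroup P"
  shows "c0_semigroup (semigroup_of P)" "generator (semigroup_of P) = P"
  using someI_ex[of "\<lambda>S. c0_semigroup S \<and> generator S = P"] assms
  by (auto simp: generates_c0_semigroup_def semigroup_of_def)

section \<open>The equivalence\<close>

text \<open>Everything the main argument uses about the splitting, on either of the two spaces.\<close>

lemma bounded_part_decomposition:
  fixes L A B :: "'a::complex_banach operator"
  assumes L: "generates_c0_semigroup L" and sum: "L = op_add A B" and A: "bounded_op A"
    and diss: "hypodissipative (op_shift B a)"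
  shows "dom L = dom B" "\<And>f. f \<in> dom B \<Longrightarrow> the (L f) = the (A f) + the (B f)"
    "c0_semigroup (semigroup_of B)" "generator (semigroup_of B) = B" "exp_bounded a (semigroup_of B)"
proof -
  have A': "dom A = UNIV" "bounded_clinear (\<lambda>f. the (A f))" using A by (auto simp: bounded_op_def)
  show dom: "dom L = dom B" using A'(1) unfolding sum op_add_def by (auto simp: dom_def split: if_splits)
  show L_eq: "the (L f) = the (A f) + the (B f)" if "f \<in> dom B" for f
    using that A'(1) unfolding sum op_add_def by simp
  note SL = semigroup_of_generator[OF L]
  have "generates_c0_semigroup B"
    by (rule bounded_perturbation_generates[OF SL(1) A'(2)]) (simp_all add: SL(2) dom L_eq)
  note SB = semigroup_of_generator[OF this]
  show "c0_semigroup (semigroup_of B)" "generator (semigroup_of B) = B" by (rule SB)+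
  show "exp_bounded a (semigroup_of B)"
    by (rule hypodissipative_exp_bounded[OF SB(1)]) (simp add: SB(2) diss)
qed

theorem theorem1:
  fixes \<iota> :: "'a::complex_banach \<Rightarrow> 'b::complex_banach"
    and L A B :: "'a operator"
    and \<L> \<A> \<B> :: "'b operator"
    and a :: real
  assumes "cont_dense_embedding \<iota>"
    and "closed_op L" and "generates_c0_semigroup L"
    and "closed_op \<L>" and "generates_c0_semigroup \<L>"
    and "is_restriction \<iota> L \<L>"
    and "closed_op A" and "closed_op B" and "closed_op \<A>" and "closed_op \<B>"
    and "\<L> = op_add \<A> \<B>" and "L = op_add A B"
    and "is_restriction \<iota> A \<A>" and "is_restriction \<iota> B \<B>"
    and "hypodissipative (op_shift B a)" and "hypodissipative (op_shift \<B> a)"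
    and "bounded_op A" and "bounded_op \<A>"
    and "\<exists>n\<ge>1. \<exists>C>0. \<forall>t\<ge>0.
      bounded_into \<iota> (conv_power (\<lambda>t f. the (\<A> (semigroup_of \<B> t f))) n t) \<and>
      bounded_into \<iota> (conv_power (\<lambda>t f. semigroup_of \<B> t (the (\<A> f))) n t) \<and>
      norm_into \<iota> (conv_power (\<lambda>t f. the (\<A> (semigroup_of \<B> t f))) n t) +
      norm_into \<iota> (conv_power (\<lambda>t f. semigroup_of \<B> t (the (\<A> f))) n t) \<le> C * exp (a * t)"
  shows "finite_rank_asymptotics a L \<longleftrightarrow> finite_rank_asymptotics a \<L>"
proof -
  note emb = assms(1) and restrL = assms(6) and restrA = assms(13) and restrB = assms(14)
  have \<iota>: "bounded_clinear \<iota>" "inj \<iota>" "closure (range \<iota>) = UNIV"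
    using emb by (auto simp: cont_dense_embedding_def)
  define S S' U U' where "S = semigroup_of L" and "S' = semigroup_of \<L>"
    and "U = semigroup_of B" and "U' = semigroup_of \<B>"
  define \<alpha> \<alpha>' where "\<alpha> = (\<lambda>f. the (A f))" and "\<alpha>' = (\<lambda>g. the (\<A> g))"
  have \<alpha>: "bounded_clinear \<alpha>" "bounded_clinear \<alpha>'" and \<iota>\<alpha>: "\<iota> (\<alpha> f) = \<alpha>' (\<iota> f)" for f
    using assms(17,18) restrA by (auto simp: bounded_op_def \<alpha>_def \<alpha>'_def is_restriction_def)
  note S = semigroup_of_generator[OF assms(3), folded S_def]
  note S' = semigroup_of_generator[OF assms(5), folded S'_def]
  note U = bounded_part_decomposition[OF assms(3,12,17,15), folded U_def]
  note U' = bounded_part_decomposition[OF assms(5,11,18,16), folded U'_def]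
  note sc = c0_semigroup_sc_family[OF S(1)] c0_semigroup_sc_family[OF S'(1)]
    c0_semigroup_sc_family[OF U(3)] c0_semigroup_sc_family[OF U'(3)]
  have \<iota>S: "\<iota> (S t f) = S' t (\<iota> f)" if "0 \<le> t" for t f
    by (rule semigroup_intertwine[OF S(1) S'(1) \<iota>(1) _ that])
      (use restrL in \<open>simp add: S(2) S'(2) is_restriction_def\<close>)
  have \<iota>U: "\<iota> (U t f) = U' t (\<iota> f)" if "0 \<le> t" for t f
    by (rule semigroup_intertwine[OF U(3) U'(3) \<iota>(1) _ that])
      (use restrB in \<open>simp add: U(4) U'(4) is_restriction_def\<close>)
  define H H' where "H = (\<lambda>t f. \<alpha> (U t f))" and "H' = (\<lambda>t g. \<alpha>' (U' t g))"
  define K K' where "K = (\<lambda>t f. U t (\<alpha> f))" and "K' = (\<lambda>t g. U' t (\<alpha>' g))"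
  have scHK: "sc_family H" "sc_family H'" "sc_family K" "sc_family K'"
    unfolding H_def H'_def K_def K'_def
    by (rule sc_family_compose[OF \<alpha>(1) sc(3)] sc_family_compose[OF \<alpha>(2) sc(4)]
        sc_family_precompose[OF sc(3) \<alpha>(1)] sc_family_precompose[OF sc(4) \<alpha>(2)])+
  note decU = exp_bounded_decays[OF U(5)] exp_bounded_decays[OF U'(5)]
  have decHK: "decays_beyond a H" "decays_beyond a H'" "decays_beyond a K" "decays_beyond a K'"
    unfolding H_def H'_def K_def K'_def
    by (rule decays_beyond_compose[OF \<alpha>(1) decU(1)] decays_beyond_compose[OF \<alpha>(2) decU(2)]
        decays_beyond_precompose[OF decU(1) \<alpha>(1)] decays_beyond_precompose[OF decU(2) \<alpha>(2)])+
  have domL: "dom (generator S) = dom (generator U)" "dom (generator S') = dom (generator U')"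
    using U(1) U'(1) S(2) S'(2) U(4) U'(4) by simp_all
  have genL: "the (generator S f) = \<alpha> f + the (generator U f)" if "f \<in> dom (generator U)" for f
    using U(2) that by (simp add: S(2) U(4) \<alpha>_def)
  have genL': "the (generator S' f) = \<alpha>' f + the (generator U' f)" if "f \<in> dom (generator U')" for f
    using U'(2) that by (simp add: S'(2) U'(4) \<alpha>'_def)
  note duh = duhamel_left[OF S(1) U(3) \<alpha>(1) domL(1) genL, folded K_def]
    duhamel_right[OF S(1) U(3) \<alpha>(1) domL(1) genL, folded H_def]
    duhamel_left[OF S'(1) U'(3) \<alpha>(2) domL(2) genL', folded K'_def]
    duhamel_right[OF S'(1) U'(3) \<alpha>(2) domL(2) genL', folded H'_def]
  obtain n C where n: "n \<ge> 1" and into: "\<And>t. 0 \<le> t \<Longrightarrow> bounded_into \<iota> (conv_power H' n t)"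
    "\<And>t. 0 \<le> t \<Longrightarrow> bounded_into \<iota> (conv_power K' n t)"
    and sum: "\<And>t. 0 \<le> t \<Longrightarrow> norm_into \<iota> (conv_power H' n t) + norm_into \<iota> (conv_power K' n t) \<le> C * exp (a * t)"
    using assms(19)[folded U'_def \<alpha>'_def[THEN fun_cong], folded H'_def K'_def] unfolding H'_def K'_def \<alpha>'_def U'_def by blast
  obtain l where l: "n = Suc l" using n by (cases n) auto
  have pos: "0 \<le> norm_into \<iota> X" if "bounded_into \<iota> X" for X
    using that onorm_pos_le[OF bounded_clinear_linear] unfolding bounded_into_def norm_into_def by blast
  have nH: "norm_into \<iota> (conv_power H' n t) \<le> C * exp (a * t)"
    and nK: "norm_into \<iota> (conv_power K' n t) \<le> C * exp (a * t)" if "0 \<le> t" for t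
    using sum[OF that] pos[OF into(1)[OF that]] pos[OF into(2)[OF that]] by linarith+
  have \<iota>H: "\<iota> (conv_power H n t f) = conv_power H' n t (\<iota> f)" if "0 \<le> t" for t f
    unfolding l by (rule conv_power_intertwine[OF \<iota>(1) scHK(1) _ that]) (simp add: H_def H'_def \<iota>\<alpha> \<iota>U)
  have \<iota>K: "\<iota> (conv_power K n t f) = conv_power K' n t (\<iota> f)" if "0 \<le> t" for t f
    unfolding l by (rule conv_power_intertwine[OF \<iota>(1) scHK(3) _ that]) (simp add: K_def K'_def \<iota>\<alpha> \<iota>U)
  have scn: "sc_family (conv_power H n)" "sc_family (conv_power K n)"
    unfolding l by (rule conv_power_sc_family[OF scHK(1)], rule conv_power_sc_family[OF scHK(3)])
  obtain TH where TH: "sc_family TH" "exp_bounded a TH" "\<And>t g. 0 \<le> t \<Longrightarrow> \<iota> (TH t g) = conv_power H' n t g"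
    "\<And>t f. 0 \<le> t \<Longrightarrow> TH t (\<iota> f) = conv_power H n t f"
    by (rule strongly_continuous_into[OF emb scn(1) \<iota>H into(1) nH]) (assumption+, rule that)
  obtain TK where TK: "sc_family TK" "exp_bounded a TK" "\<And>t g. 0 \<le> t \<Longrightarrow> \<iota> (TK t g) = conv_power K' n t g"
    "\<And>t f. 0 \<le> t \<Longrightarrow> TK t (\<iota> f) = conv_power K n t f"
    by (rule strongly_continuous_into[OF emb scn(2) \<iota>K into(2) nK]) (assumption+, rule that)
  have "semigroup_asymptotics a S'" if "semigroup_asymptotics a S"
  proof -
    obtain Y where Y: "sc_family Y" "decays_beyond a Y"
      "\<And>t f. 0 \<le> t \<Longrightarrow> S t f = Y t f + op_conv S (conv_power H (Suc l)) t f"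
      by (rule iterated_duhamel_right[where l = l, OF sc(1) sc(3) decU(1) scHK(1) decHK(1) duh(2)]) (assumption+, rule that)
    obtain Y' where Y': "sc_family Y'" "decays_beyond a Y'"
      "\<And>t f. 0 \<le> t \<Longrightarrow> S' t f = Y' t f + op_conv S' (conv_power H' (Suc l)) t f"
      by (rule iterated_duhamel_right[where l = l, OF sc(2) sc(4) decU(2) scHK(2) decHK(2) duh(4)]) (assumption+, rule that)
    show ?thesis
    proof (rule enlargement[OF S(1) S'(1) \<iota>(1,3) \<iota>S TH(1,2) Y(2) Y'(2) _ _ that])
      show "S t f = Y t f + op_conv S (\<lambda>t f. TH t (\<iota> f)) t f" if t: "0 \<le> t" for t f
        using Y(3)[OF t, of f] op_conv_cong[of S S "\<lambda>t f. TH t (\<iota> f)" "conv_power H n" t f] TH(4) l by simp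
      show "S' t g = Y' t g + op_conv S' (\<lambda>t g. \<iota> (TH t g)) t g" if t: "0 \<le> t" for t g
        using Y'(3)[OF t, of g] op_conv_cong[of S' S' "\<lambda>t g. \<iota> (TH t g)" "conv_power H' n" t g] TH(3) l by simp
    qed
  qed
  moreover have "semigroup_asymptotics a S" if "semigroup_asymptotics a S'"
  proof -
    obtain Y where Y: "sc_family Y" "decays_beyond a Y"
      "\<And>t f. 0 \<le> t \<Longrightarrow> S t f = Y t f + op_conv (conv_power K (Suc l)) S t f"
      by (rule iterated_duhamel_left[where l = l, OF sc(1) sc(3) decU(1) scHK(3) decHK(3) duh(1)]) (assumption+, rule that)
    obtain Y' where Y': "sc_family Y'" "decays_beyond a Y'"
      "\<And>t f. 0 \<le> t \<Longrightarrow> S' t f = Y' t f + op_conv (conv_power K' (Suc l)) S' t f"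
      by (rule iterated_duhamel_left[where l = l, OF sc(2) sc(4) decU(2) scHK(4) decHK(4) duh(3)]) (assumption+, rule that)
    show ?thesis
    proof (rule shrinking[OF S(1) S'(1) \<iota>(1,2) \<iota>S TK(1,2) Y(2) Y'(2) _ _ that])
      show "S t f = Y t f + op_conv (\<lambda>t f. TK t (\<iota> f)) S t f" if t: "0 \<le> t" for t f
        using Y(3)[OF t, of f] op_conv_cong[of "\<lambda>t f. TK t (\<iota> f)" "conv_power K n" S S t f] TK(4) l by simp
      show "S' t g = Y' t g + op_conv (\<lambda>t g. \<iota> (TK t g)) S' t g" if t: "0 \<le> t" for t g
        using Y'(3)[OF t, of g] op_conv_cong[of "\<lambda>t g. \<iota> (TK t g)" "conv_power K' n" S' S' t g] TK(3) l by simp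
    qed
  qed
  moreover have "finite_rank_asymptotics a L \<longleftrightarrow> semigroup_asymptotics a S"
    by (rule finite_rank_asymptotics_iff[OF S]) (simp add: S_def)
  moreover have "finite_rank_asymptotics a \<L> \<longleftrightarrow> semigroup_asymptotics a S'"
    by (rule finite_rank_asymptotics_iff[OF S']) (simp add: S'_def)
  ultimately show ?thesis by blast
qed

end
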